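(* Let $d,d'\ge1$ and let $L_X:\mathbb{Z}_+^2\to\mathbb{Z}^d$, $L_Y:\mathbb{Z}_+^2\to\mathbb{Z}^{d'}$ be link-functions with $\max\{\Delta_{L_X},\Delta_{L_Y}\}<\infty$ that are compatible and jointly circular. Let $\{x_\alpha\}_{\alpha\in\mathbb{Z}^d}$ and $\{y_\beta\}_{\beta\in\mathbb{Z}^{d'}}$ be two collections of real random variables on a common probability space, and let $M_n=(x_{L_X(i,j)}y_{L_Y(i,j)})_{1\le i,j\le n}$ for $n\ge1$. Let $c$ be a circular variable in some $*$-probability space $(\mathcal{A},\varphi)$. (a) Suppose that $\{x_\alpha\}$ and $\{y_\beta\}$ are independent of each other and that each is an admissible strongly multiplicative system (SMS) with uniformly bounded moments of all orders (i.e. $\sup_\alpha\mathbb{E}|x_\alpha|^p<\infty$ and $\sup_\beta\mathbb{E}|y_\beta|^p<\infty$ for every $p\ge1$). Then for every $Q\in\mathbb{C}\langle X,X^*\rangle$, $$\frac1n\mathrm{tr}\,Q(n^{-1/2}M_n,n^{-1/2}M_n^* )\to\varphi(Q(c,c^* ))\quad\text{in probability as } n\to\infty.$$ (b) Suppose that $\{x_\alpha\}$ and $\{y_\beta\}$ are independent of each other and that each is a collection of independent random variables with zero mean, unit variance and uniformly bounded moments of all orders (i.e. $\sup_\alpha\mathbb{E}|x_\alpha|^p<\infty$ and $\sup_\beta\mathbb{E}|y_\beta|^p<\infty$ for every $p\ge1$). Then almost surely, for every $Q\in\mathbb{C}\langle X,X^*\rangle$, $$\frac1n\mathrm{tr}\,Q(n^{-1/2}M_n,n^{-1/2}M_n^*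 )\to\varphi(Q(c,c^* ))\quad\text{as } n\to\infty.$$ As a consequence, almost surely, $n^{-1/2}M_n$, as an element of the $*$-probability space $(\mathcal{M}_n(\mathbb{C}),\frac1n\mathrm{tr})$, converges in $*$-distribution to a circular variable.
   Context: Notation: $\mathbb{Z}_+=\{1,2,\dots\}$, $[n]=\{1,\dots,n\}$; $\mathbb{C}\langle X,X^*\rangle$ is the algebra of polynomials in two non-commuting indeterminates $X,X^*$. For a link-function $L$, $$\Delta_L=\sup_n\sup_{t\in\mathrm{range}(L)}\max\Big\{\sup_{j\in[n]}\#\{i\in[n]:L(i,j)=t\},\ \sup_{i\in[n]}\#\{j\in[n]:L(i,j)=t\}\Big\}.$$ Set $L^1(i,j)=L(i,j)$ and $L^*(i,j)=L(j,i)$. Fix $k\ge1$ and $\epsilon=(\epsilon_1,\dots,\epsilon_{2k})\in\{1,*\}^{2k}$. A multi-index $\mathbf{i}=(i_1,\dots,i_{2k})\in[n]^{2k}$ (with $i_{2k+1}:=i_1$) induces the partition of $[2k]$ in which $u,v$ lie in the same block iff $L^{\epsilon_u}(i_u,i_{u+1})=L^{\epsilon_v}(i_v,i_{v+1})$. For a partition $\pi$ of $[2k]$, $[\pi]_L$ is the set of $\mathbf{i}\in[n]^{2k}$ whose induced partition is exactly $\pi$; $[\pi]_X:=[\pi]_{L_X}$, $[\pi]_Y:=[\pi]_{L_Y}$. $\mathcal{P}_2(2k)$ denotes the set of pair-partitions of $[2k]$ (all blocks of size 2) and $NC_2(2k)$ the non-crossing ones. $L_X,L_Y$ are compatible if for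 all $k\ge1$, all $\epsilon\in\{1,*\}^{2k}$ and all $\pi\ne\pi'$ in $\mathcal{P}_2(2k)$, $\#([\pi]_X\cap[\pi']_Y)/n^{1+k}\to0$ as $n\to\infty$. $L_X,L_Y$ are jointly circular if for all $k\ge1$, all $\epsilon\in\{1,*\}^{2k}$ and all $\pi\in\mathcal{P}_2(2k)$, $\#([\pi]_X\cap[\pi]_Y)/n^{1+k}$ converges as $n\to\infty$ to $\prod_{\{r,s\}\in\pi}(1-\delta_{\epsilon_r,\epsilon_s})$ if $\pi\in NC_2(2k)$, and to $0$ if $\pi\notin NC_2(2k)$. SMS: a collection $\{x_\alpha\}_{\alpha\in I}$ is a strongly multiplicative system (SMS) if for all $n\ge1$, all distinct $\alpha_1,\dots,\alpha_n\in I$ and all $\eta_1,\dots,\eta_n\in\{1,2\}$, $\mathbb{E}\prod_{k=1}^n x_{\alpha_k}^{\eta_k}$ equals $1$ if $\eta_1=\cdots=\eta_n=2$ and $0$ otherwise. An SMS in which every variable has all moments finite is admissible if for all $n\ge1$, all distinct $\alpha_1,\dots,\alpha_n\in I$ and all integers $\eta_1,\dots,\eta_n\ge1$, $\mathbb{E}\prod_{k=1}^n x_{\alpha_k}^{\eta_k}=0$ whenever at least one $\eta_k$ equals $1$. A $*$-probability space $(\mathcal{A},\varphi)$ is a unital $*$-algebra $\mathcal{A}$ over $\mathbb{C}$ with a linear functional $\varphi$ satisfying $\varphi(1)=1$ and $\varphi(a^*a)\ge0$ for all $a$. A semi-circular variable is a self-adjoint $s\in\mathcal{A}$ with $\varphi(s^k)=C_{k/2}$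 for $k$ even and $0$ for $k$ odd, where $C_m=\frac1{m+1}\binom{2m}{m}$. A circular variable is $c=(s_1+\mathrm{i}s_2)/\sqrt2$ with $s_1,s_2$ freely independent semi-circular variables. A sequence $a_n\in(\mathcal{A}_n,\varphi_n)$ converges in $*$-distribution to $a\in(\mathcal{A},\varphi)$ if $\varphi_n(Q(a_n,a_n^* ))\to\varphi(Q(a,a^* ))$ for all $Q\in\mathbb{C}\langle X,X^*\rangle$. *)

theory Defs
  imports
    "HOL-Probability.Probability"
    "HOL-Library.Poly_Mapping"
    "HOL-Library.Nonpos_Ints"
    "Jordan_Normal_Form.Schur_Decomposition"
begin

section \<open>Star-probability spaces\<close>

record 'a star_prob_struct = "(complex, 'a) module" +
  adj :: "'a \<Rightarrow> 'a"
  state :: "'a \<Rightarrow> complex"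

text \<open>
  The underlying algebra is given on an explicit carrier (a ring in the sense of HOL-Algebra,
  hence unital, that is also a module over the complex numbers), because the type of matrices
  contains matrices of all sizes at once.
\<close>

locale star_prob_space =
  alg?: ring A + vec?: Module.module "class_ring :: complex ring" A
  for A :: "('a, 'm) star_prob_struct_scheme" (structure) +
  assumes smult_mult_left:
      "\<lbrakk>a \<in> carrier A; b \<in> carrier A\<rbrakk> \<Longrightarrow> (z \<odot> a) \<otimes> b = z \<odot> (a \<otimes> b)"
    and smult_mult_right:
      "\<lbrakk>a \<in> carrier A; b \<in> carrier A\<rbrakk> \<Longrightarrow> a \<otimes> (z \<odot> b) = z \<odot> (a \<otimes> b)"
    and adj_closed: "a \<in> carrier A \<Longrightarrow> adj A a \<in> carrier A"
    and adj_adj: "a \<in> carrier A \<Longrightarrow> adj A (adj A a) = a"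
    and adj_add:
      "\<lbrakk>a \<in> carrier A; b \<in> carrier A\<rbrakk> \<Longrightarrow> adj A (a \<oplus> b) = adj A a \<oplus> adj A b"
    and adj_smult: "a \<in> carrier A \<Longrightarrow> adj A (z \<odot> a) = cnj z \<odot> adj A a"
    and adj_mult:
      "\<lbrakk>a \<in> carrier A; b \<in> carrier A\<rbrakk> \<Longrightarrow> adj A (a \<otimes> b) = adj A b \<otimes> adj A a"
    and state_add:
      "\<lbrakk>a \<in> carrier A; b \<in> carrier A\<rbrakk> \<Longrightarrow> state A (a \<oplus> b) = state A a + state A b"
    and state_smult: "a \<in> carrier A \<Longrightarrow> state A (z \<odot> a) = z * state A a"
    and state_one: "state A \<one> = 1"
    and state_nonneg: "a \<in> carrier A \<Longrightarrow> state A (adj A a \<otimes> a) \<in> \<real>\<^sub>\<ge>\<^sub>0"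

definition mat_trace :: "'a::comm_monoid_add mat \<Rightarrow> 'a" where
  "mat_trace B = (\<Sum>i<dim_row B. B $$ (i, i))"

definition mat_prob :: "nat \<Rightarrow> complex mat star_prob_struct" where
  "mat_prob n = module.extend (module_mat TYPE(complex) n n)
     (star_prob_struct.fields mat_adjoint (\<lambda>B. mat_trace B / of_nat n))"

lemma mat_prob_simps [simp]:
  "carrier (mat_prob n) = carrier_mat n n"
  "mult (mat_prob n) = (*)"
  "one (mat_prob n) = 1\<^sub>m n"
  "zero (mat_prob n) = 0\<^sub>m n n"
  "add (mat_prob n) = (+)"
  "smult (mat_prob n) = (\<cdot>\<^sub>m)"
  "adj (mat_prob n) = mat_adjoint"
  "state (mat_prob n) = (\<lambda>B. mat_trace B / of_nat n)"
  by (simp_all add: mat_prob_def module_mat_def module.defs star_prob_struct.defs)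

lemma mat_adjoint_index:
  assumes "B \<in> carrier_mat n n" "i < n" "j < n"
  shows "mat_adjoint B $$ (i, j) = conjugate (B $$ (j, i))"
  using assms by (simp add: mat_adjoint_def mat_of_rows_def)

lemma mat_adjoint_carrier:
  "B \<in> carrier_mat n n \<Longrightarrow> mat_adjoint B \<in> carrier_mat n n"
  by (auto simp: mat_adjoint_def)

lemma star_prob_space_mat:
  assumes "n \<ge> 1"
  shows "star_prob_space (mat_prob n)"
proof -
  have ring: "ring (mat_prob n)"
    by (unfold_locales)
      (use add_inv_exists_mat in \<open>auto simp: algebra_simps Units_def\<close>)
  have adj_mult: "mat_adjoint (a * b) = mat_adjoint b * mat_adjoint a"
    if "a \<in> carrier_mat n n" "b \<in> carrier_mat n n" for a b :: "complex mat"
  proof (rule eq_matI)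
    note carr = that mat_adjoint_carrier[OF that(1)] mat_adjoint_carrier[OF that(2)]
    show "dim_row (mat_adjoint (a * b)) = dim_row (mat_adjoint b * mat_adjoint a)"
      "dim_col (mat_adjoint (a * b)) = dim_col (mat_adjoint b * mat_adjoint a)"
      using carr mat_adjoint_carrier[OF mult_carrier_mat[OF that]] by auto
    fix i j assume "i < dim_row (mat_adjoint b * mat_adjoint a)"
      "j < dim_col (mat_adjoint b * mat_adjoint a)"
    then have ij: "i < n" "j < n" using carr by auto
    have "mat_adjoint (a * b) $$ (i, j) = cnj ((a * b) $$ (j, i))"
      using mat_adjoint_index[OF mult_carrier_mat[OF that] ij] by simp
    also have "\<dots> = (\<Sum>k<n. cnj (a $$ (j, k)) * cnj (b $$ (k, i)))"
      using that ij by (simp add: scalar_prod_def atLeast0LessThan)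
    also have "\<dots> = (mat_adjoint b * mat_adjoint a) $$ (i, j)"
      using carr ij by (simp add: scalar_prod_def atLeast0LessThan mat_adjoint_index mult.commute)
    finally show "mat_adjoint (a * b) $$ (i, j) = (mat_adjoint b * mat_adjoint a) $$ (i, j)" .
  qed
  have nonneg: "mat_trace (mat_adjoint a * a) / of_nat n \<in> \<real>\<^sub>\<ge>\<^sub>0"
    if a: "a \<in> carrier_mat n n" for a :: "complex mat"
  proof -
    have "mat_trace (mat_adjoint a * a) = (\<Sum>i<n. \<Sum>k<n. cnj (a $$ (k, i)) * a $$ (k, i))"
      using a mat_adjoint_carrier[OF a]
      by (simp add: mat_trace_def scalar_prod_def atLeast0LessThan mat_adjoint_index)
    also have "\<dots> = of_real (\<Sum>i<n. \<Sum>k<n. (cmod (a $$ (k, i)))\<^sup>2)"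
      by (simp add: complex_norm_square mult.commute del: of_real_power)
    finally have "mat_trace (mat_adjoint a * a) / of_nat n =
        of_real ((\<Sum>i<n. \<Sum>k<n. (cmod (a $$ (k, i)))\<^sup>2) / real n)" by simp
    then show ?thesis
      by (simp only: nonneg_Reals_of_real_iff) (simp add: sum_nonneg)
  qed
  have adj2: "mat_adjoint (mat_adjoint a) = a"
    "mat_adjoint (z \<cdot>\<^sub>m a) = cnj z \<cdot>\<^sub>m mat_adjoint a"
    if a: "a \<in> carrier_mat n n" for a :: "complex mat" and z
    using a mat_adjoint_carrier[OF a] mat_adjoint_carrier[OF mat_adjoint_carrier[OF a]]
      mat_adjoint_carrier[OF smult_carrier_mat[OF a, of z]]
      mat_adjoint_index[OF smult_carrier_mat[OF a, of z]]
    by (auto intro!: eq_matI simp: mat_adjoint_index[of _ n])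
  have adj_add: "mat_adjoint (a + b) = mat_adjoint a + mat_adjoint b"
    if "a \<in> carrier_mat n n" "b \<in> carrier_mat n n" for a b :: "complex mat"
    using that mat_adjoint_carrier[OF that(1)] mat_adjoint_carrier[OF that(2)]
      mat_adjoint_carrier[OF add_carrier_mat[OF that(2), of a]]
      mat_adjoint_index[OF add_carrier_mat[OF that(2), of a]]
    by (auto intro!: eq_matI simp: mat_adjoint_index[of _ n])
  interpret R: ring "mat_prob n" by (fact ring)
  have cring: "cring (class_ring :: complex ring)"
    by (rule class_cring.is_cring)
  have mod: "Module.module (class_ring :: complex ring) (mat_prob n)"
    by (rule moduleI[OF cring R.abelian_group_axioms])
       (auto simp: add_smult_distrib_right_mat add_smult_distrib_left_mat)
  have trace: "mat_trace (1\<^sub>m n :: complex mat) = of_nat n"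
    "mat_trace (a + b) = mat_trace a + mat_trace b"
    "mat_trace (z \<cdot>\<^sub>m a) = z * mat_trace a"
    if "a \<in> carrier_mat n n" "b \<in> carrier_mat n n" for a b :: "complex mat" and z
    using that by (auto simp: mat_trace_def sum.distrib sum_distrib_left)
  show ?thesis
    using assms trace(1)[OF zero_carrier_mat zero_carrier_mat]
    by (intro star_prob_space.intro ring mod star_prob_space_axioms.intro)
       (auto simp: mat_adjoint_carrier adj_mult nonneg adj2 adj_add trace(2,3) add_divide_distrib)
qed


section \<open>Non-commutative polynomials and convergence in star-distribution\<close>

datatype star_exp = Plain | Adj

text \<open>
  A polynomial in non-commuting \<open>X, X\<^sup>*\<close> is a finitely supported family of complex
  coefficients indexed by words; the word \<open>[e\<^sub>1, \<dots>, e\<^sub>m]\<close> stands for the monomial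
  \<open>X\<^bsup>e\<^sub>1\<^esup> \<cdots> X\<^bsup>e\<^sub>m\<^esup>\<close>.
\<close>

type_synonym nc_poly = "star_exp list \<Rightarrow>\<^sub>0 complex"

fun star_pow :: "('a, 'm) star_prob_struct_scheme \<Rightarrow> 'a \<Rightarrow> star_exp \<Rightarrow> 'a" where
  "star_pow A a Plain = a"
| "star_pow A a Adj = adj A a"

definition nc_monom :: "('a, 'm) star_prob_struct_scheme \<Rightarrow> 'a \<Rightarrow> star_exp list \<Rightarrow> 'a" where
  "nc_monom A a w = foldr (\<lambda>e b. star_pow A a e \<otimes>\<^bsub>A\<^esub> b) w \<one>\<^bsub>A\<^esub>"

text \<open>The value \<open>Q(a, a\<^sup>*)\<close>.\<close>

definition nc_eval :: "('a, 'm) star_prob_struct_scheme \<Rightarrow> nc_poly \<Rightarrow> 'a \<Rightarrow> 'a" where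
  "nc_eval A Q a =
     (\<Oplus>\<^bsub>A\<^esub>w\<in>Poly_Mapping.keys Q. Poly_Mapping.lookup Q w \<odot>\<^bsub>A\<^esub> nc_monom A a w)"

text \<open>Sequences are indexed by \<open>n \<ge> 1\<close>; the algebra of \<open>0 \<times> 0\<close> matrices carries no state.\<close>

definition converges_in_star_distribution ::
    "(nat \<Rightarrow> ('a, 'm) star_prob_struct_scheme) \<Rightarrow> (nat \<Rightarrow> 'a) \<Rightarrow>
     ('b, 'k) star_prob_struct_scheme \<Rightarrow> 'b \<Rightarrow> bool" where
  "converges_in_star_distribution An an A a \<longleftrightarrow>
     (\<forall>n\<ge>1. star_prob_space (An n) \<and> an n \<in> carrier (An n)) \<and>
     star_prob_space A \<and> a \<in> carrier A \<and>
     (\<forall>Q. (\<lambda>n. state (An n) (nc_eval (An n) Q (an n)))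
            \<longlonglongrightarrow> state A (nc_eval A Q a))"


section \<open>Free independence, semi-circular and circular variables\<close>

inductive_set generated_algebra ::
    "('a, 'm) star_prob_struct_scheme \<Rightarrow> 'a set \<Rightarrow> 'a set" for A S where
  gen: "s \<in> S \<Longrightarrow> s \<in> generated_algebra A S"
| one: "\<one>\<^bsub>A\<^esub> \<in> generated_algebra A S"
| add: "a \<in> generated_algebra A S \<Longrightarrow> b \<in> generated_algebra A S \<Longrightarrow>
        a \<oplus>\<^bsub>A\<^esub> b \<in> generated_algebra A S"
| mult: "a \<in> generated_algebra A S \<Longrightarrow> b \<in> generated_algebra A S \<Longrightarrow>
         a \<otimes>\<^bsub>A\<^esub> b \<in> generated_algebra A S"
| smult: "a \<in> generated_algebra A S \<Longrightarrow> z \<odot>\<^bsub>A\<^esub> a \<in> generated_algebra A S"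

text \<open>
  Freeness of a family of unital subalgebras: every alternating product of centred elements is
  centred. A list entry \<open>(j, a)\<close> is a factor \<open>a\<close> taken from the subalgebra \<open>B j\<close>.
\<close>

definition free_subalgebras ::
    "('a, 'm) star_prob_struct_scheme \<Rightarrow> ('i \<Rightarrow> 'a set) \<Rightarrow> bool" where
  "free_subalgebras A B \<longleftrightarrow>
     (\<forall>ps. ps \<noteq> [] \<and> distinct_adj (map fst ps) \<and>
           (\<forall>(j, a) \<in> set ps. a \<in> B j \<and> state A a = 0) \<longrightarrow>
           state A (foldr (\<lambda>(j, a) b. a \<otimes>\<^bsub>A\<^esub> b) ps \<one>\<^bsub>A\<^esub>) = 0)"

text \<open>
  Only used for self-adjoint \<open>s\<close> and \<open>t\<close>, for which the unital subalgebra generated is already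
  closed under the involution.
\<close>

definition freely_independent ::
    "('a, 'm) star_prob_struct_scheme \<Rightarrow> 'a \<Rightarrow> 'a \<Rightarrow> bool" where
  "freely_independent A s t \<longleftrightarrow>
     free_subalgebras A (case_bool (generated_algebra A {s}) (generated_algebra A {t}))"

definition catalan :: "nat \<Rightarrow> complex" where
  "catalan m = of_nat (2 * m choose m) / of_nat (m + 1)"

definition semicircular :: "('a, 'm) star_prob_struct_scheme \<Rightarrow> 'a \<Rightarrow> bool" where
  "semicircular A s \<longleftrightarrow> s \<in> carrier A \<and> adj A s = s \<and>
     (\<forall>k. state A (s [^]\<^bsub>A\<^esub> (k::nat)) = (if even k then catalan (k div 2) else 0))"

definition circular :: "('a, 'm) star_prob_struct_scheme \<Rightarrow> 'a \<Rightarrow> bool" where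
  "circular A c \<longleftrightarrow>
     (\<exists>s t. semicircular A s \<and> semicircular A t \<and> freely_independent A s t \<and>
        c = (1 / complex_of_real (sqrt 2)) \<odot>\<^bsub>A\<^esub> (s \<oplus>\<^bsub>A\<^esub> (\<i> \<odot>\<^bsub>A\<^esub> t)))"


section \<open>Link functions\<close>

text \<open>
  A link function is a function of two positive integers; its values at index 0 are never used.
\<close>

definition link_range :: "(nat \<Rightarrow> nat \<Rightarrow> 't) \<Rightarrow> 't set" where
  "link_range L = {L i j | i j. 1 \<le> i \<and> 1 \<le> j}"

definition link_Delta :: "(nat \<Rightarrow> nat \<Rightarrow> 't) \<Rightarrow> enat" where
  "link_Delta L = (SUP n\<in>{1..}. SUP t\<in>link_range L.
     max (SUP j\<in>{1..n}. enat (card {i\<in>{1..n}. L i j = t}))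
         (SUP i\<in>{1..n}. enat (card {j\<in>{1..n}. L i j = t})))"

fun link_pow :: "(nat \<Rightarrow> nat \<Rightarrow> 't) \<Rightarrow> star_exp \<Rightarrow> nat \<Rightarrow> nat \<Rightarrow> 't" where
  "link_pow L Plain i j = L i j"
| "link_pow L Adj i j = L j i"

text \<open>
  Multi-indices and exponents of length \<open>m\<close> are functions on \<open>{1..m}\<close>; the index following
  \<open>m\<close> is \<open>1\<close>.
\<close>

definition cyc_succ :: "nat \<Rightarrow> nat \<Rightarrow> nat" where
  "cyc_succ m u = (if u = m then 1 else u + 1)"

definition link_value ::
    "(nat \<Rightarrow> nat \<Rightarrow> 't) \<Rightarrow> nat \<Rightarrow> (nat \<Rightarrow> star_exp) \<Rightarrow> (nat \<Rightarrow> nat) \<Rightarrow> nat \<Rightarrow> 't" where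
  "link_value L m \<epsilon> i u = link_pow L (\<epsilon> u) (i u) (i (cyc_succ m u))"

definition induced_partition ::
    "(nat \<Rightarrow> nat \<Rightarrow> 't) \<Rightarrow> nat \<Rightarrow> (nat \<Rightarrow> star_exp) \<Rightarrow> (nat \<Rightarrow> nat) \<Rightarrow> nat set set" where
  "induced_partition L m \<epsilon> i =
     {1..m} // {(u, v). u \<in> {1..m} \<and> v \<in> {1..m} \<and>
                        link_value L m \<epsilon> i u = link_value L m \<epsilon> i v}"

text \<open>The set \<open>[\<pi>]\<^sub>L\<close>, with its dependence on \<open>k\<close>, \<open>\<epsilon>\<close> and \<open>n\<close> made explicit.\<close>

definition partition_class ::
    "(nat \<Rightarrow> nat \<Rightarrow> 't) \<Rightarrow> nat \<Rightarrow> (nat \<Rightarrow> star_exp) \<Rightarrow> nat \<Rightarrow> nat set set \<Rightarrow> (nat \<Rightarrow> nat) set" where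
  "partition_class L k \<epsilon> n \<pi> =
     {i \<in> {1..2*k} \<rightarrow>\<^sub>E {1..n}. induced_partition L (2*k) \<epsilon> i = \<pi>}"

definition pair_partitions :: "nat \<Rightarrow> nat set set set" where
  "pair_partitions m = {\<pi>. partition_on {1..m} \<pi> \<and> (\<forall>B\<in>\<pi>. card B = 2)}"

definition noncrossing :: "nat set set \<Rightarrow> bool" where
  "noncrossing \<pi> \<longleftrightarrow>
     \<not> (\<exists>B\<in>\<pi>. \<exists>B'\<in>\<pi>. B \<noteq> B' \<and>
          (\<exists>a b c d. a < b \<and> b < c \<and> c < d \<and> a \<in> B \<and> c \<in> B \<and> b \<in> B' \<and> d \<in> B'))"

definition nc_pair_partitions :: "nat \<Rightarrow> nat set set set" where
  "nc_pair_partitions m = {\<pi> \<in> pair_partitions m. noncrossing \<pi>}"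

definition compatible ::
    "(nat \<Rightarrow> nat \<Rightarrow> 's) \<Rightarrow> (nat \<Rightarrow> nat \<Rightarrow> 't) \<Rightarrow> bool" where
  "compatible LX LY \<longleftrightarrow>
     (\<forall>k\<ge>1. \<forall>\<epsilon>. \<forall>\<pi>\<in>pair_partitions (2*k). \<forall>\<pi>'\<in>pair_partitions (2*k). \<pi> \<noteq> \<pi>' \<longrightarrow>
        (\<lambda>n. real (card (partition_class LX k \<epsilon> n \<pi> \<inter> partition_class LY k \<epsilon> n \<pi>')) / real n ^ (1 + k))
          \<longlonglongrightarrow> 0)"

text \<open>A block \<open>{r, s}\<close> of a pair-partition is accessed through its minimum and maximum.\<close>

definition jointly_circular ::
    "(nat \<Rightarrow> nat \<Rightarrow> 's) \<Rightarrow> (nat \<Rightarrow> nat \<Rightarrow> 't) \<Rightarrow> bool" where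
  "jointly_circular LX LY \<longleftrightarrow>
     (\<forall>k\<ge>1. \<forall>\<epsilon>. \<forall>\<pi>\<in>pair_partitions (2*k).
        (\<lambda>n. real (card (partition_class LX k \<epsilon> n \<pi> \<inter> partition_class LY k \<epsilon> n \<pi>)) / real n ^ (1 + k))
          \<longlonglongrightarrow> (if \<pi> \<in> nc_pair_partitions (2*k)
             then \<Prod>B\<in>\<pi>. 1 - (if \<epsilon> (Min B) = \<epsilon> (Max B) then 1 else 0)
             else 0))"


section \<open>Random variables\<close>

definition SMS :: "'w measure \<Rightarrow> 'i set \<Rightarrow> ('i \<Rightarrow> 'w \<Rightarrow> real) \<Rightarrow> bool" where
  "SMS P I x \<longleftrightarrow>
     (\<forall>n\<ge>1. \<forall>\<alpha> \<eta>. inj_on \<alpha> {1..n} \<and> \<alpha> ` {1..n} \<subseteq> I \<and> (\<forall>k\<in>{1..n}. \<eta> k \<in> {1, 2::nat}) \<longrightarrow>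
        has_bochner_integral P (\<lambda>\<omega>. \<Prod>k\<in>{1..n::nat}. x (\<alpha> k) \<omega> ^ \<eta> k)
          (if \<forall>k\<in>{1..n}. \<eta> k = 2 then 1 else 0))"

definition admissible_SMS :: "'w measure \<Rightarrow> 'i set \<Rightarrow> ('i \<Rightarrow> 'w \<Rightarrow> real) \<Rightarrow> bool" where
  "admissible_SMS P I x \<longleftrightarrow> SMS P I x \<and>
     (\<forall>\<alpha>\<in>I. \<forall>p::nat. integrable P (\<lambda>\<omega>. x \<alpha> \<omega> ^ p)) \<and>
     (\<forall>n\<ge>1. \<forall>\<alpha> \<eta>. inj_on \<alpha> {1..n} \<and> \<alpha> ` {1..n} \<subseteq> I \<and> (\<forall>k\<in>{1..n}. \<eta> k \<ge> (1::nat)) \<and>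
        (\<exists>k\<in>{1..n}. \<eta> k = 1) \<longrightarrow>
        has_bochner_integral P (\<lambda>\<omega>. \<Prod>k\<in>{1..n::nat}. x (\<alpha> k) \<omega> ^ \<eta> k) 0)"

definition uniformly_bounded_moments :: "'w measure \<Rightarrow> ('i \<Rightarrow> 'w \<Rightarrow> real) \<Rightarrow> bool" where
  "uniformly_bounded_moments P x \<longleftrightarrow>
     (\<forall>p\<ge>1::nat. (SUP \<alpha>. \<integral>\<^sup>+\<omega>. ennreal (\<bar>x \<alpha> \<omega>\<bar> ^ p) \<partial>P) < \<infinity>)"

text \<open>
  The two generated \<open>\<sigma>\<close>-algebras are independent. The library's \<^const>\<open>prob_space.indep_var\<close>
  is not applicable, as it requires both variables to take values in the same type.
\<close>

definition independent_collections ::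
    "'w measure \<Rightarrow> ('i \<Rightarrow> 'w \<Rightarrow> real) \<Rightarrow> ('j \<Rightarrow> 'w \<Rightarrow> real) \<Rightarrow> bool" where
  "independent_collections P x y \<longleftrightarrow>
     prob_space.indep_set P
       (sets (vimage_algebra (space P) (\<lambda>\<omega> \<alpha>. x \<alpha> \<omega>) (Pi\<^sub>M UNIV (\<lambda>_. borel))))
       (sets (vimage_algebra (space P) (\<lambda>\<omega> \<beta>. y \<beta> \<omega>) (Pi\<^sub>M UNIV (\<lambda>_. borel))))"

definition independent_standardized :: "'w measure \<Rightarrow> ('i \<Rightarrow> 'w \<Rightarrow> real) \<Rightarrow> bool" where
  "independent_standardized P x \<longleftrightarrow>
     prob_space.indep_vars P (\<lambda>_. borel) x UNIV \<and>
     (\<forall>\<alpha>. has_bochner_integral P (x \<alpha>) 0 \<and> prob_space.variance P (x \<alpha>) = 1)"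

definition converges_in_probability ::
    "'w measure \<Rightarrow> (nat \<Rightarrow> 'w \<Rightarrow> 'b::metric_space) \<Rightarrow> 'b \<Rightarrow> bool" where
  "converges_in_probability P Z l \<longleftrightarrow>
     (\<forall>e>0. (\<lambda>n. measure P {\<omega> \<in> space P. dist (Z n \<omega>) l > e}) \<longlonglongrightarrow> 0)"

text \<open>
  Matrix indices start at 0 in the library, whence the shift by one. The matrix is real, but it is
  regarded as an element of the algebra of complex matrices.
\<close>

definition link_matrix ::
    "(nat \<Rightarrow> nat \<Rightarrow> 's) \<Rightarrow> (nat \<Rightarrow> nat \<Rightarrow> 't) \<Rightarrow> ('s \<Rightarrow> 'w \<Rightarrow> real) \<Rightarrow> ('t \<Rightarrow> 'w \<Rightarrow> real) \<Rightarrow>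
     nat \<Rightarrow> 'w \<Rightarrow> complex mat" where
  "link_matrix LX LY x y n \<omega> = Matrix.mat n n
     (\<lambda>(i, j). complex_of_real (x (LX (Suc i) (Suc j)) \<omega> * y (LY (Suc i) (Suc j)) \<omega>))"

definition scaled_link_matrix ::
    "(nat \<Rightarrow> nat \<Rightarrow> 's) \<Rightarrow> (nat \<Rightarrow> nat \<Rightarrow> 't) \<Rightarrow> ('s \<Rightarrow> 'w \<Rightarrow> real) \<Rightarrow> ('t \<Rightarrow> 'w \<Rightarrow> real) \<Rightarrow>
     nat \<Rightarrow> 'w \<Rightarrow> complex mat" where
  "scaled_link_matrix LX LY x y n \<omega> =
     complex_of_real (1 / sqrt (real n)) \<cdot>\<^sub>m link_matrix LX LY x y n \<omega>"

end

theory Submission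
  imports Defs "HOL-Number_Theory.Cong" "HOL-Real_Asymp.Real_Asymp"
begin

text \<open>
  The normalized trace of a word in \<open>n\<^bsup>-1/2\<^esup> M\<^sub>n\<close> and its adjoint is a sum over multi-indices.
  In its expectation only multi-indices inducing pair partitions, the same for both link functions,
  survive, and joint circularity turns them into non-crossing pairings of letters with opposite
  exponents.  These count the mixed moments of a circular variable: the Wick products of
  \<open>c\<close> and \<open>c\<^sup>*\<close> are centred by freeness, and expanding a word in Wick products is a stack machine
  whose runs are exactly these pairings.

  The fluctuations are controlled one family at a time through
  \<open>X Y - E X E Y = (X - E X) Y + E X (Y - E Y)\<close>.  An \<open>r\<close>-fold product of centred factors has
  non-zero expectation only if every cycle shares a label with another cycle, or (for \<open>r = 2\<close>) if
  some label is taken three times.  Rotating each cycle so that a shared edge closes it saves a power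
  of \<open>n\<close> for a fixed fraction of the cycles.  Two cycles give a variance of order \<open>1/n\<close>, and
  twelve cycles give a twelfth centred moment of order \<open>1/n\<^sup>2\<close>, which is summable.
\<close>

section \<open>Counting multi-indices with repeated labels\<close>

text \<open>The moments of an admissible strongly multiplicative system are prescribed only if every
  label occurs exactly twice or some label occurs once; nothing is known to factor over disjoint
  labels. Two unlinked cycles are therefore seen to cancel only if all labels are paired, since then
  every moment in the expansion equals 1. Configurations of two cycles with a triple label have to
  be counted: they lose a label, hence a power of \<open>n\<close>. For independent variables an
  unlinked cycle splits off whatever the number of cycles, which opens the way to higher moments in
  (b).

  The gain from linking is a sixth of a power of \<open>n\<close> per cycle, measured against one
  free vertex per pair and one starting vertex per cycle. A position in a block of size at least
  three costs at least 1/6 of a label; a closing edge whose partner lies in a later cycle gains a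
  whole vertex, and at least half of the remaining closing edges achieve this in one of the two
  orders. After normalization this leaves \<open>n\<close> to the power \<open>- r / 6\<close>,
  rounded down, so that \<open>r = 2\<close> gives 1/n and \<open>r = 12\<close> gives
  1/n^2.\<close>

type_synonym 't link = "nat \<Rightarrow> nat \<Rightarrow> 't"
type_synonym exponents = "nat \<Rightarrow> star_exp"
type_synonym config = "nat \<Rightarrow> nat \<Rightarrow> nat"

abbreviation multi_indices :: "nat \<Rightarrow> nat \<Rightarrow> (nat \<Rightarrow> nat) set" where
  "multi_indices m n \<equiv> {1..m} \<rightarrow>\<^sub>E {1..n}"

definition link_bounded :: "'t link \<Rightarrow> nat \<Rightarrow> bool" where
  "link_bounded L K \<longleftrightarrow>
     (\<forall>n. \<forall>v\<in>{1..n}. \<forall>s e. card {w\<in>{1..n}. link_pow L e v w = s} \<le> K)"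

lemma link_bounded_of_Delta:
  assumes "link_Delta L < \<infinity>"
  obtains K where "link_bounded L K"
proof -
  obtain K where K: "link_Delta L = enat K"
    using assms by (cases "link_Delta L") auto
  have "card {w\<in>{1..n}. link_pow L e v w = s} \<le> K" if v: "v \<in> {1..n}" for n v s e
  proof (cases "s \<in> link_range L")
    case True
    have le: "max (SUP j\<in>{1..n}. enat (card {i\<in>{1..n}. L i j = s}))
              (SUP i\<in>{1..n}. enat (card {j\<in>{1..n}. L i j = s})) \<le> enat K"
      unfolding K[symmetric] link_Delta_def using v True
      by (intro SUP_upper2[of n] SUP_upper2[of s]) auto
    have "enat (card {i\<in>{1..n}. L i v = s}) \<le> enat K" "enat (card {j\<in>{1..n}. L v j = s}) \<le> enat K"
      by (rule order_trans[OF _ order_trans[OF max.cobounded1 le]], rule SUP_upper[OF v])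
         (rule order_trans[OF _ order_trans[OF max.cobounded2 le]], rule SUP_upper[OF v])
    then show ?thesis by (cases e) auto
  next
    case False
    then have "{w\<in>{1..n}. link_pow L e v w = s} = {}"
      using v by (cases e) (auto simp: link_range_def)
    then show ?thesis by (simp only: card.empty)
  qed
  then show ?thesis using that unfolding link_bounded_def by blast
qed

text \<open>A traversal visits the vertices \<open>g 0, g 1, \<dots>\<close>.  The edge at \<open>t\<close> ends in \<open>g (nx t)\<close>, which is the
  next vertex unless the edge closes a cycle.\<close>

definition step_label ::
    "'t link \<Rightarrow> exponents \<Rightarrow> (nat \<Rightarrow> nat) \<Rightarrow> (nat \<Rightarrow> nat) \<Rightarrow> nat \<Rightarrow> 't" where
  "step_label L e nx g t = link_pow L (e t) (g t) (g (nx t))"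

abbreviation label_repeats where
  "label_repeats L e nx g t \<equiv> \<exists>t'<t. step_label L e nx g t' = step_label L e nx g t"

text \<open>Let the vertices be chosen one after another. An edge in \<open>D\<close> ends in the
  vertex chosen next, and its label must agree with one of at most \<open>N\<close> earlier labels;
  each of them leaves at most \<open>K\<close> choices for that vertex instead of \<open>n\<close>.
  Since \<open>nx t\<close> is at most \<open>Suc t\<close>, the earlier labels are settled before
  this choice. The bound \<open>N\<close> is separate from \<open>q\<close> because \<open>q\<close>
  shrinks in the induction.\<close>

lemma card_constrained_steps:
  assumes K: "link_bounded L K" and nx: "\<And>t. nx t \<le> Suc t"
    and D: "D \<subseteq> {t. Suc t < q \<and> nx t = Suc t}" and q: "q \<le> N"
  shows "card {g \<in> {..<q} \<rightarrow>\<^sub>E {1..n}. \<forall>t\<in>D. \<exists>t'<t. step_label L e nx g t' = step_label L e nx g t}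
           \<le> n ^ (q - card D) * (N * K) ^ card D"
  using D q
proof (induction q arbitrary: D)
  case 0
  then show ?case by auto
next
  case (Suc q)
  define C where "C q D = {g \<in> {..<q} \<rightarrow>\<^sub>E {1..n}. \<forall>t\<in>D. \<exists>t'<t.
      step_label L e nx g t' = step_label L e nx g t}" for q :: nat and D
  define D' where "D' = {t\<in>D. Suc t < q}"
  define W where "W h = {w\<in>{1..n}. h(q := w) \<in> C (Suc q) D}" for h
  have fin: "finite (C q D)" for q D
    unfolding C_def by (rule finite_subset[of _ "{..<q} \<rightarrow>\<^sub>E {1..n}"]) (auto intro: finite_PiE)
  have D'sub: "D' \<subseteq> {t. Suc t < q \<and> nx t = Suc t}" using Suc.prems(1) by (auto simp: D'_def)
  have finD: "finite D" by (rule finite_subset[OF Suc.prems(1)]) auto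
  have upd: "step_label L e nx (h(q := w)) t = step_label L e nx h t" if "Suc t < q" for h w t
    using nx[of t] that by (auto simp: step_label_def)
  \<comment> \<open>Forgetting the last vertex means resetting it to \<open>undefined\<close>, as
    the extensional function space demands; \<open>W h\<close> is the fibre over the shorter
    traversal \<open>h\<close>.\<close>
  have cov: "C (Suc q) D \<subseteq> (\<lambda>(h, w). h(q := w)) ` (SIGMA h:C q D'. W h)"
  proof
    fix g assume g: "g \<in> C (Suc q) D"
    define h where "h = g(q := undefined)"
    have gh: "g = h(q := g q)" by (auto simp: h_def)
    have hP: "h \<in> {..<q} \<rightarrow>\<^sub>E {1..n}"
      using g unfolding C_def h_def PiE_def Pi_def extensional_def by auto
    have "\<exists>t'<t. step_label L e nx h t' = step_label L e nx h t" if "t \<in> D'" for t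
    proof -
      have "t \<in> D" using that by (simp add: D'_def)
      then have "\<exists>t'<t. step_label L e nx g t' = step_label L e nx g t"
        using g by (simp add: C_def)
      then obtain t' where "t' < t" "step_label L e nx g t' = step_label L e nx g t"
        by (elim exE conjE)
      moreover have "step_label L e nx g t' = step_label L e nx h t'" "step_label L e nx g t = step_label L e nx h t"
        using upd[of t' h "g q"] upd[of t h "g q"] that \<open>t' < t\<close> unfolding gh[symmetric] D'_def by auto
      ultimately show ?thesis by auto
    qed
    then have "h \<in> C q D'" using hP by (auto simp: C_def)
    moreover have "g q \<in> W h" using g gh[symmetric] unfolding W_def C_def by fastforce
    ultimately show "g \<in> (\<lambda>(h, w). h(q := w)) ` (SIGMA h:C q D'. W h)"
      using gh by (intro image_eqI[of _ _ "(h, g q)"]) simp_all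
  qed
  have finW: "finite (W h)" for h by (auto simp: W_def)
  have card_le: "card (C (Suc q) D) \<le> (\<Sum>h\<in>C q D'. card (W h))"
  proof -
    have "card (C (Suc q) D) \<le> card ((\<lambda>(h, w). h(q := w)) ` (SIGMA h:C q D'. W h))"
      by (rule card_mono[OF _ cov]) (auto intro!: finite_imageI finite_SigmaI fin finW)
    also have "\<dots> \<le> card (SIGMA h:C q D'. W h)"
      by (rule card_image_le) (auto intro!: finite_SigmaI fin finW)
    also have "\<dots> = (\<Sum>h\<in>C q D'. card (W h))" by (simp add: card_SigmaI fin finW)
    finally show ?thesis .
  qed
  have IH: "card (C q D') \<le> n ^ (q - card D') * (N * K) ^ card D'"
    unfolding C_def by (rule Suc.IH[OF D'sub]) (use Suc.prems in auto)
  have D'q: "card D' \<le> q"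
    using card_mono[of "{..<q}" D'] D'sub by (auto dest: Suc_lessD)
  show ?case
  \<comment> \<open>Only the edge that ends in the last vertex \<open>q\<close> can restrict it: if
    that edge belongs to \<open>D\<close>, the fibre has at most \<open>N * K\<close> elements,
    otherwise at most \<open>n\<close>.\<close>
  proof (cases "\<exists>p\<in>D. Suc p = q")
    case True
    then obtain p where p: "p \<in> D" "Suc p = q" by auto
    have DD': "D = insert p D'" "p \<notin> D'" using p Suc.prems(1) by (auto simp: D'_def)
    have cD: "card D = Suc (card D')" using DD' finD by auto
    have "card (W h) \<le> N * K" if h: "h \<in> C q D'" for h
    proof -
      have hp: "h p \<in> {1..n}" using h p by (auto simp: C_def)
      have "W h \<subseteq> (\<Union>t'\<in>{..<p}. {w\<in>{1..n}. link_pow L (e p) (h p) w = step_label L e nx h t'})"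
      proof
        fix w assume w: "w \<in> W h"
        then obtain t' where t': "t' < p"
          "step_label L e nx (h(q := w)) t' = step_label L e nx (h(q := w)) p"
          using p by (auto simp: W_def C_def)
        moreover have "nx p = q" using p Suc.prems(1) by auto
        ultimately have "link_pow L (e p) (h p) w = step_label L e nx h t'"
          using upd[of t' h w] p(2) by (simp add: step_label_def[of _ _ _ _ p])
        moreover have "w \<in> {1..n}" using w unfolding W_def by blast
        ultimately show "w \<in> (\<Union>t'\<in>{..<p}. {w\<in>{1..n}. link_pow L (e p) (h p) w = step_label L e nx h t'})"
          using t'(1) by blast
      qed
      then have "card (W h) \<le> card (\<Union>t'\<in>{..<p}. {w\<in>{1..n}. link_pow L (e p) (h p) w = step_label L e nx h t'})"
        by (intro card_mono) auto
      also have "\<dots> \<le> (\<Sum>t'\<in>{..<p}. card {w\<in>{1..n}. link_pow L (e p) (h p) w = step_label L e nx h t'})"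
        by (rule card_UN_le) auto
      also have "\<dots> \<le> (\<Sum>t'\<in>{..<p}. K)"
        by (rule sum_mono) (use K hp in \<open>unfold link_bounded_def, blast\<close>)
      also have "\<dots> \<le> N * K" using p Suc.prems by auto
      finally show ?thesis .
    qed
    then have "card (C (Suc q) D) \<le> card (C q D') * (N * K)"
      using order_trans[OF card_le sum_bounded_above[of "C q D'" "\<lambda>h. card (W h)" "N * K"]] by simp
    also have "\<dots> \<le> n ^ (q - card D') * (N * K) ^ card D' * (N * K)"
      using IH by (rule mult_le_mono1)
    also have "\<dots> = n ^ (Suc q - card D) * (N * K) ^ card D"
      unfolding cD by (simp only: diff_Suc_Suc power_Suc2 mult.assoc)
    finally show ?thesis unfolding C_def .
  next
    case False
    have "t \<in> D'" if t: "t \<in> D" for t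
    proof -
      have "Suc t < Suc q" using t Suc.prems(1) by auto
      moreover have "Suc t \<noteq> q" using t False by auto
      ultimately have "Suc t < q" by simp
      then show ?thesis using t unfolding D'_def by blast
    qed
    then have DD': "D' = D" unfolding D'_def by blast
    have "card (W h) \<le> n" for h
      using card_mono[of "{1..n}" "W h"] by (simp add: W_def subset_iff)
    then have "card (C (Suc q) D) \<le> card (C q D') * n"
      using order_trans[OF card_le sum_bounded_above[of "C q D'" "\<lambda>h. card (W h)" n]] by simp
    also have "\<dots> \<le> n ^ (q - card D') * (N * K) ^ card D' * n"
      using IH by (rule mult_le_mono1)
    also have "\<dots> = n ^ (Suc q - card D) * (N * K) ^ card D"
      using D'q unfolding DD' by (simp only: Suc_diff_le power_Suc2 mult_ac)
    finally show ?thesis unfolding C_def .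
  qed
qed

text \<open>Union bound over the sets \<open>D\<close> of exactly \<open>d\<close> constrained
  steps; the factor \<open>2 ^ q\<close> counts the candidates for \<open>D\<close>.\<close>

lemma card_many_constrained_steps:
  assumes K: "link_bounded L K" and nx: "\<And>t. nx t \<le> Suc t"
  shows "card {g \<in> {..<q} \<rightarrow>\<^sub>E {1..n}. d \<le> card {t. Suc t < q \<and> nx t = Suc t \<and>
             label_repeats L e nx g t}}
           \<le> 2 ^ q * (q * K) ^ d * n ^ (q - d)"
proof -
  let ?G = "{g \<in> {..<q} \<rightarrow>\<^sub>E {1..n}. d \<le> card {t. Suc t < q \<and> nx t = Suc t \<and> label_repeats L e nx g t}}"
  define DD where "DD = {D. D \<subseteq> {t. Suc t < q \<and> nx t = Suc t} \<and> card D = d}"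
  define S where "S D = {g \<in> {..<q} \<rightarrow>\<^sub>E {1..n}. \<forall>t\<in>D. \<exists>t'<t.
      step_label L e nx g t' = step_label L e nx g t}" for D
  have DDsub: "DD \<subseteq> Pow {..<q}" by (auto simp: DD_def)
  have finDD: "finite DD" by (rule finite_subset[OF DDsub]) auto
  have cDD: "card DD \<le> 2 ^ q" using card_mono[OF _ DDsub] by (auto simp: card_Pow)
  have finS: "finite (S D)" for D
    unfolding S_def by (rule finite_subset[of _ "{..<q} \<rightarrow>\<^sub>E {1..n}"]) (auto intro: finite_PiE)
  have "?G \<subseteq> (\<Union>D\<in>DD. S D)"
  proof (intro subsetI, elim CollectE conjE)
    fix g assume g: "g \<in> {..<q} \<rightarrow>\<^sub>E {1..n}"
      and d: "d \<le> card {t. Suc t < q \<and> nx t = Suc t \<and>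
             label_repeats L e nx g t}"
    obtain D where "D \<subseteq> {t. Suc t < q \<and> nx t = Suc t \<and>
             label_repeats L e nx g t}" "card D = d"
      by (rule obtain_subset_with_card_n[OF d])
    then show "g \<in> (\<Union>D\<in>DD. S D)" using g by (intro UN_I[of D]) (auto simp: DD_def S_def)
  qed
  then have "card ?G \<le> card (\<Union>D\<in>DD. S D)"
    by (intro card_mono) (auto intro: finDD finS)
  also have "\<dots> \<le> (\<Sum>D\<in>DD. card (S D))" by (rule card_UN_le[OF finDD])
  also have "\<dots> \<le> (\<Sum>D\<in>DD. n ^ (q - d) * (q * K) ^ d)"
  proof (rule sum_mono)
    fix D assume D: "D \<in> DD"
    show "card (S D) \<le> n ^ (q - d) * (q * K) ^ d"
      using card_constrained_steps[OF K nx, of D q q n e] D unfolding S_def DD_def by auto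
  qed
  also have "\<dots> \<le> 2 ^ q * (n ^ (q - d) * (q * K) ^ d)" using cDD by (simp add: mult_le_mono1)
  finally show ?thesis by (simp only: mult_ac)
qed

section \<open>Rotated cycles, and several cycles read as one traversal\<close>

definition rot :: "nat \<Rightarrow> nat \<Rightarrow> nat \<Rightarrow> nat" where
  "rot m u k = (u + k) mod m + 1"

lemma rot_in: "m \<ge> 1 \<Longrightarrow> rot m u k \<in> {1..m}"
proof -
  assume "m \<ge> 1"
  then have "(u + k) mod m < m" by simp
  then show ?thesis by (simp add: rot_def)
qed

lemma cyc_succ_rot: "m \<ge> 1 \<Longrightarrow> cyc_succ m (rot m u k) = rot m u (Suc k)"
  by (auto simp: cyc_succ_def rot_def mod_Suc)

lemma rot_m: "m \<ge> 1 \<Longrightarrow> rot m u m = rot m u 0"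
  by (simp add: rot_def)

text \<open>The shift by one in \<open>rot\<close> lets the rotated cycle start right after
  \<open>u\<close>, so that \<open>u\<close> comes last and its edge is the closing one.\<close>

lemma rot_last: "u \<in> {1..m} \<Longrightarrow> rot m u (m - 1) = u"
proof -
  assume u: "u \<in> {1..m}"
  then have "u + (m - 1) = (u - 1) + m" by auto
  then have "(u + (m - 1)) mod m = (u - 1) mod m" by (simp only: mod_add_self2)
  also have "\<dots> = u - 1" using u by (intro mod_less) auto
  finally have "(u + (m - 1)) mod m = u - 1" .
  then show ?thesis using u by (simp add: rot_def)
qed

lemma inj_on_rot: "inj_on (rot m u) {..<m}"
proof (rule inj_onI)
  fix k k' assume "k \<in> {..<m}" "k' \<in> {..<m}" "rot m u k = rot m u k'"
  then have "(u + k) mod m = (u + k') mod m" "k < m" "k' < m" by (auto simp: rot_def)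
  then have "[k = k'] (mod m)" using cong_add_lcancel_nat[of u k k' m] by (simp add: cong_def)
  then show "k = k'" using \<open>k < m\<close> \<open>k' < m\<close> by (simp add: cong_def)
qed

lemma rot_image: "m \<ge> 1 \<Longrightarrow> rot m u ` {..<m} = {1..m}"
proof (rule card_subset_eq)
  assume m: "m \<ge> 1"
  show "rot m u ` {..<m} \<subseteq> {1..m}" by (intro image_subsetI rot_in[OF m])
  show "card (rot m u ` {..<m}) = card {1..m}" by (simp add: card_image[OF inj_on_rot])
qed auto

definition configs :: "nat \<Rightarrow> nat \<Rightarrow> nat \<Rightarrow> config set" where
  "configs r m n = {..<r} \<rightarrow>\<^sub>E (multi_indices m n)"

definition cyc_label ::
    "'t link \<Rightarrow> nat \<Rightarrow> exponents \<Rightarrow> config \<Rightarrow> nat \<times> nat \<Rightarrow> 't" where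
  "cyc_label L m \<epsilon> F p = link_value L m \<epsilon> (F (fst p)) (snd p)"

text \<open>The traversal runs through the cycles in the order \<open>\<sigma>\<close> and enters cycle \<open>l\<close> right after position
  \<open>a l\<close>, so that the edge at \<open>a l\<close> is the one closing that cycle.\<close>

definition reorder :: "nat \<Rightarrow> (nat \<Rightarrow> nat) \<Rightarrow> (nat \<Rightarrow> nat) \<Rightarrow> nat \<Rightarrow> nat \<times> nat" where
  "reorder m \<sigma> a t = (\<sigma> (t div m), rot m (a (\<sigma> (t div m))) (t mod m))"

lemma finite_configs: "finite (configs r m n)"
  by (simp add: configs_def finite_PiE)

lemma reorder_mem:
  assumes "m \<ge> 1" "\<sigma> ` {..<r} \<subseteq> {..<r}" "t < r * m"
  shows "reorder m \<sigma> a t \<in> {..<r} \<times> {1..m}"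
proof -
  have "t div m < r" using assms by (simp add: less_mult_imp_div_less)
  then have "\<sigma> (t div m) \<in> {..<r}" using assms(2) by blast
  then show ?thesis using rot_in[OF assms(1)] by (simp add: reorder_def)
qed

lemma div_mod_less:
  assumes "j < r" "k < (m::nat)"
  shows "j * m + k < r * m" "(j * m + k) div m = j" "(j * m + k) mod m = k"
proof -
  have "Suc j * m \<le> r * m" using assms by (intro mult_le_mono1) simp
  then show "j * m + k < r * m" using assms by simp
qed (use assms in auto)

lemma reorder_surj:
  assumes "m \<ge> 1" "{..<r} \<subseteq> \<sigma> ` {..<r}" "p \<in> {..<r} \<times> {1..m}"
  obtains t where "t < r * m" "reorder m \<sigma> a t = p"
proof -
  obtain l u where p: "p = (l, u)" "l < r" "u \<in> {1..m}" using assms(3) by auto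
  obtain j where j: "j < r" "\<sigma> j = l" using assms(2) p(2) by blast
  obtain k where k: "k < m" "rot m (a l) k = u" 
    using p(3) unfolding rot_image[OF assms(1), of "a l", symmetric] by (elim imageE) simp
  show ?thesis
    using that[of "j * m + k"] div_mod_less[OF j(1) k(1)] j k p by (simp add: reorder_def)
qed

lemma reorder_inj:
  assumes "inj_on \<sigma> {..<r}"
  shows "inj_on (reorder m \<sigma> a) {..<r * m}"
proof (rule inj_onI)
  fix t t' assume t: "t \<in> {..<r * m}" "t' \<in> {..<r * m}" and eq: "reorder m \<sigma> a t = reorder m \<sigma> a t'"
  have "m \<noteq> 0" using t(1) by (intro notI) simp
  then have m: "m > 0" by simp
  have "t div m < r" "t' div m < r"
    using t by (intro less_mult_imp_div_less, simp)+
  moreover have "\<sigma> (t div m) = \<sigma> (t' div m)" using eq by (simp add: reorder_def)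
  ultimately have d: "t div m = t' div m"
    using inj_onD[OF assms, of "t div m" "t' div m"] by simp
  have "rot m (a (\<sigma> (t div m))) (t mod m) = rot m (a (\<sigma> (t div m))) (t' mod m)"
    using eq by (simp add: reorder_def d)
  then have e: "t mod m = t' mod m"
    by (rule inj_onD[OF inj_on_rot]) (use m in auto)
  have "t = t div m * m + t mod m" by (rule div_mult_mod_eq[symmetric])
  also have "\<dots> = t'" unfolding d e by (rule div_mult_mod_eq)
  finally show "t = t'" .
qed

definition repeats :: "'t link \<Rightarrow> nat \<Rightarrow> exponents \<Rightarrow> (nat \<Rightarrow> nat) \<Rightarrow> (nat \<Rightarrow> nat) \<Rightarrow>
    config \<Rightarrow> nat \<Rightarrow> bool" where
  "repeats L m \<epsilon> \<sigma> a F t \<longleftrightarrow>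
     (\<exists>t'<t. cyc_label L m \<epsilon> F (reorder m \<sigma> a t') = cyc_label L m \<epsilon> F (reorder m \<sigma> a t))"

definition open_repeats :: "'t link \<Rightarrow> nat \<Rightarrow> nat \<Rightarrow> exponents \<Rightarrow> (nat \<Rightarrow> nat) \<Rightarrow> (nat \<Rightarrow> nat) \<Rightarrow>
    config \<Rightarrow> nat set" where
  "open_repeats L r m \<epsilon> \<sigma> a F = {t. t < r * m \<and> Suc t mod m \<noteq> 0 \<and> repeats L m \<epsilon> \<sigma> a F t}"

text \<open>The configuration is flattened along \<open>reorder\<close> into one traversal of
  \<open>r * m\<close> vertices. This is injective because \<open>reorder\<close> reaches every
  position, and repeated labels at non-closing edges become constrained steps.\<close>

lemma card_many_open_repeats:
  assumes K: "link_bounded L K" and m: "m \<ge> 1" and \<sigma>: "\<sigma> ` {..<r} = {..<r}"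
  shows "card {F \<in> configs r m n. d \<le> card (open_repeats L r m \<epsilon> \<sigma> a F)}
           \<le> 2 ^ (r * m) * (r * m * K) ^ d * n ^ (r * m - d)"
proof -
  define \<rho> where "\<rho> = reorder m \<sigma> a"
  \<comment> \<open>At the last position of a cycle, \<open>nx\<close> jumps back to the first
    position of the same cycle instead of entering the next one.\<close>
  define nx where "nx t = (if Suc t mod m = 0 then Suc t - m else Suc t)" for t
  define e where "e t = \<epsilon> (snd (\<rho> t))" for t
  define G where "G F = restrict (\<lambda>t. F (fst (\<rho> t)) (snd (\<rho> t))) {..<r * m}" for F :: config
  let ?F = "{F \<in> configs r m n. d \<le> card (open_repeats L r m \<epsilon> \<sigma> a F)}"
  let ?H = "{g \<in> {..<r * m} \<rightarrow>\<^sub>E {1..n}. d \<le> card {t. Suc t < r * m \<and> nx t = Suc t \<and> label_repeats L e nx g t}}"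
  have \<rho>_mem: "\<rho> t \<in> {..<r} \<times> {1..m}" if "t < r * m" for t
    unfolding \<rho>_def by (rule reorder_mem[OF m _ that]) (simp add: \<sigma>)
  have nx: "nx t < r * m" "\<rho> (nx t) = (fst (\<rho> t), cyc_succ m (snd (\<rho> t)))" if t: "t < r * m" for t
  proof -
    define j k where "j = t div m" and "k = t mod m"
    have jk: "t = j * m + k" "j < r" "k < m"
      using t m by (auto simp: j_def k_def less_mult_imp_div_less)
    have "nx t < r * m \<and> nx t div m = j \<and> rot m (a (\<sigma> j)) (nx t mod m) = rot m (a (\<sigma> j)) (Suc k)"
    proof (cases "Suc k = m")
      case True
      then have "Suc t = Suc j * m" using jk by simp
      then have "nx t = j * m + 0" unfolding nx_def by simp
      then show ?thesis using div_mod_less[OF jk(2), of 0 m] m True rot_m[OF m] by simp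
    next
      case False
      then have k: "Suc k < m" using jk by simp
      have "Suc t = j * m + Suc k" using jk by simp
      then have "nx t = j * m + Suc k" unfolding nx_def using div_mod_less[OF jk(2) k] by simp
      then show ?thesis using div_mod_less[OF jk(2) k] by simp
    qed
    moreover have "\<rho> t = (\<sigma> j, rot m (a (\<sigma> j)) k)" by (simp add: \<rho>_def reorder_def j_def k_def)
    ultimately show "nx t < r * m" "\<rho> (nx t) = (fst (\<rho> t), cyc_succ m (snd (\<rho> t)))"
      using cyc_succ_rot[OF m] by (simp_all add: \<rho>_def reorder_def j_def[symmetric] k_def[symmetric])
  qed
  have lab: "step_label L e nx (G F) t = cyc_label L m \<epsilon> F (\<rho> t)" if "t < r * m" for F t
    using nx[OF that] that by (simp add: step_label_def cyc_label_def link_value_def e_def G_def)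
  have Gmem: "G F \<in> {..<r * m} \<rightarrow>\<^sub>E {1..n}" if F: "F \<in> configs r m n" for F
  proof -
    have "F (fst (\<rho> t)) (snd (\<rho> t)) \<in> {1..n}" if "t < r * m" for t
    proof -
      have "F (fst (\<rho> t)) \<in> multi_indices m n"
        using F \<rho>_mem[OF that] unfolding configs_def by (elim PiE_mem) (simp add: mem_Times_iff)
      then show ?thesis using \<rho>_mem[OF that] by (elim PiE_mem) (simp add: mem_Times_iff)
    qed
    then show ?thesis unfolding G_def by (intro restrict_PiE_iff[THEN iffD2]) blast
  qed
  have inj: "inj_on G (configs r m n)"
  proof (rule inj_onI)
    fix F F' assume F: "F \<in> configs r m n" "F' \<in> configs r m n" and eq: "G F = G F'"
    have "F l u = F' l u" if lu: "l < r" "u \<in> {1..m}" for l u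
    proof -
      obtain t where t: "t < r * m" "\<rho> t = (l, u)"
        unfolding \<rho>_def by (rule reorder_surj[of m r \<sigma> "(l, u)" a]) (use m \<sigma> lu in auto)
      then show ?thesis using fun_cong[OF eq, of t] by (simp add: G_def)
    qed
    moreover have "F l \<in> multi_indices m n" "F' l \<in> multi_indices m n" if "l < r" for l
      using F that unfolding configs_def by (auto intro: PiE_mem)
    ultimately have "F l = F' l" if "l < r" for l
      using that by (intro PiE_ext[of _ "{1..m}" "\<lambda>_. {1..n}"]) auto
    then show "F = F'" using F unfolding configs_def
      by (intro PiE_ext[of _ "{..<r}" "\<lambda>_. multi_indices m n"]) auto
  qed
  have rep: "{t. Suc t < r * m \<and> nx t = Suc t \<and> (\<exists>t'<t. step_label L e nx (G F) t' = step_label L e nx (G F) t)}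
      = open_repeats L r m \<epsilon> \<sigma> a F" for F
  proof -
    have "Suc t < r * m \<longleftrightarrow> t < r * m" if "Suc t mod m \<noteq> 0" for t
    proof -
      have "Suc t \<noteq> r * m" using that mod_mult_self2_is_0[of r m] by auto
      then show ?thesis by auto
    qed
    moreover have "nx t = Suc t \<longleftrightarrow> Suc t mod m \<noteq> 0" for t using m by (auto simp: nx_def)
    ultimately show ?thesis
      unfolding open_repeats_def repeats_def \<rho>_def[symmetric]
      by (intro Collect_cong) (auto simp: lab)
  qed
  have "card ?F
    \<le> card ?H"
  proof (rule card_inj_on_le[of G])
    show "inj_on G ?F"
      by (rule inj_on_subset[OF inj]) blast
    show "G ` ?F \<subseteq>
      ?H"
      using Gmem by (intro image_subsetI CollectI conjI) (simp_all only: mem_Collect_eq rep)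
    show "finite ?H"
      by (rule finite_subset[of _ "{..<r * m} \<rightarrow>\<^sub>E {1..n}"]) (auto intro: finite_PiE)
  qed
  also have "\<dots> \<le> 2 ^ (r * m) * (r * m * K) ^ d * n ^ (r * m - d)"
    by (rule card_many_constrained_steps[OF K]) (simp add: nx_def)
  finally show ?thesis .
qed

text \<open>Cycles are named by their place \<open>j\<close> in the order \<open>\<sigma>\<close>;
  their closing edge is traversed at time \<open>j * m + (m - 1)\<close>.\<close>

definition fresh_cycles :: "'t link \<Rightarrow> nat \<Rightarrow> nat \<Rightarrow> exponents \<Rightarrow> (nat \<Rightarrow> nat) \<Rightarrow> (nat \<Rightarrow> nat) \<Rightarrow>
    config \<Rightarrow> nat set" where
  "fresh_cycles L r m \<epsilon> \<sigma> a F = {j. j < r \<and> \<not> repeats L m \<epsilon> \<sigma> a F (j * m + (m - 1))}"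

text \<open>A closing edge constrains no new vertex, hence a label occurring there for the first time is gained
  compared with one free vertex per label.\<close>

lemma card_open_repeats_ge:
  assumes m: "m \<ge> 1" and \<sigma>: "\<sigma> ` {..<r} \<subseteq> {..<r}"
  shows "r * m + card (fresh_cycles L r m \<epsilon> \<sigma> a F)
    \<le> card (open_repeats L r m \<epsilon> \<sigma> a F) + card (cyc_label L m \<epsilon> F ` ({..<r} \<times> {1..m})) + r"
proof -
  define R where "R = repeats L m \<epsilon> \<sigma> a F"
  define lb where "lb t = cyc_label L m \<epsilon> F (reorder m \<sigma> a t)" for t
  \<comment> \<open>Every step is a repeat at a non-closing edge (\<open>O'\<close>), a first
    occurrence (\<open>N\<close>, at most one per label), or a repeat at a closing edge
    (\<open>C\<close>, at most one per cycle that is not fresh).\<close>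
  define O' where "O' = open_repeats L r m \<epsilon> \<sigma> a F"
  define N where "N = {t. t < r * m \<and> \<not> R t}"
  define C where "C = {t. t < r * m \<and> Suc t mod m = 0 \<and> R t}"
  define S where "S = fresh_cycles L r m \<epsilon> \<sigma> a F"
  have N: "card N \<le> card (cyc_label L m \<epsilon> F ` ({..<r} \<times> {1..m}))"
  proof (rule card_inj_on_le[of lb])
    show "inj_on lb N"
    proof (rule inj_onI)
      fix t t' assume "t \<in> N" "t' \<in> N" "lb t = lb t'"
      then have "\<not> t < t'" "\<not> t' < t"
        unfolding N_def R_def repeats_def lb_def by auto
      then show "t = t'" by simp
    qed
    show "lb ` N \<subseteq> cyc_label L m \<epsilon> F ` ({..<r} \<times> {1..m})"
      unfolding lb_def N_def using reorder_mem[OF m \<sigma>] by blast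
  qed simp
  have SC: "card C \<le> card ({..<r} - S)"
  proof (rule card_inj_on_le[of "\<lambda>t. t div m"])
    have last: "t = (t div m) * m + (m - 1)" if "Suc t mod m = 0" for t
    proof -
      have "Suc t mod m = (if Suc (t mod m) = m then 0 else Suc (t mod m))" by (rule mod_Suc)
      then have "t mod m = m - 1" using that by (auto split: if_splits)
      then show ?thesis using div_mult_mod_eq[of t m] by simp
    qed
    show "inj_on (\<lambda>t. t div m) C"
    proof (rule inj_onI)
      fix t t' assume "t \<in> C" "t' \<in> C" "t div m = t' div m"
      then show "t = t'" using last[of t] last[of t'] unfolding C_def by simp
    qed
    show "(\<lambda>t. t div m) ` C \<subseteq> {..<r} - S"
    proof (intro image_subsetI)
      fix t assume t: "t \<in> C"
      then have "t div m < r" unfolding C_def by (simp add: less_mult_imp_div_less)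
      moreover have "t div m \<notin> S"
        using t last[of t] unfolding C_def S_def fresh_cycles_def R_def by simp
      ultimately show "t div m \<in> {..<r} - S" by simp
    qed
  qed simp
  have "S \<subseteq> {..<r}" by (auto simp: S_def fresh_cycles_def)
  then have "card ({..<r} - S) + card S = r"
    using card_Diff_subset[of S "{..<r}"] card_mono[of "{..<r}" S] finite_subset[of S "{..<r}"] by simp
  moreover have "{..<r * m} \<subseteq> O' \<union> N \<union> C"
    unfolding O'_def N_def C_def R_def open_repeats_def by auto
  then have "r * m \<le> card (O' \<union> N \<union> C)"
    using card_mono[of "O' \<union> N \<union> C" "{..<r * m}"] by (simp add: O'_def N_def C_def open_repeats_def)
  then have "r * m \<le> card O' + card N + card C"
    using card_Un_le[of "O' \<union> N" C] card_Un_le[of O' N] by linarith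
  ultimately show ?thesis using N SC unfolding O'_def S_def by linarith
qed

section \<open>Configurations without isolated labels and with linked cycles\<close>

definition labels :: "'t link \<Rightarrow> nat \<Rightarrow> nat \<Rightarrow> exponents \<Rightarrow> config \<Rightarrow> 't set" where
  "labels L r m \<epsilon> F = cyc_label L m \<epsilon> F ` ({..<r} \<times> {1..m})"

definition block :: "'t link \<Rightarrow> nat \<Rightarrow> nat \<Rightarrow> exponents \<Rightarrow> config \<Rightarrow> nat \<times> nat \<Rightarrow> (nat \<times> nat) set" where
  "block L r m \<epsilon> F p = {p' \<in> {..<r} \<times> {1..m}. cyc_label L m \<epsilon> F p' = cyc_label L m \<epsilon> F p}"

definition no_single :: "'t link \<Rightarrow> nat \<Rightarrow> nat \<Rightarrow> exponents \<Rightarrow> config \<Rightarrow> bool" where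
  "no_single L r m \<epsilon> F \<longleftrightarrow> (\<forall>p \<in> {..<r} \<times> {1..m}. 2 \<le> card (block L r m \<epsilon> F p))"

definition all_linked :: "'t link \<Rightarrow> nat \<Rightarrow> nat \<Rightarrow> exponents \<Rightarrow> config \<Rightarrow> bool" where
  "all_linked L r m \<epsilon> F \<longleftrightarrow> (\<forall>l<r. \<exists>u\<in>{1..m}. \<exists>p'\<in>block L r m \<epsilon> F (l, u). fst p' \<noteq> l)"

text \<open>The exponent stands for one free vertex per label and one starting vertex per cycle. The
  traversal used keeps the cycles in their order, and rotation by \<open>m\<close> starts each of
  them at position 1.\<close>

lemma card_configs_few_labels:
  assumes K: "link_bounded L K" and m: "m \<ge> 1" and n: "n \<ge> 1"
  shows "card {F \<in> configs r m n. card (labels L r m \<epsilon> F) \<le> B}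
    \<le> 2 ^ (r * m) * (r * m * K) ^ (r * m - (B + r)) * n ^ (B + r)"
proof -
  let ?F = "{F \<in> configs r m n. card (labels L r m \<epsilon> F) \<le> B}"
  define d where "d = r * m - (B + r)"
  have "?F
      \<subseteq> {F \<in> configs r m n. d \<le> card (open_repeats L r m \<epsilon> id (\<lambda>_. m) F)}"
  proof (intro subsetI CollectI conjI; elim CollectE conjE)
    fix F assume "card (labels L r m \<epsilon> F) \<le> B"
    then show "d \<le> card (open_repeats L r m \<epsilon> id (\<lambda>_. m) F)"
      using card_open_repeats_ge[OF m, of id r L \<epsilon> "\<lambda>_. m" F] by (simp add: labels_def d_def)
  qed
  then have "card ?F
      \<le> card {F \<in> configs r m n. d \<le> card (open_repeats L r m \<epsilon> id (\<lambda>_. m) F)}"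
    by (rule card_mono[rotated]) (simp add: finite_configs)
  also have "\<dots> \<le> 2 ^ (r * m) * (r * m * K) ^ d * n ^ (r * m - d)"
    by (rule card_many_open_repeats[OF K m]) simp
  also have "\<dots> \<le> 2 ^ (r * m) * (r * m * K) ^ d * n ^ (B + r)"
    by (intro mult_le_mono2 power_increasing n) (simp add: d_def)
  finally show ?thesis unfolding d_def .
qed

text \<open>A weighted count over the labels: a block of size 2 contributes exactly 6 to either
  side, and a block of size \<open>s \<ge> 3\<close> contributes \<open>s + 6\<close> on the left,
  which is at most \<open>3 * s\<close>.\<close>

lemma card_big_blocks:
  assumes "no_single L r m \<epsilon> F"
  shows "card {p \<in> {..<r} \<times> {1..m}. 3 \<le> card (block L r m \<epsilon> F p)} + 6 * card (labels L r m \<epsilon> F) \<le> 3 * (r * m)"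
proof -
  define S where "S = {..<r} \<times> {1..m}"
  define f where "f = cyc_label L m \<epsilon> F"
  define s where "s y = card {p\<in>S. f p = y}" for y
  have fin: "finite S" by (simp add: S_def)
  have bl: "card (block L r m \<epsilon> F p) = s (f p)" for p
    by (simp add: block_def s_def S_def f_def)
  have "card S = (\<Sum>y\<in>f ` S. s y)"
    using sum.image_gen[OF fin, of "\<lambda>_. 1::nat" f] by (simp add: s_def)
  moreover have "card S = r * m" by (simp add: S_def card_cartesian_product)
  moreover have "card {p \<in> S. 3 \<le> s (f p)} = (\<Sum>y\<in>f ` S. if 3 \<le> s y then s y else 0)"
  proof -
    have "card {p \<in> S. 3 \<le> s (f p)} = (\<Sum>p\<in>S. if 3 \<le> s (f p) then 1 else 0)"
      using fin by (simp add: sum.inter_filter[symmetric])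
    also have "\<dots> = (\<Sum>y\<in>f ` S. \<Sum>p\<in>{p\<in>S. f p = y}. if 3 \<le> s (f p) then 1 else 0)"
      by (rule sum.image_gen[OF fin])
    also have "\<dots> = (\<Sum>y\<in>f ` S. \<Sum>p\<in>{p\<in>S. f p = y}. if 3 \<le> s y then 1 else 0)"
      by (intro sum.cong refl) simp
    also have "\<dots> = (\<Sum>y\<in>f ` S. if 3 \<le> s y then s y else 0)"
      by (intro sum.cong refl) (simp add: s_def)
    finally show ?thesis .
  qed
  moreover have "(\<Sum>y\<in>f ` S. (if 3 \<le> s y then s y else 0) + 6) \<le> (\<Sum>y\<in>f ` S. 3 * s y)"
  proof (rule sum_mono)
    fix y assume "y \<in> f ` S"
    then have "2 \<le> s y" using assms unfolding no_single_def bl S_def by blast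
    then show "(if 3 \<le> s y then s y else 0) + 6 \<le> 3 * s y" by simp
  qed
  ultimately show ?thesis
    unfolding bl labels_def S_def[symmetric] f_def[symmetric]
    by (simp add: sum.distrib sum_distrib_left[symmetric])
qed

text \<open>The edges visited up to the closing edge of \<open>l\<close> all lie in the first
  \<open>j + 1\<close> cycles, \<open>l\<close> included. If the rest of its block lies outside
  these cycles, its label cannot have occurred before.\<close>

lemma fresh_cyclesI:
  assumes m: "m \<ge> 1" and \<sigma>: "\<sigma> ` {..<r} \<subseteq> {..<r}" "inj_on \<sigma> {..<r}" and j: "j < r" "\<sigma> j = l"
    and a: "a l \<in> {1..m}"
    and fresh: "\<And>p. p \<in> block L r m \<epsilon> F (l, a l) \<Longrightarrow> p \<noteq> (l, a l) \<Longrightarrow> fst p \<notin> \<sigma> ` {..j}"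
  shows "j \<in> fresh_cycles L r m \<epsilon> \<sigma> a F"
proof -
  define t where "t = j * m + (m - 1)"
  have t: "t < r * m" "t div m = j" "t mod m = m - 1"
    using div_mod_less[OF j(1), of "m - 1" m] m by (simp_all add: t_def)
  have rt: "reorder m \<sigma> a t = (l, a l)"
    unfolding reorder_def t by (simp add: j rot_last[OF a, simplified])
  have "cyc_label L m \<epsilon> F (reorder m \<sigma> a t') \<noteq> cyc_label L m \<epsilon> F (reorder m \<sigma> a t)" if t': "t' < t" for t'
  proof
    assume eq: "cyc_label L m \<epsilon> F (reorder m \<sigma> a t') = cyc_label L m \<epsilon> F (reorder m \<sigma> a t)"
    have "reorder m \<sigma> a t' \<in> {..<r} \<times> {1..m}"
      using reorder_mem[OF m \<sigma>(1)] t(1) t' by simp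
    then have "reorder m \<sigma> a t' \<in> block L r m \<epsilon> F (l, a l)"
      using eq rt by (simp add: block_def)
    moreover have "reorder m \<sigma> a t' \<noteq> (l, a l)"
      using inj_onD[OF reorder_inj[OF \<sigma>(2), of m a], of t' t] rt t(1) t' by auto
    moreover have "t' div m \<le> j" using t(2) t' div_le_mono[of t' t m] by simp
    then have "fst (reorder m \<sigma> a t') \<in> \<sigma> ` {..j}" by (simp add: reorder_def)
    ultimately show False using fresh by blast
  qed
  then show ?thesis using j(1) unfolding fresh_cycles_def repeats_def mem_Collect_eq t_def[symmetric] by blast
qed

text \<open>If the label of a closing edge occurs just twice, its partner lies in another cycle, hence later in
  either the order of the cycles or its reversal.  Labels occurring more often make up for the
  remaining cycles, because they reduce the number of labels.\<close>

lemma linked_many_open_repeats: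
  assumes m: "m \<ge> 1" and ns: "no_single L r m \<epsilon> F" and linked: "all_linked L r m \<epsilon> F"
  obtains \<sigma> a where "\<sigma> \<in> {id, \<lambda>j. r - 1 - j}" "a \<in> {..<r} \<rightarrow>\<^sub>E {1..m}"
    "r * m - (3 * (r * m) + 5 * r) div 6 \<le> card (open_repeats L r m \<epsilon> \<sigma> a F)"
proof -
  define rv where "rv = (\<lambda>j. r - 1 - j)"
  define bl where "bl = block L r m \<epsilon> F"
  define b where "b = card (labels L r m \<epsilon> F)"
  have "\<forall>l. \<exists>u. l < r \<longrightarrow> u \<in> {1..m} \<and> (\<exists>p'\<in>bl (l, u). fst p' \<noteq> l)"
    using linked unfolding all_linked_def bl_def by blast
  then obtain a0 where a0: "\<And>l. l < r \<Longrightarrow> a0 l \<in> {1..m} \<and> (\<exists>p'\<in>bl (l, a0 l). fst p' \<noteq> l)"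
    using choice[of "\<lambda>l u. l < r \<longrightarrow> u \<in> {1..m} \<and> (\<exists>p'\<in>bl (l, u). fst p' \<noteq> l)"] by blast
  \<comment> \<open>\<open>a l\<close> is a position of cycle \<open>l\<close> whose label also
    occurs in another cycle; rotating by \<open>a l\<close> makes this shared edge the closing
    one.\<close>
  define a where "a = restrict a0 {..<r}"
  have a: "a l \<in> {1..m}" "\<exists>p'\<in>bl (l, a l). fst p' \<noteq> l" if "l < r" for l
    using a0[OF that] that by (simp_all add: a_def)
  have aE: "a \<in> {..<r} \<rightarrow>\<^sub>E {1..m}"
    using a(1) unfolding a_def by (intro restrict_PiE_iff[THEN iffD2]) auto
  define Big where "Big = {p \<in> {..<r} \<times> {1..m}. 3 \<le> card (bl p)}"
  define Bl where "Bl = {l. l < r \<and> (l, a l) \<in> Big}"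
  \<comment> \<open>\<open>Sf\<close> and \<open>Sb\<close> collect the cycles whose closing edge
    has all its partners in later, respectively earlier, cycles. A closing edge belonging to neither
    has a block of size at least three.\<close>
  define Sf where "Sf = {l. l < r \<and> (\<forall>p\<in>bl (l, a l). p \<noteq> (l, a l) \<longrightarrow> l < fst p)}"
  define Sb where "Sb = {l. l < r \<and> (\<forall>p\<in>bl (l, a l). p \<noteq> (l, a l) \<longrightarrow> fst p < l)}"
  have big: "card Big + 6 * b \<le> 3 * (r * m)"
    using card_big_blocks[OF ns] by (simp add: Big_def bl_def b_def)
  have "card Bl \<le> card Big"
    by (rule card_inj_on_le[of "\<lambda>l. (l, a l)"]) (auto simp: Bl_def Big_def inj_on_def)
  have cover: "{..<r} \<subseteq> Sf \<union> Sb \<union> Bl"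
  proof
    fix l assume "l \<in> {..<r}"
    then have l: "l < r" by simp
    obtain p' where p': "p' \<in> bl (l, a l)" "fst p' \<noteq> l" using a(2)[OF l] by blast
    have self: "(l, a l) \<in> bl (l, a l)" using a(1)[OF l] l by (simp add: bl_def block_def)
    show "l \<in> Sf \<union> Sb \<union> Bl"
    proof (cases "3 \<le> card (bl (l, a l))")
      case True
      then show ?thesis using l a(1)[OF l] by (simp add: Bl_def Big_def)
    next
      case False
      have fin: "finite (bl (l, a l))" by (simp add: bl_def block_def)
      have ne: "p' \<noteq> (l, a l)" using p'(2) by auto
      then have "card {(l, a l), p'} = 2" by simp
      then have "bl (l, a l) = {(l, a l), p'}"
        using False self p'(1) by (intro card_subset_eq[OF fin, symmetric] antisym[of "card _"] card_mono[OF fin]) auto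
      then show ?thesis using p'(2) l by (auto simp: Sf_def Sb_def)
    qed
  qed
  have fin: "finite Sf" "finite Sb" "finite Bl" by (simp_all add: Sf_def Sb_def Bl_def)
  have sum: "r \<le> card Sf + card Sb + card Big"
  proof -
    have "r \<le> card (Sf \<union> Sb \<union> Bl)" using card_mono[OF _ cover] fin by simp
    also have "\<dots> \<le> card Sf + card Sb + card Bl"
      using card_Un_le[of "Sf \<union> Sb" Bl] card_Un_le[of Sf Sb] by linarith
    finally show ?thesis using \<open>card Bl \<le> card Big\<close> by linarith
  qed
  have finfresh: "finite (fresh_cycles L r m \<epsilon> \<sigma> a F)" for \<sigma> by (simp add: fresh_cycles_def)
  have f: "card Sf \<le> card (fresh_cycles L r m \<epsilon> id a F)"
  proof (rule card_mono[OF finfresh], rule subsetI)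
    fix l assume l: "l \<in> Sf"
    then have "l < r" by (simp add: Sf_def)
    then show "l \<in> fresh_cycles L r m \<epsilon> id a F"
      using l a(1) by (intro fresh_cyclesI[OF m, of id r l l]) (auto simp: Sf_def bl_def)
  qed
  have rv: "rv ` {..<r} \<subseteq> {..<r}" "inj_on rv {..<r}" by (auto simp: rv_def inj_on_def)
  have g: "card Sb \<le> card (fresh_cycles L r m \<epsilon> rv a F)"
  proof (rule card_inj_on_le[OF _ _ finfresh])
    show "inj_on rv Sb" by (rule inj_on_subset[OF rv(2)]) (auto simp: Sb_def)
    show "rv ` Sb \<subseteq> fresh_cycles L r m \<epsilon> rv a F"
    proof (rule image_subsetI)
      fix l assume l: "l \<in> Sb"
      then have lr: "l < r" by (simp add: Sb_def)
      have "l \<le> rv j" if "j \<le> rv l" for j using that lr by (auto simp: rv_def)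
      then have "p \<in> bl (l, a l) \<Longrightarrow> p \<noteq> (l, a l) \<Longrightarrow> fst p \<notin> rv ` {..rv l}" for p
        using l unfolding Sb_def by fastforce
      moreover have "rv l < r" "rv (rv l) = l" using lr by (auto simp: rv_def)
      ultimately show "rv l \<in> fresh_cycles L r m \<epsilon> rv a F"
        using a(1)[OF lr] by (intro fresh_cyclesI[OF m rv, of "rv l" l]) (auto simp: bl_def)
    qed
  qed
  \<comment> \<open>With \<open>f\<close> fresh cycles, the number of unconstrained vertices is at
    most \<open>b + r - f\<close>, where \<open>6 * b \<le> 3 * (r * m) - card Big\<close>. Six
    times this number is at most \<open>3 * (r * m) + 6 * r - (card Big + 6 * f)\<close>, and the
    bracket is at least \<open>r\<close>. This is the origin of \<open>5 * r\<close>.\<close>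
  have enough: "r * m - (3 * (r * m) + 5 * r) div 6 \<le> card (open_repeats L r m \<epsilon> \<sigma> a F)"
    if "\<sigma> ` {..<r} \<subseteq> {..<r}" "r \<le> 2 * card (fresh_cycles L r m \<epsilon> \<sigma> a F) + card Big" for \<sigma>
  proof -
    have "r * m + card (fresh_cycles L r m \<epsilon> \<sigma> a F) \<le> card (open_repeats L r m \<epsilon> \<sigma> a F) + b + r"
      using card_open_repeats_ge[OF m that(1)] by (simp add: b_def labels_def)
    then show ?thesis using that(2) big by linarith
  qed
  show ?thesis
  \<comment> \<open>The larger of the two sets decides between the given order and its
    reversal.\<close>
  proof (cases "card Sb \<le> card Sf")
    case True
    then show ?thesis using that[of id a] aE sum f enough[of id] by simp
  next
    case False
    then show ?thesis using that[of rv a] aE sum g enough[of rv] rv(1) by (simp add: rv_def)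
  qed
qed

text \<open>Order and rotations depend on the configuration, but there are only finitely many of
  them, in a number that does not involve \<open>n\<close>; hence a union bound suffices.\<close>

lemma card_linked_configs:
  assumes K: "link_bounded L K" and m: "m \<ge> 1"
  shows "\<exists>C. \<forall>n\<ge>1. card {F \<in> configs r m n. no_single L r m \<epsilon> F \<and> all_linked L r m \<epsilon> F}
    \<le> C * n ^ ((3 * (r * m) + 5 * r) div 6)"
proof -
  let ?F = "\<lambda>n. {F \<in> configs r m n. no_single L r m \<epsilon> F \<and> all_linked L r m \<epsilon> F}"
  define d where "d = r * m - (3 * (r * m) + 5 * r) div 6"
  define A where "A = {id, \<lambda>j. r - 1 - j} \<times> ({..<r} \<rightarrow>\<^sub>E {1..m})"
  define c where "c = 2 ^ (r * m) * (r * m * K) ^ d"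
  define S where "S n p = {F \<in> configs r m n. d \<le> card (open_repeats L r m \<epsilon> (fst p) (snd p) F)}" for n p
  have finA: "finite A" by (simp add: A_def finite_PiE)
  have "card (?F n)
      \<le> card A * c * n ^ ((3 * (r * m) + 5 * r) div 6)" if n: "n \<ge> 1" for n
  proof -
    have "(?F n) \<subseteq> (\<Union>p\<in>A. S n p)"
    proof (intro subsetI; elim CollectE conjE)
      fix F assume F: "F \<in> configs r m n" "no_single L r m \<epsilon> F" "all_linked L r m \<epsilon> F"
      obtain \<sigma> a where "\<sigma> \<in> {id, \<lambda>j. r - 1 - j}" "a \<in> {..<r} \<rightarrow>\<^sub>E {1..m}"
        "d \<le> card (open_repeats L r m \<epsilon> \<sigma> a F)"
        unfolding d_def by (rule linked_many_open_repeats[OF m F(2,3)])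
      then show "F \<in> (\<Union>p\<in>A. S n p)"
        using F(1) unfolding A_def S_def by (intro UN_I[of "(\<sigma>, a)"] SigmaI CollectI conjI) (assumption | simp only: prod.sel)+
    qed
    then have "card (?F n) \<le> card (\<Union>p\<in>A. S n p)"
      by (rule card_mono[rotated]) (simp add: finA S_def finite_configs)
    also have "\<dots> \<le> (\<Sum>p\<in>A. card (S n p))" by (rule card_UN_le[OF finA])
    also have "\<dots> \<le> (\<Sum>p\<in>A. c * n ^ (r * m - d))"
    proof (rule sum_mono)
      fix p assume "p \<in> A"
      then have "fst p = id \<or> fst p = (\<lambda>j. r - 1 - j)" 
        unfolding A_def by (simp only: mem_Times_iff insert_iff empty_iff simp_thms)
      moreover have "(\<lambda>j. r - 1 - j) ` {..<r} = {..<r}"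
      proof (rule card_subset_eq)
        show "card ((\<lambda>j. r - 1 - j) ` {..<r}) = card {..<r}"
          by (rule card_image) (auto simp: inj_on_def)
      qed auto
      ultimately show "card (S n p) \<le> c * n ^ (r * m - d)"
        unfolding S_def c_def by (intro card_many_open_repeats[OF K m]) (elim disjE; simp)
    qed
    also have "\<dots> = card A * c * n ^ (r * m - d)" by simp
    also have "\<dots> \<le> card A * c * n ^ ((3 * (r * m) + 5 * r) div 6)"
      by (intro mult_le_mono2 power_increasing n) (simp add: d_def)
    finally show ?thesis .
  qed
  then show ?thesis by blast
qed

section \<open>Moments of the two families\<close>

definition label_moment :: "'w measure \<Rightarrow> ('i \<Rightarrow> 'w \<Rightarrow> real) \<Rightarrow> (nat \<times> nat \<Rightarrow> 'i) \<Rightarrow> (nat \<times> nat) set \<Rightarrow> real" where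
  "label_moment P x f T = (\<integral>\<omega>. (\<Prod>p\<in>T. x (f p) \<omega>) \<partial>P)"

abbreviation moment_bounded where
  "moment_bounded P x f T C \<equiv> integrable P (\<lambda>\<omega>. \<Prod>p\<in>T. x (f p) \<omega>) \<and> \<bar>label_moment P x f T\<bar> \<le> C"

text \<open>The common ground of the admissible systems in (a) and the independent variables in (b).
  Sets of positions consist of pairs (cycle, place in the cycle), and the bounds are uniform in the
  labelling.\<close>

definition regular_family :: "'w measure \<Rightarrow> ('i \<Rightarrow> 'w \<Rightarrow> real) \<Rightarrow> bool" where
  "regular_family P x \<longleftrightarrow>
     (\<forall>\<alpha>. x \<alpha> \<in> borel_measurable P) \<and>
     (\<forall>N. \<exists>C. \<forall>f T. finite T \<and> card T = N \<longrightarrow>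
        moment_bounded P x f T C) \<and>
     (\<forall>f T p. finite T \<and> p \<in> T \<and> {p'\<in>T. f p' = f p} = {p} \<longrightarrow> label_moment P x f T = 0) \<and>
     (\<forall>f T. finite T \<and> (\<forall>p\<in>T. card {p'\<in>T. f p' = f p} = 2) \<longrightarrow> label_moment P x f T = 1)"

text \<open>The additional property of independent variables by which an unlinked cycle can be split
  off; an admissible system need not have it.\<close>

definition factorizing :: "'w measure \<Rightarrow> ('i \<Rightarrow> 'w \<Rightarrow> real) \<Rightarrow> bool" where
  "factorizing P x \<longleftrightarrow> (\<forall>f T T'. finite T \<and> finite T' \<and> T \<inter> T' = {} \<and> f ` T \<inter> f ` T' = {} \<longrightarrow>
     label_moment P x f (T \<union> T') = label_moment P x f T * label_moment P x f T')"

text \<open>Every factor is at most the largest one. This plays the part of Hoelder's inequality and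
  reduces mixed moments to absolute moments of single variables.\<close>

lemma abs_prod_le_sum_power:
  fixes a :: "'p \<Rightarrow> real"
  assumes "finite T" "T \<noteq> {}"
  shows "\<bar>\<Prod>p\<in>T. a p\<bar> \<le> (\<Sum>p\<in>T. \<bar>a p\<bar> ^ card T)"
proof -
  define m where "m = Max ((\<lambda>p. \<bar>a p\<bar>) ` T)"
  have "m \<in> (\<lambda>p. \<bar>a p\<bar>) ` T" unfolding m_def using assms by (intro Max_in) auto
  then obtain q where q: "q \<in> T" "m = \<bar>a q\<bar>" by auto
  have "\<bar>\<Prod>p\<in>T. a p\<bar> = (\<Prod>p\<in>T. \<bar>a p\<bar>)" by (rule abs_prod)
  also have "\<dots> \<le> (\<Prod>p\<in>T. m)"
    by (rule prod_mono) (use assms in \<open>auto simp: m_def\<close>)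
  also have "\<dots> = \<bar>a q\<bar> ^ card T" by (simp add: q)
  also have "\<dots> \<le> (\<Sum>p\<in>T. \<bar>a p\<bar> ^ card T)"
    by (rule member_le_sum[OF q(1)]) (use assms in auto)
  finally show ?thesis .
qed

lemma prod_by_labels:
  fixes g :: "'i \<Rightarrow> 'r::comm_semiring_1"
  assumes "finite T"
  shows "(\<Prod>p\<in>T. g (f p)) = (\<Prod>v\<in>f ` T. g v ^ card {p\<in>T. f p = v})"
proof -
  have "(\<Prod>p\<in>T. g (f p)) = (\<Prod>v\<in>f ` T. \<Prod>p\<in>{p\<in>T. f p = v}. g (f p))"
    by (rule prod.image_gen[OF assms])
  also have "\<dots> = (\<Prod>v\<in>f ` T. g v ^ card {p\<in>T. f p = v})"
    by (intro prod.cong refl) simp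
  finally show ?thesis .
qed

lemma bounded_moments_obtain:
  assumes ub: "uniformly_bounded_moments P x" and meas: "\<And>\<alpha>. x \<alpha> \<in> borel_measurable P" and p: "p \<ge> 1"
  obtains C where "\<And>\<alpha>. integrable P (\<lambda>\<omega>. \<bar>x \<alpha> \<omega>\<bar> ^ p)" "\<And>\<alpha>. (\<integral>\<omega>. \<bar>x \<alpha> \<omega>\<bar> ^ p \<partial>P) \<le> C"
proof -
  define c where "c = (SUP \<alpha>. \<integral>\<^sup>+\<omega>. ennreal (\<bar>x \<alpha> \<omega>\<bar> ^ p) \<partial>P)"
  have c: "c < \<infinity>" using ub p unfolding uniformly_bounded_moments_def c_def by blast
  have le: "(\<integral>\<^sup>+\<omega>. ennreal (\<bar>x \<alpha> \<omega>\<bar> ^ p) \<partial>P) \<le> c" for \<alpha> unfolding c_def by (rule SUP_upper) simp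
  have int: "integrable P (\<lambda>\<omega>. \<bar>x \<alpha> \<omega>\<bar> ^ p)" for \<alpha>
    using meas[of \<alpha>] le[of \<alpha>] c by (intro integrableI_nonneg) (auto intro: le_less_trans)
  moreover have "(\<integral>\<omega>. \<bar>x \<alpha> \<omega>\<bar> ^ p \<partial>P) \<le> enn2real c" for \<alpha>
    using le[of \<alpha>] c meas[of \<alpha>] by (subst integral_eq_nn_integral) (auto intro!: enn2real_mono)
  ultimately show ?thesis using that by blast
qed

lemma bounded_label_moments:
  fixes P :: "'w measure" and x :: "'i \<Rightarrow> 'w \<Rightarrow> real"
  assumes P: "prob_space P"
    and ub: "uniformly_bounded_moments P x" and meas: "\<And>\<alpha>. x \<alpha> \<in> borel_measurable P"
  shows "\<exists>C. \<forall>f T. finite T \<and> card T = N \<longrightarrow>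
        moment_bounded P x f T C"
\<comment> \<open>The moment bounds concern powers \<open>p \<ge> 1\<close>; for
  \<open>N = 0\<close> the product is empty and has expectation 1.\<close>
proof (cases "N = 0")
  case True
  interpret prob_space P by (rule P)
  show ?thesis
    using True prob_space by (intro exI[of _ 1]) (auto simp: label_moment_def)
next
  case False
  then have N: "N \<ge> 1" by simp
  interpret prob_space P by (rule P)
  obtain C where C: "\<And>\<alpha>. integrable P (\<lambda>\<omega>. \<bar>x \<alpha> \<omega>\<bar> ^ N)" "\<And>\<alpha>. (\<integral>\<omega>. \<bar>x \<alpha> \<omega>\<bar> ^ N \<partial>P) \<le> C"
    using bounded_moments_obtain[OF ub meas N] by blast
  have "moment_bounded P x f T (real N * C)"
    if T: "finite T" "card T = N" for f and T :: "(nat \<times> nat) set"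
  proof -
    have "T \<noteq> {}" using T False by auto
    then have le: "\<bar>\<Prod>p\<in>T. x (f p) \<omega>\<bar> \<le> (\<Sum>p\<in>T. \<bar>x (f p) \<omega>\<bar> ^ N)" for \<omega>
      using abs_prod_le_sum_power[OF T(1)] T(2) by blast
    have i1: "integrable P (\<lambda>\<omega>. \<Sum>p\<in>T. \<bar>x (f p) \<omega>\<bar> ^ N)"
      by (intro Bochner_Integration.integrable_sum C)
    have i2: "integrable P (\<lambda>\<omega>. \<Prod>p\<in>T. x (f p) \<omega>)"
      by (rule Bochner_Integration.integrable_bound[OF i1])
         (use meas le in \<open>auto intro!: borel_measurable_prod AE_I2 order_trans[OF le] abs_ge_self\<close>)
    have "\<bar>label_moment P x f T\<bar> \<le> (\<integral>\<omega>. \<bar>\<Prod>p\<in>T. x (f p) \<omega>\<bar> \<partial>P)"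
      unfolding label_moment_def by (rule integral_abs_bound)
    also have "\<dots> \<le> (\<integral>\<omega>. (\<Sum>p\<in>T. \<bar>x (f p) \<omega>\<bar> ^ N) \<partial>P)"
      by (rule integral_mono[OF integrable_abs[OF i2] i1]) (rule le)
    also have "\<dots> = (\<Sum>p\<in>T. \<integral>\<omega>. \<bar>x (f p) \<omega>\<bar> ^ N \<partial>P)"
      by (rule Bochner_Integration.integral_sum) (rule C)
    also have "\<dots> \<le> real N * C" using sum_bounded_above[of T _ C] C(2) T(2) by auto
    finally show ?thesis using i2 by blast
  qed
  then show ?thesis by blast
qed

lemma regular_family_SMS:
  fixes P :: "'w measure" and x :: "'i \<Rightarrow> 'w \<Rightarrow> real"
  assumes P: "prob_space P"
    and sms: "admissible_SMS P UNIV x" and ub: "uniformly_bounded_moments P x"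
    and meas: "\<And>\<alpha>. x \<alpha> \<in> borel_measurable P"
  shows "regular_family P x"
  unfolding regular_family_def
proof (intro conjI allI impI)
  interpret prob_space P by (rule P)
  \<comment> \<open>The distinct labels are enumerated by \<open>{1..n}\<close> and the block sizes
    become exponents, which is the form in which the SMS properties are stated.\<close>
  have enum: "\<exists>\<alpha> n. n \<ge> (1::nat) \<and> bij_betw \<alpha> {1..n} (f ` T) \<and> inj_on \<alpha> {1..n} \<and>
      (\<forall>\<omega>. (\<Prod>p\<in>T. x (f p) \<omega>) = (\<Prod>k\<in>{1..n}. x (\<alpha> k) \<omega> ^ card {p\<in>T. f p = \<alpha> k}))"
    if T: "finite T" "T \<noteq> {}" for f and T :: "(nat \<times> nat) set"
  proof -
    obtain \<alpha> where \<alpha>: "bij_betw \<alpha> {1..card (f ` T)} (f ` T)"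
      using ex_bij_betw_nat_finite_1[of "f ` T"] T(1) by auto
    have "(\<Prod>p\<in>T. x (f p) \<omega>) = (\<Prod>k\<in>{1..card (f ` T)}. x (\<alpha> k) \<omega> ^ card {p\<in>T. f p = \<alpha> k})" for \<omega>
      unfolding prod_by_labels[OF T(1), of "\<lambda>v. x v \<omega>"]
      by (rule prod.reindex_bij_betw[OF \<alpha>, symmetric])
    moreover have "card (f ` T) \<ge> 1" using T by (simp add: Suc_le_eq card_gt_0_iff)
    ultimately show ?thesis using \<alpha> bij_betw_imp_inj_on[OF \<alpha>]
      by (intro exI[of _ \<alpha>] exI[of _ "card (f ` T)"] conjI allI)
  qed
  show "x \<alpha> \<in> borel_measurable P" for \<alpha> by (rule meas)
  show "\<exists>C. \<forall>f T. finite T \<and> card T = N \<longrightarrow>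
        moment_bounded P x f T C" for N
    by (rule bounded_label_moments[OF P ub meas])
  fix f :: "nat \<times> nat \<Rightarrow> 'i" and T :: "(nat \<times> nat) set"
  {
    fix p assume "finite T \<and> p \<in> T \<and> {p'\<in>T. f p' = f p} = {p}"
    then have T: "finite T" "p \<in> T" "{p'\<in>T. f p' = f p} = {p}" by auto
    then have "T \<noteq> {}" by auto
    from enum[OF T(1) this, of f] obtain \<alpha> and n :: nat where n: "n \<ge> 1" and \<alpha>: "bij_betw \<alpha> {1..n} (f ` T)" "inj_on \<alpha> {1..n}"
      and eq: "\<forall>\<omega>. (\<Prod>p\<in>T. x (f p) \<omega>) = (\<Prod>k\<in>{1..n}. x (\<alpha> k) \<omega> ^ card {p\<in>T. f p = \<alpha> k})" by blast
    define \<eta> where "\<eta> k = card {p\<in>T. f p = \<alpha> k}" for k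
    have im: "\<alpha> ` {1..n} = f ` T" using \<alpha>(1) by (simp add: bij_betw_def)
    have ge: "\<eta> k \<ge> 1" if "k \<in> {1..n}" for k
    proof -
      have "\<alpha> k \<in> f ` T" using im that by blast
      then obtain p where "p \<in> T" "f p = \<alpha> k" by auto
      then have "{p\<in>T. f p = \<alpha> k} \<noteq> {}" by blast
      then show ?thesis using T(1) by (simp add: \<eta>_def Suc_le_eq card_gt_0_iff)
    qed
    have "f p \<in> \<alpha> ` {1..n}" using im T(2) by auto
    then obtain k where "k \<in> {1..n}" "\<alpha> k = f p" by auto
    then have "\<exists>k\<in>{1..n}. \<eta> k = 1" using T(3) by (intro bexI[of _ k]) (simp_all add: \<eta>_def)
    then have "has_bochner_integral P (\<lambda>\<omega>. \<Prod>k\<in>{1..n}. x (\<alpha> k) \<omega> ^ \<eta> k) 0"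
      using conjunct2[OF conjunct2[OF sms[unfolded admissible_SMS_def]], rule_format, OF n, of \<alpha> \<eta>] \<alpha>(2) ge
      by simp
    then show "label_moment P x f T = 0"
      using eq by (simp add: label_moment_def has_bochner_integral_integral_eq \<eta>_def)
  next
    assume "finite T \<and> (\<forall>p\<in>T. card {p'\<in>T. f p' = f p} = 2)"
    then have T: "finite T" "\<forall>p\<in>T. card {p'\<in>T. f p' = f p} = 2" by auto
    show "label_moment P x f T = 1"
    proof (cases "T = {}")
      case True
      then show ?thesis by (simp add: label_moment_def prob_space)
    next
      case False
      from enum[OF T(1) this, of f] obtain \<alpha> and n :: nat where n: "n \<ge> 1" and \<alpha>: "bij_betw \<alpha> {1..n} (f ` T)" "inj_on \<alpha> {1..n}"
        and eq: "\<forall>\<omega>. (\<Prod>p\<in>T. x (f p) \<omega>) = (\<Prod>k\<in>{1..n}. x (\<alpha> k) \<omega> ^ card {p\<in>T. f p = \<alpha> k})" by blast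
      define \<eta> where "\<eta> k = card {p\<in>T. f p = \<alpha> k}" for k
      have im: "\<alpha> ` {1..n} = f ` T" using \<alpha>(1) by (simp add: bij_betw_def)
      have two: "\<forall>k\<in>{1..n}. \<eta> k = 2"
      proof
        fix k assume "k \<in> {1..n}"
        then have "\<alpha> k \<in> f ` T" using im by blast
        then obtain p where "p \<in> T" "\<alpha> k = f p" by auto
        then show "\<eta> k = 2" using T(2) by (simp add: \<eta>_def)
      qed
      have S: "SMS P UNIV x" using sms unfolding admissible_SMS_def by blast
      have "has_bochner_integral P (\<lambda>\<omega>. \<Prod>k\<in>{1..n}. x (\<alpha> k) \<omega> ^ \<eta> k) (if \<forall>k\<in>{1..n}. \<eta> k = 2 then 1 else 0)"
        using S[unfolded SMS_def, rule_format, OF n, of \<alpha> \<eta>] \<alpha>(2) two by blast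
      then show ?thesis
        using eq two by (simp add: label_moment_def has_bochner_integral_integral_eq \<eta>_def)
    qed
  }
qed

lemma independent_label_moment:
  fixes P :: "'w measure" and x :: "'i \<Rightarrow> 'w \<Rightarrow> real"
  assumes P: "prob_space P"
    and ind: "independent_standardized P x" and ub: "uniformly_bounded_moments P x"
    and meas: "\<And>\<alpha>. x \<alpha> \<in> borel_measurable P" and T: "finite T"
  shows "label_moment P x f T = (\<Prod>v\<in>f ` T. \<integral>\<omega>. x v \<omega> ^ card {p\<in>T. f p = v} \<partial>P)"
proof -
  interpret prob_space P by (rule P)
  have iv: "indep_vars (\<lambda>_. borel) x UNIV" using ind by (simp add: independent_standardized_def)
  define g where "g = (\<lambda>v \<omega>. x v \<omega> ^ card {p\<in>T. f p = v})"
  have "indep_vars (\<lambda>_. borel) x (f ` T)" by (rule indep_vars_subset[OF iv]) simp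
  then have "indep_vars (\<lambda>_. borel) (\<lambda>v \<omega>. (\<lambda>z. z ^ card {p\<in>T. f p = v}) (x v \<omega>)) (f ` T)"
    by (rule indep_vars_compose2) simp
  then have ig: "indep_vars (\<lambda>_. borel) g (f ` T)" by (simp add: g_def)
  have "integrable P (g v)" if "v \<in> f ` T" for v
  proof -
    have "card {p\<in>T. f p = v} \<ge> 1" using that T by (auto simp: Suc_le_eq card_gt_0_iff)
    from bounded_moments_obtain[OF ub meas this] obtain C where
      "\<And>\<alpha>. integrable P (\<lambda>\<omega>. \<bar>x \<alpha> \<omega>\<bar> ^ card {p\<in>T. f p = v})" by blast
    then have "integrable P (\<lambda>\<omega>. \<bar>g v \<omega>\<bar>)" unfolding g_def by (simp add: power_abs)
    moreover have "g v \<in> borel_measurable P" unfolding g_def using meas[of v] by measurable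
    ultimately show ?thesis by (simp add: integrable_abs_iff)
  qed
  then have "(\<integral>\<omega>. (\<Prod>v\<in>f ` T. g v \<omega>) \<partial>P) = (\<Prod>v\<in>f ` T. \<integral>\<omega>. g v \<omega> \<partial>P)"
    using T by (intro indep_vars_lebesgue_integral[OF _ ig]) auto
  then show ?thesis unfolding label_moment_def prod_by_labels[OF T, of "\<lambda>v. x v _"] g_def .
qed

lemma regular_family_independent:
  fixes P :: "'w measure" and x :: "'i \<Rightarrow> 'w \<Rightarrow> real"
  assumes P: "prob_space P"
    and ind: "independent_standardized P x" and ub: "uniformly_bounded_moments P x"
    and meas: "\<And>\<alpha>. x \<alpha> \<in> borel_measurable P"
  shows "regular_family P x" "factorizing P x"
proof -
  interpret prob_space P by (rule P)
  note lm = independent_label_moment[OF P ind ub meas]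
  have m1: "(\<integral>\<omega>. x v \<omega> \<partial>P) = 0" for v
    using ind by (simp add: independent_standardized_def has_bochner_integral_integral_eq)
  have m2: "(\<integral>\<omega>. (x v \<omega>)\<^sup>2 \<partial>P) = 1" for v
  proof -
    have "variance (x v) = 1" using ind by (simp add: independent_standardized_def)
    then show ?thesis using m1[of v] by simp
  qed
  show "regular_family P x"
    unfolding regular_family_def
  proof (intro conjI allI impI)
    show "x \<alpha> \<in> borel_measurable P" for \<alpha> by (rule meas)
    show "\<exists>C. \<forall>f T. finite T \<and> card T = N \<longrightarrow>
          moment_bounded P x f T C" for N
      by (rule bounded_label_moments[OF P ub meas])
  next
    fix f :: "nat \<times> nat \<Rightarrow> 'i" and T :: "(nat \<times> nat) set" and p
    assume "finite T \<and> p \<in> T \<and> {p'\<in>T. f p' = f p} = {p}"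
    then have T: "finite T" "p \<in> T" "{p'\<in>T. f p' = f p} = {p}" by auto
    have "(\<integral>\<omega>. x (f p) \<omega> ^ card {p'\<in>T. f p' = f p} \<partial>P) = 0" unfolding T(3) using m1 by simp
    then show "label_moment P x f T = 0"
      unfolding lm[OF T(1)] using T(1,2) by (intro prod_zero) auto
  next
    fix f :: "nat \<times> nat \<Rightarrow> 'i" and T :: "(nat \<times> nat) set"
    assume "finite T \<and> (\<forall>p\<in>T. card {p'\<in>T. f p' = f p} = 2)"
    then have T: "finite T" "\<forall>p\<in>T. card {p'\<in>T. f p' = f p} = 2" by auto
    show "label_moment P x f T = 1"
      unfolding lm[OF T(1)] using T(2) m2 by (intro prod.neutral) auto
  qed
  show "factorizing P x"
    unfolding factorizing_def
  proof (intro allI impI; elim conjE)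
    fix f :: "nat \<times> nat \<Rightarrow> 'i" and T T' :: "(nat \<times> nat) set"
    assume T: "finite T" "finite T'" "T \<inter> T' = {}" "f ` T \<inter> f ` T' = {}"
    have e1: "{p\<in>T \<union> T'. f p = v} = {p\<in>T. f p = v}" if "v \<in> f ` T" for v using T(4) that by auto
    have e2: "{p\<in>T \<union> T'. f p = v} = {p\<in>T'. f p = v}" if "v \<in> f ` T'" for v using T(4) that by auto
    have fin: "finite (T \<union> T')" using T by simp
    show "label_moment P x f (T \<union> T') = label_moment P x f T * label_moment P x f T'"
      unfolding lm[OF fin] lm[OF T(1)] lm[OF T(2)] image_Un
      using T by (subst prod.union_disjoint)
        (simp_all only: finite_imageI e1 e2 cong: prod.cong)
  qed
qed

section \<open>Centred products over several cycles\<close>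

definition cyc_prod :: "('i \<Rightarrow> 'w \<Rightarrow> real) \<Rightarrow> 'i link \<Rightarrow> nat \<Rightarrow> exponents \<Rightarrow> (nat \<Rightarrow> nat) \<Rightarrow> 'w \<Rightarrow> real" where
  "cyc_prod x L m \<epsilon> i \<omega> = (\<Prod>u\<in>{1..m}. x (link_value L m \<epsilon> i u) \<omega>)"

definition cyc_mean :: "'w measure \<Rightarrow> ('i \<Rightarrow> 'w \<Rightarrow> real) \<Rightarrow> 'i link \<Rightarrow> nat \<Rightarrow> exponents \<Rightarrow> (nat \<Rightarrow> nat) \<Rightarrow> real" where
  "cyc_mean P x L m \<epsilon> i = (\<integral>\<omega>. cyc_prod x L m \<epsilon> i \<omega> \<partial>P)"

definition centred_moment :: "'w measure \<Rightarrow> ('i \<Rightarrow> 'w \<Rightarrow> real) \<Rightarrow> 'i link \<Rightarrow> nat \<Rightarrow> nat \<Rightarrow> exponents \<Rightarrow>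
    config \<Rightarrow> real" where
  "centred_moment P x L r m \<epsilon> F =
     (\<integral>\<omega>. (\<Prod>l<r. cyc_prod x L m \<epsilon> (F l) \<omega> - cyc_mean P x L m \<epsilon> (F l)) \<partial>P)"

abbreviation cycles_moment where
  "cycles_moment P x L m \<epsilon> F S \<equiv> label_moment P x (cyc_label L m \<epsilon> F) (S \<times> {1..m})"

lemma prod_cyc_prod:
  "(\<Prod>l\<in>S. cyc_prod x L m \<epsilon> (F l) \<omega>) = (\<Prod>p\<in>S \<times> {1..m}. x (cyc_label L m \<epsilon> F p) \<omega>)"
  by (simp add: cyc_prod_def cyc_label_def prod.cartesian_product case_prod_unfold)

lemma integral_prod_cyc_prod:
  "(\<integral>\<omega>. (\<Prod>l\<in>S. cyc_prod x L m \<epsilon> (F l) \<omega>) \<partial>P) = cycles_moment P x L m \<epsilon> F S"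
  unfolding prod_cyc_prod label_moment_def ..

lemma cyc_mean_label_moment:
  "cyc_mean P x L m \<epsilon> (F l) = label_moment P x (cyc_label L m \<epsilon> F) ({l} \<times> {1..m})"
  using integral_prod_cyc_prod[where S = "{l}"] by (simp add: cyc_mean_def)

lemma regular_family_bound:
  assumes "regular_family P x"
  obtains K where "K \<ge> 1"
    "\<And>f T. finite T \<Longrightarrow> card T \<le> N \<Longrightarrow> moment_bounded P x f T K"
proof -
  have "\<forall>n. \<exists>C. \<forall>f T. finite T \<and> card T = n \<longrightarrow>
        moment_bounded P x f T C"
    using assms unfolding regular_family_def by (elim conjE)
  then obtain C where C: "\<And>n f T. finite T \<Longrightarrow> card T = n \<Longrightarrow>
        moment_bounded P x f T (C n)"
    by (elim choice[THEN exE]) blast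
  define K where "K = 1 + (\<Sum>n\<le>N. \<bar>C n\<bar>)"
  have le: "C n \<le> K" if "n \<le> N" for n
  proof -
    have "\<bar>C n\<bar> \<le> (\<Sum>n\<le>N. \<bar>C n\<bar>)" using that by (intro member_le_sum) auto
    then show ?thesis by (simp add: K_def)
  qed
  show ?thesis
  proof (rule that)
    show "K \<ge> 1" by (simp add: K_def sum_nonneg)
    show "moment_bounded P x f T K"
      if "finite T" "card T \<le> N" for f T
      using C[OF that(1) refl, of f] le[OF that(2)] by linarith
  qed
qed

lemma prod_centred_expand:
  fixes a c :: "nat \<Rightarrow> real"
  shows "(\<Prod>l<r. a l - c l) = (\<Sum>S\<in>Pow {..<r}. (\<Prod>l\<in>S. a l) * (\<Prod>l\<in>{..<r} - S. - c l))"
  using prod_add[of "{..<r}" a "\<lambda>l. - c l"] by simp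

lemma integrable_prod_cyc:
  fixes F :: config
  assumes "regular_family P x" "finite S"
  shows "integrable P (\<lambda>\<omega>. \<Prod>l\<in>S. cyc_prod x L m \<epsilon> (F l) \<omega>)"
proof -
  obtain K where "\<And>f T. finite T \<Longrightarrow> card T \<le> card (S \<times> {1..m}) \<Longrightarrow> moment_bounded P x f T K"
    using regular_family_bound[OF assms(1)] by blast
  from this[of "S \<times> {1..m}" "cyc_label L m \<epsilon> F"] show ?thesis
    unfolding prod_cyc_prod using assms(2) by simp
qed

lemma integrable_centred:
  fixes F :: config
  assumes "regular_family P x"
  shows "integrable P (\<lambda>\<omega>. \<Prod>l<r. cyc_prod x L m \<epsilon> (F l) \<omega> - cyc_mean P x L m \<epsilon> (F l))"
  unfolding prod_centred_expand
  by (intro Bochner_Integration.integrable_sum integrable_mult_left integrable_prod_cyc[OF assms])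
    (auto intro: finite_subset)

lemma centred_moment_expand:
  assumes "regular_family P x"
  shows "centred_moment P x L r m \<epsilon> F =
    (\<Sum>S\<in>Pow {..<r}. cycles_moment P x L m \<epsilon> F S *
        (\<Prod>l\<in>{..<r} - S. - cyc_mean P x L m \<epsilon> (F l)))"
proof -
  have int: "integrable P (\<lambda>\<omega>. (\<Prod>l\<in>S. cyc_prod x L m \<epsilon> (F l) \<omega>) * (\<Prod>l\<in>{..<r} - S. - cyc_mean P x L m \<epsilon> (F l)))"
    if "S \<in> Pow {..<r}" for S
    using that by (intro integrable_mult_left integrable_prod_cyc[OF assms]) (auto intro: finite_subset)
  show ?thesis
    unfolding centred_moment_def prod_centred_expand
    by (subst Bochner_Integration.integral_sum[OF int]) (simp_all add: integral_prod_cyc_prod)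
qed

lemma centred_moment_bounded:
  assumes "regular_family P x"
  obtains K where "\<And>L \<epsilon> F. \<bar>centred_moment P x L r m \<epsilon> F\<bar> \<le> K"
    "\<And>L \<epsilon> F S. S \<subseteq> {..<r} \<Longrightarrow> \<bar>cycles_moment P x L m \<epsilon> F S\<bar> \<le> K"
    "K \<ge> 1"
proof -
  \<comment> \<open>The size \<open>(r + 1) * m\<close> covers moments of up to \<open>r\<close>
    cycles and also the mean of a single cycle when \<open>r = 0\<close>.\<close>
  obtain K where K: "K \<ge> 1" "\<And>f T. finite T \<Longrightarrow> card T \<le> (r + 1) * m \<Longrightarrow> moment_bounded P x f T K"
    using regular_family_bound[OF assms, of "(r + 1) * m"] by blast
  have cm: "\<bar>cyc_mean P x L m \<epsilon> (F l)\<bar> \<le> K" for L \<epsilon> and F :: config and l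
    unfolding cyc_mean_label_moment using K(2)[of "{l} \<times> {1..m}"] by simp
  have lm: "\<bar>cycles_moment P x L m \<epsilon> F S\<bar> \<le> K" if "S \<subseteq> {..<r}" for S L \<epsilon> F
  proof -
    have "card S \<le> r" using card_mono[OF _ that] by simp
    then have "card (S \<times> {1..m}) \<le> (r + 1) * m"
      by (simp add: card_cartesian_product trans_le_add2)
    moreover have "finite (S \<times> {1..m})" using finite_subset[OF that] by simp
    ultimately show ?thesis using K(2) by blast
  qed
  have "\<bar>centred_moment P x L r m \<epsilon> F\<bar> \<le> 2 ^ r * (K * K ^ r)" for L \<epsilon> F
  proof -
    have "\<bar>centred_moment P x L r m \<epsilon> F\<bar> \<le> (\<Sum>S\<in>Pow {..<r}. \<bar>cycles_moment P x L m \<epsilon> F S *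
        (\<Prod>l\<in>{..<r} - S. - cyc_mean P x L m \<epsilon> (F l))\<bar>)"
      unfolding centred_moment_expand[OF assms] by (rule sum_abs)
    also have "\<dots> \<le> (\<Sum>S\<in>Pow {..<r}. K * K ^ r)"
    proof (rule sum_mono)
      fix S assume S: "S \<in> Pow {..<r}"
      have "\<bar>\<Prod>l\<in>{..<r} - S. - cyc_mean P x L m \<epsilon> (F l)\<bar> \<le> (\<Prod>l\<in>{..<r} - S. K)"
        unfolding abs_prod by (rule prod_mono) (simp add: cm)
      also have "\<dots> = K ^ card ({..<r} - S)" by simp
      also have "\<dots> \<le> K ^ r"
        using K(1) card_mono[of "{..<r}" "{..<r} - S"] by (intro power_increasing) auto
      finally have "\<bar>\<Prod>l\<in>{..<r} - S. - cyc_mean P x L m \<epsilon> (F l)\<bar> \<le> K ^ r" .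
      then show "\<bar>cycles_moment P x L m \<epsilon> F S *
        (\<Prod>l\<in>{..<r} - S. - cyc_mean P x L m \<epsilon> (F l))\<bar> \<le> K * K ^ r"
        unfolding abs_mult using S K(1) lm[of S L \<epsilon> F] by (intro mult_mono) auto
    qed
    also have "\<dots> = 2 ^ r * (K * K ^ r)" by (simp add: card_Pow)
    finally show ?thesis .
  qed
  moreover have "K \<le> 2 ^ r * (K * K ^ r)"
  proof -
    have "1 * (K * 1) \<le> 2 ^ r * (K * K ^ r)" using K(1) by (intro mult_mono) auto
    then show ?thesis by simp
  qed
  ultimately show ?thesis using K(1) lm
    by (intro that[of "2 ^ r * (K * K ^ r)"]) (blast intro: order_trans)+
qed

lemma no_singleE:
  assumes "\<not> no_single L r m \<epsilon> F"
  obtains l u where "l < r" "u \<in> {1..m}" "block L r m \<epsilon> F (l, u) = {(l, u)}"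
proof -
  obtain p where p: "p \<in> {..<r} \<times> {1..m}" "card (block L r m \<epsilon> F p) < 2"
    using assms unfolding no_single_def by (auto simp: not_le)
  have "p \<in> block L r m \<epsilon> F p" using p(1) by (simp add: block_def)
  moreover have "finite (block L r m \<epsilon> F p)" by (simp add: block_def)
  ultimately have "card (block L r m \<epsilon> F p) = 1"
    using p(2) card_gt_0_iff[of "block L r m \<epsilon> F p"] by (intro antisym) auto
  then have "block L r m \<epsilon> F p = {p}"
    using \<open>p \<in> block L r m \<epsilon> F p\<close> by (auto simp: card_1_singleton_iff)
  then show ?thesis using p(1) that[of "fst p" "snd p"] by (simp add: mem_Times_iff)
qed

lemma label_moment_single:
  assumes reg: "regular_family P x" and S: "S \<subseteq> {..<r}" "l \<in> S" and u: "u \<in> {1..m}"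
    and b: "block L r m \<epsilon> F (l, u) = {(l, u)}"
  shows "cycles_moment P x L m \<epsilon> F S = 0"
proof -
  have "{p' \<in> S \<times> {1..m}. cyc_label L m \<epsilon> F p' = cyc_label L m \<epsilon> F (l, u)} = {(l, u)}"
  proof
    show "{p' \<in> S \<times> {1..m}. cyc_label L m \<epsilon> F p' = cyc_label L m \<epsilon> F (l, u)} \<subseteq> {(l, u)}"
      unfolding b[symmetric] block_def using S by auto
  qed (use S u in auto)
  moreover have "finite (S \<times> {1..m})" using S finite_subset by auto
  moreover have "(l, u) \<in> S \<times> {1..m}" using S u by simp
  moreover have "\<forall>f T p. finite T \<and> p \<in> T \<and> {p'\<in>T. f p' = f p} = {p} \<longrightarrow> label_moment P x f T = 0"
    using reg unfolding regular_family_def by (elim conjE)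
  ultimately show ?thesis by blast
qed

text \<open>A subset in the expansion either contains the cycle with the isolated label, and its
  moment vanishes, or omits it, and then the vanishing mean of that cycle is a factor.\<close>

lemma centred_moment_single:
  assumes reg: "regular_family P x" and s: "\<not> no_single L r m \<epsilon> F"
  shows "centred_moment P x L r m \<epsilon> F = 0"
proof -
  obtain l u where lu: "l < r" "u \<in> {1..m}" "block L r m \<epsilon> F (l, u) = {(l, u)}"
    using no_singleE[OF s] by blast
  have cm: "cyc_mean P x L m \<epsilon> (F l) = 0"
    unfolding cyc_mean_label_moment
    by (rule label_moment_single[OF reg _ _ lu(2,3)]) (use lu in auto)
  show ?thesis
    unfolding centred_moment_expand[OF reg]
  proof (rule sum.neutral, rule ballI)
    fix S assume S: "S \<in> Pow {..<r}"
    show "cycles_moment P x L m \<epsilon> F S *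
        (\<Prod>l\<in>{..<r} - S. - cyc_mean P x L m \<epsilon> (F l)) = 0"
    proof (cases "l \<in> S")
      case True
      then show ?thesis using label_moment_single[OF reg _ True lu(2,3)] S by simp
    next
      case False
      then have "l \<in> {..<r} - S" using lu by simp
      then have "(\<Prod>l\<in>{..<r} - S. - cyc_mean P x L m \<epsilon> (F l)) = 0"
        using cm by (intro prod_zero) auto
      then show ?thesis by simp
    qed
  qed
qed

text \<open>The set \<open>S\<close> has to be closed under blocks: a pair cut by it would leave an
  isolated label and the moment 0 instead of 1.\<close>

lemma label_moment_pairs:
  assumes reg: "regular_family P x" and S: "S \<subseteq> {..<r}"
    and two: "\<And>p. p \<in> S \<times> {1..m} \<Longrightarrow> card (block L r m \<epsilon> F p) = 2"
    and sub: "\<And>p. p \<in> S \<times> {1..m} \<Longrightarrow> block L r m \<epsilon> F p \<subseteq> S \<times> {1..m}"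
  shows "cycles_moment P x L m \<epsilon> F S = 1"
proof -
  have "card {p' \<in> S \<times> {1..m}. cyc_label L m \<epsilon> F p' = cyc_label L m \<epsilon> F p} = 2" if p: "p \<in> S \<times> {1..m}" for p
  proof -
    have "{p' \<in> S \<times> {1..m}. cyc_label L m \<epsilon> F p' = cyc_label L m \<epsilon> F p} = block L r m \<epsilon> F p"
      using sub[OF p] S unfolding block_def by blast
    then show ?thesis using two[OF p] by simp
  qed
  moreover have "finite (S \<times> {1..m})" using S finite_subset by auto
  moreover have "\<forall>f T. finite T \<and> (\<forall>p\<in>T. card {p'\<in>T. f p' = f p} = 2) \<longrightarrow> label_moment P x f T = 1"
    using reg unfolding regular_family_def by (elim conjE)
  ultimately show ?thesis by blast
qed

text \<open>This is the substitute for independence in (a). With two cycles, an unlinked one means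
  that no pair joins them; then all moments and means in the expansion are 1, and it collapses to
  \<open>(1 - 1) * (1 - 1)\<close>.\<close>

lemma centred_moment_unlinked_pairs:
  assumes reg: "regular_family P x"
    and two: "\<And>p. p \<in> {..<2} \<times> {1..m} \<Longrightarrow> card (block L 2 m \<epsilon> F p) = 2"
    and un: "\<not> all_linked L 2 m \<epsilon> F"
  shows "centred_moment P x L 2 m \<epsilon> F = 0"
proof -
  obtain l where l: "l < 2" "\<And>u p'. u \<in> {1..m} \<Longrightarrow> p' \<in> block L 2 m \<epsilon> F (l, u) \<Longrightarrow> fst p' = l"
    using un unfolding all_linked_def by blast
  have own: "fst p' = fst p" if p: "p \<in> {..<2} \<times> {1..m}" and p': "p' \<in> block L 2 m \<epsilon> F p" for p p'
  proof (rule ccontr)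
    assume ne: "fst p' \<noteq> fst p"
    have p'2: "p' \<in> {..<2} \<times> {1..m}" "p \<in> block L 2 m \<epsilon> F p'" using p p' by (auto simp: block_def)
    have lt: "fst p < 2" "fst p' < 2" using p p'2(1) by auto
    then have "fst p = l \<or> fst p' = l" using ne l(1) by linarith
    then show False
    proof
      assume "fst p = l"
      then show False using l(2)[of "snd p" p'] p p' ne by auto
    next
      assume "fst p' = l"
      then show False using l(2)[of "snd p'" p] p'2 ne by auto
    qed
  qed
  have lm: "cycles_moment P x L m \<epsilon> F S = 1" if S: "S \<subseteq> {..<2}" for S
  proof (rule label_moment_pairs[OF reg S])
    fix p assume p: "p \<in> S \<times> {1..m}"
    then have p2: "p \<in> {..<2} \<times> {1..m}" using S by auto
    then show "card (block L 2 m \<epsilon> F p) = 2" by (rule two)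
    show "block L 2 m \<epsilon> F p \<subseteq> S \<times> {1..m}"
      using own[OF p2] p by (force simp: block_def)
  qed
  have cm: "cyc_mean P x L m \<epsilon> (F l) = 1" if "l < 2" for l
    unfolding cyc_mean_label_moment by (rule lm) (use that in simp)
  have "centred_moment P x L 2 m \<epsilon> F = (\<Sum>S\<in>Pow {..<2::nat}. (\<Prod>l\<in>S. 1) * (\<Prod>l\<in>{..<2} - S. - (1::real)))"
    unfolding centred_moment_expand[OF reg]
  proof (rule sum.cong[OF refl])
    fix S assume S: "S \<in> Pow {..<2::nat}"
    have "(\<Prod>l\<in>{..<2} - S. - cyc_mean P x L m \<epsilon> (F l)) = (\<Prod>l\<in>{..<2} - S. - 1)"
      by (rule prod.cong[OF refl]) (simp add: cm)
    then show "cycles_moment P x L m \<epsilon> F S * (\<Prod>l\<in>{..<2} - S. - cyc_mean P x L m \<epsilon> (F l))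
        = (\<Prod>l\<in>S. 1) * (\<Prod>l\<in>{..<2} - S. - 1)"
      using lm[of S] S by simp
  qed
  also have "\<dots> = (\<Prod>l<(2::nat). 1 - (1::real))" by (rule prod_centred_expand[symmetric])
  finally show ?thesis by simp
qed

text \<open>The subsets in the expansion are matched as \<open>S\<close> and
  \<open>insert l S\<close> with \<open>l\<close> outside \<open>S\<close>. The unlinked cycle
  \<open>l\<close> splits off from the moment of \<open>insert l S\<close>, so the two terms differ
  only in sign.\<close>

lemma centred_moment_factorizing:
  assumes reg: "regular_family P x" and fac: "factorizing P x"
    and un: "\<not> all_linked L r m \<epsilon> F"
  shows "centred_moment P x L r m \<epsilon> F = 0"
proof -
  obtain l where l: "l < r" "\<And>u p'. u \<in> {1..m} \<Longrightarrow> p' \<in> block L r m \<epsilon> F (l, u) \<Longrightarrow> fst p' = l"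
    using un unfolding all_linked_def by blast
  define R where "R = {..<r} - {l}"
  define lm where "lm S = cycles_moment P x L m \<epsilon> F S" for S
  define c where "c l = - cyc_mean P x L m \<epsilon> (F l)" for l
  define g where "g S = lm S * (\<Prod>l\<in>{..<r} - S. c l)" for S
  have R: "{..<r} = insert l R" "l \<notin> R" "finite R" using l(1) by (auto simp: R_def)
  have cl: "c l = - lm {l}" by (simp add: c_def lm_def cyc_mean_label_moment)
  have split: "lm (insert l S) = lm {l} * lm S" if S: "S \<subseteq> R" for S
  proof -
    have "insert l S \<times> {1..m} = ({l} \<times> {1..m}) \<union> (S \<times> {1..m})" by auto
    moreover have "finite (S \<times> {1..m})" using S R(3) finite_subset by auto
    moreover have "({l} \<times> {1..m}) \<inter> (S \<times> {1..m}) = {}" using S R(2) by auto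
    moreover have "cyc_label L m \<epsilon> F ` ({l} \<times> {1..m}) \<inter> cyc_label L m \<epsilon> F ` (S \<times> {1..m}) = {}"
    proof (rule ccontr)
      assume "cyc_label L m \<epsilon> F ` ({l} \<times> {1..m}) \<inter> cyc_label L m \<epsilon> F ` (S \<times> {1..m}) \<noteq> {}"
      then obtain p p' where p: "p \<in> {l} \<times> {1..m}" "p' \<in> S \<times> {1..m}" "cyc_label L m \<epsilon> F p = cyc_label L m \<epsilon> F p'"
        by blast
      then have "p' \<in> block L r m \<epsilon> F (l, snd p)" using S by (auto simp: block_def R_def)
      then have "fst p' = l" using l(2)[of "snd p" p'] p(1) by auto
      then show False using p(2) S R(2) by auto
    qed
    ultimately show ?thesis
      using fac[unfolded factorizing_def, rule_format, of "{l} \<times> {1..m}" "S \<times> {1..m}" "cyc_label L m \<epsilon> F"]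
      unfolding lm_def by simp
  qed
  have zero: "g S + g (insert l S) = 0" if S: "S \<in> Pow R" for S
  proof -
    have "{..<r} - S = insert l (R - S)" "{..<r} - insert l S = R - S" using S R by auto
    moreover have "l \<notin> R - S" "finite (R - S)" using R by auto
    ultimately show ?thesis using split[of S] S by (simp add: g_def cl algebra_simps)
  qed
  have "centred_moment P x L r m \<epsilon> F = (\<Sum>S\<in>Pow {..<r}. g S)"
    unfolding centred_moment_expand[OF reg] g_def lm_def c_def ..
  also have "\<dots> = (\<Sum>S\<in>Pow R. g S) + (\<Sum>S\<in>insert l ` Pow R. g S)"
    unfolding R(1) Pow_insert by (rule sum.union_disjoint) (use R in auto)
  also have "(\<Sum>S\<in>insert l ` Pow R. g S) = (\<Sum>S\<in>Pow R. g (insert l S))"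
  proof (subst sum.reindex)
    show "inj_on (insert l) (Pow R)"
      using R(2) by (intro inj_onI) (metis Diff_insert_absorb PowD subsetD)
  qed simp
  also have "(\<Sum>S\<in>Pow R. g S) + (\<Sum>S\<in>Pow R. g (insert l S)) = (\<Sum>S\<in>Pow R. g S + g (insert l S))"
    by (rule sum.distrib[symmetric])
  also have "\<dots> = 0" using zero by (intro sum.neutral) auto
  finally show ?thesis .
qed

text \<open>A single big block makes the estimate of \<open>card_big_blocks\<close> strict, and by
  integrality the number of labels drops below \<open>r * m / 2\<close>.\<close>

lemma few_labels_of_big_block:
  assumes ns: "no_single L r m \<epsilon> F" and p: "p \<in> {..<r} \<times> {1..m}" "card (block L r m \<epsilon> F p) \<noteq> 2"
  shows "card (labels L r m \<epsilon> F) \<le> (r * m - 1) div 2"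
proof -
  have "2 \<le> card (block L r m \<epsilon> F p)" using ns p(1) unfolding no_single_def by blast
  then have "p \<in> {p \<in> {..<r} \<times> {1..m}. 3 \<le> card (block L r m \<epsilon> F p)}" using p by simp
  moreover have "finite {p \<in> {..<r} \<times> {1..m}. 3 \<le> card (block L r m \<epsilon> F p)}" by simp
  ultimately have "card {p \<in> {..<r} \<times> {1..m}. 3 \<le> card (block L r m \<epsilon> F p)} > 0"
    by (subst card_gt_0_iff) blast
  then show ?thesis using card_big_blocks[OF ns] by linarith
qed

lemma sum_centred_moment:
  assumes reg: "regular_family P x" and K: "link_bounded L K" and m: "m \<ge> 1"
    and r: "r = 2 \<or> factorizing P x"
  shows "\<exists>C. \<forall>n\<ge>1. (\<Sum>F\<in>configs r m n. \<bar>centred_moment P x L r m \<epsilon> F\<bar>) \<le> C * real n ^ ((3 * (r * m) + 5 * r) div 6)"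
proof -
  define e where "e = (3 * (r * m) + 5 * r) div 6"
  define A where "A n = {F \<in> configs r m n. no_single L r m \<epsilon> F \<and> all_linked L r m \<epsilon> F}" for n
  \<comment> \<open>For two cycles, a block of size at least three destroys the cancellation of
    unlinked cycles; such configurations are bounded in number instead.\<close>
  define B where "B n = (if r = 2 then {F \<in> configs r m n. card (labels L r m \<epsilon> F) \<le> (r * m - 1) div 2} else {})" for n
  obtain M where M: "\<And>L \<epsilon> F. \<bar>centred_moment P x L r m \<epsilon> F\<bar> \<le> M"
    "\<And>L \<epsilon> F S. S \<subseteq> {..<r} \<Longrightarrow> \<bar>cycles_moment P x L m \<epsilon> F S\<bar> \<le> M" "M \<ge> 1"
    by (rule centred_moment_bounded[OF reg, of r m]) (rule that)
  have "\<exists>C. \<forall>n\<ge>1. card (A n) \<le> C * n ^ e"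
    unfolding A_def e_def by (rule card_linked_configs[OF K m])
  then obtain C1 where "\<forall>n\<ge>1. card (A n) \<le> C1 * n ^ e" ..
  then have C1: "\<And>n. n \<ge> 1 \<Longrightarrow> card (A n) \<le> C1 * n ^ e" by simp
  define C2 where "C2 = 2 ^ (r * m) * (r * m * K) ^ (r * m - ((r * m - 1) div 2 + r))"
  have C2: "card (B n) \<le> C2 * n ^ e" if n: "n \<ge> 1" for n
  proof (cases "r = 2")
    case True
    \<comment> \<open>At most \<open>m - 1\<close> labels and two starting vertices: the same
      exponent \<open>m + 1\<close> as for two linked cycles.\<close>
    have "(r * m - 1) div 2 + r = e" unfolding e_def True using m by simp
    then show ?thesis
      using card_configs_few_labels[OF K m n, of r \<epsilon> "(r * m - 1) div 2"] True unfolding B_def C2_def by simp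
  next
    case False
    then show ?thesis by (simp add: B_def)
  qed
  have zero: "centred_moment P x L r m \<epsilon> F = 0" if F: "F \<in> configs r m n" "F \<notin> A n \<union> B n" for F n
  proof (cases "no_single L r m \<epsilon> F")
    case False
    then show ?thesis by (rule centred_moment_single[OF reg])
  next
    case True
    then have un: "\<not> all_linked L r m \<epsilon> F" using F by (auto simp: A_def)
    show ?thesis
    proof (cases "r = 2")
      case r2: True
      have "card (block L r m \<epsilon> F p) = 2" if "p \<in> {..<r} \<times> {1..m}" for p
        using few_labels_of_big_block[OF True that] F r2 unfolding B_def by auto
      then show ?thesis using centred_moment_unlinked_pairs[OF reg, of m L \<epsilon> F] un r2 by simp
    next
      case False
      then show ?thesis using centred_moment_factorizing[OF reg _ un] r by simp
    qed
  qed
  have "(\<Sum>F\<in>configs r m n. \<bar>centred_moment P x L r m \<epsilon> F\<bar>) \<le> (M * real (C1 + C2)) * real n ^ e" if n: "n \<ge> 1" for n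
  proof -
    have sub: "A n \<union> B n \<subseteq> configs r m n" by (auto simp: A_def B_def)
    have "(\<Sum>F\<in>configs r m n. \<bar>centred_moment P x L r m \<epsilon> F\<bar>) = (\<Sum>F\<in>A n \<union> B n. \<bar>centred_moment P x L r m \<epsilon> F\<bar>)"
      by (rule sum.mono_neutral_right[OF finite_configs sub]) (use zero in auto)
    also have "\<dots> \<le> real (card (A n \<union> B n)) * M"
      by (rule sum_bounded_above) (rule M(1))
    also have "\<dots> \<le> real ((C1 + C2) * n ^ e) * M"
    proof (rule mult_right_mono)
      have "card (A n \<union> B n) \<le> (C1 + C2) * n ^ e"
        using card_Un_le[of "A n" "B n"] C1[OF n] C2[OF n] by (simp add: algebra_simps)
      then show "real (card (A n \<union> B n)) \<le> real ((C1 + C2) * n ^ e)" by (rule of_nat_mono)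
    qed (use M(3) in simp)
    finally show ?thesis by (simp add: mult_ac)
  qed
  then show ?thesis unfolding e_def[symmetric] by blast
qed

section \<open>The moments of a circular variable\<close>

text \<open>Walks with \<open>m\<close> unit steps from \<open>d\<close> to 0, without a
  barrier.\<close>

fun path_count :: "nat \<Rightarrow> int \<Rightarrow> int" where
  "path_count 0 d = (if d = 0 then 1 else 0)"
| "path_count (Suc m) d = path_count m (d - 1) + path_count m (d + 1)"

lemma path_count_neg: "path_count m (- d) = path_count m d"
proof (induction m arbitrary: d)
  case (Suc m)
  have "path_count (Suc m) (- d) = path_count m (- (d + 1)) + path_count m (- (d - 1))" by simp
  then show ?case unfolding Suc.IH by simp
qed simp

lemma path_count_outside: "d < - int m \<Longrightarrow> path_count m d = 0"
  by (induction m arbitrary: d) auto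

lemma path_count_odd: "odd (int m + d) \<Longrightarrow> path_count m d = 0"
  by (induction m arbitrary: d) auto

text \<open>A walk from \<open>2 * i - m\<close> to 0 takes exactly \<open>i\<close> of its
  \<open>m\<close> steps downwards, and the binomial coefficient selects them.\<close>

lemma path_count_eq: "path_count m (2 * int i - int m) = int (m choose i)"
proof (induction m arbitrary: i)
  case 0
  then show ?case by (cases i) auto
next
  case (Suc m)
  show ?case
  proof (cases i)
    case 0
    have "path_count (Suc m) (2 * int i - int (Suc m)) =
        path_count m (- int m - 2) + path_count m (2 * int 0 - int m)"
      using 0 by (simp add: algebra_simps)
    also have "\<dots> = 1" unfolding Suc.IH by (simp add: path_count_outside)
    finally show ?thesis using 0 by simp
  next
    case (Suc i')
    have "path_count (Suc m) (2 * int i - int (Suc m)) =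
        path_count m (2 * int i' - int m) + path_count m (2 * int (Suc i') - int m)"
      unfolding Suc path_count.simps by (intro arg_cong2[of _ _ _ _ "(+)"] arg_cong[of _ _ "path_count m"]) simp_all
    then show ?thesis unfolding Suc.IH Suc by simp
  qed
qed

text \<open>Walks with \<open>m\<close> unit steps from height \<open>k\<close> to 0 that never
  become negative. They will reappear as the state of \<open>s ^ m\<close> times the Wick product of
  \<open>k\<close> equal letters, for a semi-circular \<open>s\<close>.\<close>

fun ballot :: "nat \<Rightarrow> nat \<Rightarrow> int" where
  "ballot 0 k = (if k = 0 then 1 else 0)"
| "ballot (Suc m) 0 = ballot m 1"
| "ballot (Suc m) (Suc k) = ballot m (Suc (Suc k)) + ballot m k"

text \<open>The reflection principle.\<close>

lemma ballot_eq_path_count: "ballot m k = path_count m (int k) - path_count m (int k + 2)"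
proof (induction m k rule: ballot.induct)
  case (1 k)
  then show ?case by simp
next
  case (2 m)
  then show ?case using path_count_neg[of m 1] by simp
next
  case (3 m k)
  then show ?case by (simp add: algebra_simps)
qed

lemma ballot_0: "of_int (ballot m 0) = (if even m then catalan (m div 2) else (0::complex))"
proof (cases "even m")
  case True
  then obtain n where m: "m = 2 * n" by blast
  \<comment> \<open>This relation turns the difference of two neighbouring binomial coefficients,
    which the reflection principle yields, into the Catalan number.\<close>
  have "Suc n * (2 * n choose Suc n) = n * (2 * n choose n)"
  proof (cases n)
    case (Suc n')
    have "Suc n * (2 * n choose Suc n) = 2 * n * (2 * n - 1 choose n)"
      by (rule binomial_absorption)
    also have "\<dots> = (2 * n - n) * (2 * n choose n)" by (rule binomial_absorb_comp[symmetric])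
    finally show ?thesis by simp
  qed simp
  then have c: "of_nat (Suc n) * of_nat (2 * n choose Suc n) = (of_nat n * of_nat (2 * n choose n) :: complex)"
    by (metis of_nat_mult)
  have "ballot m 0 = int (2 * n choose n) - int (2 * n choose Suc n)"
    using path_count_eq[of "2 * n" n] path_count_eq[of "2 * n" "Suc n"]
    by (simp add: ballot_eq_path_count m algebra_simps)
  then have "of_nat (Suc n) * (of_int (ballot m 0) :: complex) =
      of_nat (Suc n) * of_nat (2 * n choose n) - of_nat (Suc n) * of_nat (2 * n choose Suc n)"
    by (simp only: of_int_diff of_int_of_nat_eq right_diff_distrib)
  also have "\<dots> = of_nat (2 * n choose n)" unfolding c by (simp add: algebra_simps)
  finally have "of_int (ballot m 0) = (of_nat (2 * n choose n) / of_nat (n + 1) :: complex)"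
    using of_nat_neq_0[of n, where ?'a = complex] by (simp add: field_simps del: of_nat_Suc)
  then show ?thesis using m by (simp add: catalan_def)
next
  case False
  then show ?thesis by (simp add: ballot_eq_path_count path_count_odd)
qed

section \<open>Wick products of free semi-circular elements\<close>

text \<open>For \<open>\<kappa>\<close> the covariance of the generators, multiplying the Wick product of \<open>k # v\<close> by \<open>f j\<close> gives the Wick
  product of \<open>j # k # v\<close> plus \<open>\<kappa> j k\<close> times that of \<open>v\<close>.\<close>

fun wick :: "('a, 'm) star_prob_struct_scheme \<Rightarrow> ('b \<Rightarrow> 'a) \<Rightarrow> ('b \<Rightarrow> 'b \<Rightarrow> complex) \<Rightarrow> 'b list \<Rightarrow> 'a" where
  "wick A f \<kappa> [] = \<one>\<^bsub>A\<^esub>"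
| "wick A f \<kappa> [j] = f j"
| "wick A f \<kappa> (j # k # v) =
     (f j \<otimes>\<^bsub>A\<^esub> wick A f \<kappa> (k # v)) \<oplus>\<^bsub>A\<^esub> ((- \<kappa> j k) \<odot>\<^bsub>A\<^esub> wick A f \<kappa> v)"

definition delta :: "'b \<Rightarrow> 'b \<Rightarrow> complex" where
  "delta j k = (if j = k then 1 else 0)"

lemma wick_cong: "(\<And>j. j \<in> set v \<Longrightarrow> f j = g j) \<Longrightarrow> wick A f \<kappa> v = wick A g \<kappa> v"
  by (induction A f \<kappa> v rule: wick.induct) auto

context star_prob_space
begin

lemma smult_in: "a \<in> carrier A \<Longrightarrow> z \<odot> a \<in> carrier A"
  by (rule vec.smult_closed) (simp_all add: class_ring_simps)

lemma smult_zero: "a \<in> carrier A \<Longrightarrow> (0::complex) \<odot> a = \<zero>"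
  using vec.smult_l_null by (simp add: class_ring_simps)

lemma state_lin:
  assumes "a \<in> carrier A" "b \<in> carrier A" "d \<in> carrier A"
  shows "state A (d \<otimes> (a \<oplus> z \<odot> b)) = state A (d \<otimes> a) + z * state A (d \<otimes> b)"
  using assms by (simp add: alg.r_distr smult_in smult_mult_right state_add state_smult)

lemma wick_closed: "(\<And>j. f j \<in> carrier A) \<Longrightarrow> wick A f \<kappa> v \<in> carrier A"
  by (induction v rule: induct_list012) (simp_all add: smult_in)

text \<open>The recursion of \<open>wick\<close> read backwards: a letter multiplied from the left
  is either kept or contracted with the first letter of the Wick product.\<close>

lemma state_mult_wick_Cons:
  assumes f: "\<And>j. f j \<in> carrier A" and a: "a \<in> carrier A"
  shows "state A ((a \<otimes> f j) \<otimes> wick A f \<kappa> v) = state A (a \<otimes> wick A f \<kappa> (j # v)) +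
     (case v of [] \<Rightarrow> 0 | k # v' \<Rightarrow> \<kappa> j k * state A (a \<otimes> wick A f \<kappa> v'))"
  using f a wick_closed[of f, OF f]
  by (cases v) (simp_all add: state_lin alg.m_assoc)

text \<open>No contraction crosses the border between the two groups, because \<open>delta\<close>
  vanishes for different letters.\<close>

lemma wick_replicate_append:
  assumes f: "\<And>j. f j \<in> carrier A" and v: "v = [] \<or> hd v \<noteq> j"
  shows "wick A f delta (replicate n j @ v) = wick A f delta (replicate n j) \<otimes> wick A f delta v"
proof (induction n rule: induct_nat_012)
  case 0
  then show ?case using wick_closed[of f, OF f] by simp
next
  case 1
  show ?case
  proof (cases v)
    case Nil
    then show ?thesis using f by simp
  next
    case (Cons k v')
    then have "delta j k = 0" using v by (simp add: delta_def)
    then show ?thesis using Cons f wick_closed[of f, OF f] by (simp add: smult_zero)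
  qed
next
  case (ge2 n)
  then show ?case using f wick_closed[of f, OF f] wick_closed[of f delta "j # replicate n j", OF f]
    by (simp add: alg.l_distr smult_in smult_mult_left alg.m_assoc)
qed

text \<open>For equal letters the Wick products are rescaled Chebyshev polynomials of the second
  kind, and their recursion is that of \<open>ballot\<close>. The start \<open>k = 0\<close> is the
  moment formula of a semi-circular variable.\<close>

lemma state_pow_mult_wick:
  assumes f: "f j \<in> carrier A"
    and sc: "\<And>k. state A (f j [^] (k::nat)) = (if even k then catalan (k div 2) else 0)"
  shows "state A (f j [^] m \<otimes> wick A (\<lambda>_. f j) delta (replicate k j)) = of_int (ballot m k)"
proof (induction k arbitrary: m rule: induct_nat_012)
  case 0
  then show ?case using f sc by (simp add: ballot_0)
next
  case 1
  then show ?case using f sc[of "Suc m"] ballot_0[of "Suc m"] by (simp add: ballot.simps(2) del: div_Suc even_Suc)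
next
  case (ge2 k)
  have f': "\<And>i. (\<lambda>_. f j) i \<in> carrier A" using f by simp
  have "state A (f j [^] m \<otimes> wick A (\<lambda>_. f j) delta (replicate (Suc (Suc k)) j)) =
      state A (f j [^] Suc m \<otimes> wick A (\<lambda>_. f j) delta (replicate (Suc k) j))
      - state A (f j [^] m \<otimes> wick A (\<lambda>_. f j) delta (replicate k j))"
    using state_mult_wick_Cons[of "\<lambda>_. f j" "f j [^] m" j delta "replicate (Suc k) j"] f
    by (simp add: delta_def)
  also have "\<dots> = of_int (ballot (Suc m) (Suc k)) - of_int (ballot m k)"
    by (simp only: ge2.IH)
  finally show ?case by simp
qed

lemma wick_in_generated:
  "wick A (\<lambda>_. a) \<kappa> v \<in> generated_algebra A {a}"
  by (induction v rule: induct_list012) (auto intro: generated_algebra.intros)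

text \<open>The case \<open>m = 0\<close> of the preceding formula: a walk without steps cannot
  descend from \<open>n > 0\<close>.\<close>

lemma state_wick_replicate:
  assumes f: "f j \<in> carrier A"
    and sc: "\<And>k. state A (f j [^] (k::nat)) = (if even k then catalan (k div 2) else 0)"
    and n: "n > 0"
  shows "state A (wick A f delta (replicate n j)) = 0"
proof -
  have w: "wick A f delta (replicate n j) = wick A (\<lambda>_. f j) delta (replicate n j)"
    by (rule wick_cong) simp
  have "wick A (\<lambda>_. f j) delta (replicate n j) \<in> carrier A" by (rule wick_closed) (rule f)
  then show ?thesis unfolding w using state_pow_mult_wick[of f j, OF f sc, of 0 n] n by simp
qed

text \<open>Grouping equal letters turns a Wick product into an alternating product of centred elements.\<close>

lemma state_wick_free:
  assumes f: "\<And>j. f j \<in> carrier A"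
    and sc: "\<And>j k. state A (f j [^] (k::nat)) = (if even k then catalan (k div 2) else 0)"
    and free: "free_subalgebras A (\<lambda>j. generated_algebra A {f j})" and v: "v \<noteq> []"
  shows "state A (wick A f delta v) = 0"
proof -
  \<comment> \<open>The decomposition remembers the first letter of \<open>v\<close>; this shows
    that a group put in front differs in its letter from the next group.\<close>
  have "\<exists>ps. distinct_adj (map fst ps) \<and>
      (\<forall>(j, a) \<in> set ps. a \<in> generated_algebra A {f j} \<and> state A a = 0) \<and>
      wick A f delta v = foldr (\<lambda>(j, a) b. a \<otimes> b) ps \<one> \<and>
      (v \<noteq> [] \<longrightarrow> ps \<noteq> [] \<and> fst (hd ps) = hd v) \<and> (v = [] \<longrightarrow> ps = [])"
  proof (induction "length v" arbitrary: v rule: less_induct)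
    case less
    show ?case
    proof (cases v)
      case Nil
      then show ?thesis by (intro exI[of _ "[]"]) simp
    next
      case (Cons j v')
      define w where "w = dropWhile (\<lambda>x. x = j) v"
      define n where "n = length (takeWhile (\<lambda>x. x = j) v)"
      have n: "n > 0" by (simp add: n_def Cons)
      have "\<forall>x\<in>set (takeWhile (\<lambda>x. x = j) v). x = j" by (auto dest: set_takeWhileD)
      then have rep: "takeWhile (\<lambda>x. x = j) v = replicate n j"
        unfolding n_def by (intro replicate_eqI) auto
      have vw: "v = replicate n j @ w" unfolding w_def rep[symmetric] by simp
      have wj: "w = [] \<or> hd w \<noteq> j" unfolding w_def using hd_dropWhile[of "\<lambda>x. x = j" v] by auto
      have "length w < length v" using vw n by simp
      from less(1)[OF this] obtain ps where ps: "distinct_adj (map fst ps)"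
        "\<forall>(j, a) \<in> set ps. a \<in> generated_algebra A {f j} \<and> state A a = 0"
        "wick A f delta w = foldr (\<lambda>(j, a) b. a \<otimes> b) ps \<one>"
        "w \<noteq> [] \<longrightarrow> ps \<noteq> [] \<and> fst (hd ps) = hd w" "w = [] \<longrightarrow> ps = []" by blast
      define c where "c = wick A f delta (replicate n j)"
      have c: "c \<in> generated_algebra A {f j}" "state A c = 0"
      proof -
        have "c = wick A (\<lambda>_. f j) delta (replicate n j)"
          unfolding c_def by (rule wick_cong) simp
        then show "c \<in> generated_algebra A {f j}" by (simp add: wick_in_generated)
        show "state A c = 0" unfolding c_def by (rule state_wick_replicate[of f, OF f sc n])
      qed
      have "wick A f delta v = c \<otimes> wick A f delta w"
        unfolding c_def vw by (rule wick_replicate_append[of f, OF f wj])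
      moreover have "distinct_adj (map fst ((j, c) # ps))"
        using ps(1,4,5) wj by (cases ps) auto
      ultimately show ?thesis
        using ps(2,3) c Cons by (intro exI[of _ "(j, c) # ps"]) auto
    qed
  qed
  then obtain ps where "distinct_adj (map fst ps)" "ps \<noteq> []"
      "\<forall>(j, a) \<in> set ps. a \<in> generated_algebra A {f j} \<and> state A a = 0"
      "wick A f delta v = foldr (\<lambda>(j, a) b. a \<otimes> b) ps \<one>"
    using v by blast
  then show ?thesis using free unfolding free_subalgebras_def by simp
qed

end

text \<open>The multilinear expansion of a word whose letters are combinations of two generators, as
  \<open>c\<close> and its adjoint are combinations of \<open>s\<close> and
  \<open>t\<close>.\<close>

fun word_mix :: "('b \<Rightarrow> bool \<Rightarrow> complex) \<Rightarrow> 'b list \<Rightarrow> (bool list \<Rightarrow> complex) \<Rightarrow> complex" where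
  "word_mix \<gamma> [] \<phi> = \<phi> []"
| "word_mix \<gamma> (e # v) \<phi> =
     \<gamma> e True * word_mix \<gamma> v (\<lambda>j. \<phi> (True # j)) + \<gamma> e False * word_mix \<gamma> v (\<lambda>j. \<phi> (False # j))"

lemma word_mix_add: "word_mix \<gamma> v (\<lambda>j. \<phi> j + \<psi> j) = word_mix \<gamma> v \<phi> + word_mix \<gamma> v \<psi>"
  by (induction v arbitrary: \<phi> \<psi>) (simp_all add: algebra_simps)

lemma word_mix_mult: "word_mix \<gamma> v (\<lambda>j. z * \<phi> j) = z * word_mix \<gamma> v \<phi>"
  by (induction v arbitrary: \<phi>) (simp_all add: algebra_simps)

lemma word_mix_zero: "(\<And>j. length j = length v \<Longrightarrow> \<phi> j = 0) \<Longrightarrow> word_mix \<gamma> v \<phi> = 0"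
  by (induction v arbitrary: \<phi>) simp_all

context star_prob_space
begin

text \<open>Wick products are multilinear in the generators, provided that the covariance transforms
  along.\<close>

lemma state_mult_wick_mix:
  assumes f: "\<And>j. f j \<in> carrier A"
    and g: "\<And>e. g e = (\<gamma> e True \<odot> f True) \<oplus> (\<gamma> e False \<odot> f False)"
    and \<kappa>: "\<And>e e'. \<kappa> e e' = \<gamma> e True * \<gamma> e' True + \<gamma> e False * \<gamma> e' False"
    and a: "a \<in> carrier A"
  shows "state A (a \<otimes> wick A g \<kappa> v) = word_mix \<gamma> v (\<lambda>j. state A (a \<otimes> wick A f delta j))"
  using a
proof (induction v arbitrary: a rule: induct_list012)
  have fw: "wick A f delta j \<in> carrier A" for j by (rule wick_closed) (rule f)
  have gin: "g e \<in> carrier A" for e using f by (simp add: g smult_in)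
  have gw: "wick A g \<kappa> v \<in> carrier A" for v by (rule wick_closed) (rule gin)
  have expand: "state A ((a \<otimes> g e) \<otimes> b) =
      \<gamma> e True * state A ((a \<otimes> f True) \<otimes> b) + \<gamma> e False * state A ((a \<otimes> f False) \<otimes> b)"
    if "a \<in> carrier A" "b \<in> carrier A" for a b e
    using that f
    by (simp add: g alg.r_distr alg.l_distr smult_in smult_mult_right smult_mult_left state_add state_smult)
  {
    case 1
    then show ?case by simp
  next
    case (2 e)
    then show ?case using expand[OF 2, of \<one> e] f gin by simp
  next
    case (3 e e' v)
    let ?S = "\<lambda>j. state A (a \<otimes> wick A f delta j)"
    have ag: "a \<otimes> g e \<in> carrier A" using 3(3) gin by simp
    have "state A (a \<otimes> wick A g \<kappa> (e # e' # v)) =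
        state A ((a \<otimes> g e) \<otimes> wick A g \<kappa> (e' # v)) - \<kappa> e e' * state A (a \<otimes> wick A g \<kappa> v)"
      using state_mult_wick_Cons[of g a e \<kappa> "e' # v", OF gin 3(3)] by simp
    also have "\<dots> = word_mix \<gamma> (e' # v) (\<lambda>j. state A ((a \<otimes> g e) \<otimes> wick A f delta j))
        - \<kappa> e e' * word_mix \<gamma> v ?S"
      by (simp only: 3(2)[OF ag] 3(1)[OF 3(3)])
    \<comment> \<open>The contractions of the first two letters occur only between equal generators.
      Weighted by the coefficients they add up to \<open>\<kappa> e e'\<close>, the correction in
      the recursion on the other side.\<close>
    also have "word_mix \<gamma> (e' # v) (\<lambda>j. state A ((a \<otimes> g e) \<otimes> wick A f delta j)) =
       word_mix \<gamma> (e # e' # v) ?S + \<kappa> e e' * word_mix \<gamma> v ?S"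
    proof -
      have step: "state A ((a \<otimes> f b) \<otimes> wick A f delta (b' # j)) =
          ?S (b # b' # j) + delta b b' * ?S j" for b b' j
        using state_mult_wick_Cons[of f a b delta "b' # j", OF f 3(3)] by simp
      show ?thesis
        by (simp add: expand[OF 3(3) fw] step word_mix_add word_mix_mult delta_def \<kappa> algebra_simps
            del: wick.simps)
    qed
    finally show ?case by simp
  }
qed

end

text \<open>Counts the ways to reach the empty stack when every letter read is either pushed or cancelled
  against an opposite letter on top of the stack.\<close>

fun stack_count :: "star_exp list \<Rightarrow> star_exp list \<Rightarrow> nat" where
  "stack_count [] v = (if v = [] then 1 else 0)"
| "stack_count (e # u) [] = stack_count u [e]"
| "stack_count (e # u) (e' # v) =
     stack_count u (e # e' # v) + (if e \<noteq> e' then stack_count u v else 0)"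

lemma nc_monom_append:
  fixes A (structure)
  assumes "star_prob_space A" "c \<in> carrier A"
  shows "nc_monom A c w \<in> carrier A"
    and "nc_monom A c (w @ w') = nc_monom A c w \<otimes>\<^bsub>A\<^esub> nc_monom A c w'"
proof -
  interpret star_prob_space A by (rule assms)
  have e: "star_pow A c e \<in> carrier A" for e using assms(2) adj_closed by (cases e) auto
  show in': "nc_monom A c w \<in> carrier A" for w
    by (induction w) (simp_all add: nc_monom_def e)
  show "nc_monom A c (w @ w') = nc_monom A c w \<otimes>\<^bsub>A\<^esub> nc_monom A c w'"
  proof (induction w)
    case Nil
    then show ?case using in'[of w'] by (simp add: nc_monom_def)
  next
    case (Cons x w)
    then show ?case using in'[of w'] in'[of w] e[of x] by (simp add: nc_monom_def alg.m_assoc)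
  qed
qed

text \<open>The word is read from its right end and the Wick product serves as the stack: a letter
  is pushed, or contracted with the top letter if the two are opposite. At the end, only the empty
  Wick product has a non-zero state.\<close>

lemma state_nc_monom_circular:
  fixes A (structure)
  assumes A: "star_prob_space A" and c: "circular A c"
  shows "state A (nc_monom A c w) = of_nat (stack_count (rev w) [])"
proof -
  interpret star_prob_space A by (rule A)
  obtain s t where s: "semicircular A s" and t: "semicircular A t"
    and free: "freely_independent A s t"
    and c: "c = (1 / complex_of_real (sqrt 2)) \<odot> (s \<oplus> (\<i> \<odot> t))"
    using c unfolding circular_def by blast
  have st: "s \<in> carrier A" "t \<in> carrier A" "adj A s = s" "adj A t = t"
    using s t by (auto simp: semicircular_def)
  define f where "f = case_bool s t"
  define r where "r = (1 / complex_of_real (sqrt 2))"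
  \<comment> \<open>The coordinates of \<open>c\<close> and its adjoint in \<open>s\<close> and
    \<open>t\<close>. Their covariance is bilinear, without conjugation, hence 0 for equal and 1 for
    opposite exponents.\<close>
  define \<gamma> where "\<gamma> e b = (if b then r else if e = Plain then r * \<i> else - (r * \<i>))" for e b
  define \<kappa> :: "star_exp \<Rightarrow> star_exp \<Rightarrow> complex" where "\<kappa> e e' = (if e \<noteq> e' then 1 else 0)" for e e'
  have rr: "r * r = 1 / 2" "cnj r = r"
    by (simp_all add: r_def of_real_mult[symmetric] del: of_real_mult)
  have f: "f j \<in> carrier A" for j using st by (cases j) (auto simp: f_def)
  have lin: "z \<odot> (a \<oplus> b) = z \<odot> a \<oplus> z \<odot> b" "z \<odot> (z' \<odot> a) = (z * z') \<odot> a"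
    if "a \<in> carrier A" "b \<in> carrier A" for a b z z'
    using vec.smult_r_distr[of z a b] vec.smult_assoc1[of z z' a] that by (simp_all add: class_ring_simps)
  have g: "star_pow A c e = (\<gamma> e True \<odot> f True) \<oplus> (\<gamma> e False \<odot> f False)" for e
  proof (cases e)
    case Plain
    then show ?thesis unfolding c r_def[symmetric] using st by (simp add: lin smult_in f_def \<gamma>_def)
  next
    case Adj
    have "adj A c = r \<odot> s \<oplus> (r * - \<i>) \<odot> t"
      unfolding c r_def[symmetric] using st
      by (simp add: adj_smult adj_add smult_in rr lin)
    then show ?thesis using Adj by (simp add: f_def \<gamma>_def)
  qed
  have c_in: "c \<in> carrier A" unfolding c using st by (simp add: smult_in)
  have gin: "star_pow A c e \<in> carrier A" for e unfolding g using f by (simp add: smult_in)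
  have \<kappa>: "\<kappa> e e' = \<gamma> e True * \<gamma> e' True + \<gamma> e False * \<gamma> e' False" for e e'
  proof -
    have "r * \<i> * (r * \<i>) = - (1 / 2)" using rr(1) by (simp add: algebra_simps)
    then show ?thesis using rr(1) by (cases e; cases e') (simp_all add: \<kappa>_def \<gamma>_def field_simps)
  qed
  have \<kappa>e: "\<kappa> e e' = (if e \<noteq> e' then 1 else 0)" for e e' by (simp add: \<kappa>_def)
  have "(\<lambda>j. generated_algebra A {f j}) = case_bool (generated_algebra A {s}) (generated_algebra A {t})"
    by (rule ext) (simp add: f_def split: bool.split)
  then have fr: "free_subalgebras A (\<lambda>j. generated_algebra A {f j})"
    using free by (simp add: freely_independent_def)
  have sc: "state A (f j [^] (k::nat)) = (if even k then catalan (k div 2) else 0)" for j k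
    using s t by (cases j) (auto simp: f_def semicircular_def)
  let ?W = "wick A (star_pow A c) \<kappa>"
  have W_in: "?W v \<in> carrier A" for v by (rule wick_closed) (rule gin)
  have W0: "state A (?W v) = (if v = [] then 1 else 0)" for v
  proof (cases "v = []")
    case True
    then show ?thesis by (simp add: state_one)
  next
    case False
    have "state A (\<one> \<otimes> ?W v) = word_mix \<gamma> v (\<lambda>j. state A (\<one> \<otimes> wick A f delta j))"
      by (rule state_mult_wick_mix) (simp_all add: f g \<kappa>)
    also have "\<dots> = 0"
    proof (rule word_mix_zero)
      fix j :: "bool list" assume "length j = length v"
      then have "j \<noteq> []" using False by auto
      then show "state A (\<one> \<otimes> wick A f delta j) = 0"
        using state_wick_free[of f, OF f sc fr] wick_closed[of f delta j, OF f] by simp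
    qed
    finally show ?thesis using False W_in[of v] by simp
  qed
  \<comment> \<open>\<open>u\<close> holds the letters still to be read, in reading order, and
    \<open>v\<close> is the stack.\<close>
  have "state A (nc_monom A c (rev u) \<otimes> ?W v) = of_nat (stack_count u v)" for u v
  proof (induction u v rule: stack_count.induct)
    case (1 v)
    then show ?case using W0[of v] W_in[of v] by (simp add: nc_monom_def)
  next
    case (2 e u)
    have "state A (nc_monom A c (rev (e # u)) \<otimes> ?W []) =
        state A ((nc_monom A c (rev u) \<otimes> star_pow A c e) \<otimes> ?W [])"
      using nc_monom_append(2)[OF A c_in, of "rev u" "[e]"] gin[of e]
      by (simp add: nc_monom_def[of _ _ "[e]"])
    then show ?case
      using 2 state_mult_wick_Cons[of "star_pow A c" "nc_monom A c (rev u)" e \<kappa> "[]", OF gin nc_monom_append(1)[OF A c_in]]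
      by simp
  next
    case (3 e u e' v)
    have "state A (nc_monom A c (rev (e # u)) \<otimes> ?W (e' # v)) =
        state A ((nc_monom A c (rev u) \<otimes> star_pow A c e) \<otimes> ?W (e' # v))"
      using nc_monom_append(2)[OF A c_in, of "rev u" "[e]"] gin[of e]
      by (simp add: nc_monom_def[of _ _ "[e]"])
    then show ?case
      using 3 state_mult_wick_Cons[of "star_pow A c" "nc_monom A c (rev u)" e \<kappa> "e' # v", OF gin nc_monom_append(1)[OF A c_in]]
        \<kappa>e[of e e'] by (cases "e = e'") (simp_all del: wick.simps)
  qed
  from this[of "rev w" "[]"] show ?thesis using nc_monom_append(1)[OF A c_in, of w] by simp
qed

section \<open>Non-crossing pairings as runs of the stack machine\<close>

text \<open>The positions in \<open>T\<close> lie above \<open>u\<close> and are still on the stack, waiting for a partner in \<open>{1..u}\<close>.\<close>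

definition matched_pairings :: "(nat \<Rightarrow> star_exp) \<Rightarrow> nat \<Rightarrow> nat set \<Rightarrow> nat set set set" where
  "matched_pairings lab u T = {\<pi>. partition_on ({1..u} \<union> T) \<pi> \<and> noncrossing \<pi> \<and>
     (\<forall>B\<in>\<pi>. card B = 2 \<and> lab (Min B) \<noteq> lab (Max B) \<and> \<not> B \<subseteq> T)}"

lemma finite_matched_pairings: "finite T \<Longrightarrow> finite (matched_pairings lab u T)"
  by (rule finite_subset[of _ "Pow (Pow ({1..u} \<union> T))"]) (auto simp: matched_pairings_def partition_on_def)

lemma noncrossingD:
  "\<lbrakk>noncrossing \<pi>; B \<in> \<pi>; B' \<in> \<pi>; B \<noteq> B'; a < b; b < c; c < d; a \<in> B; c \<in> B; b \<in> B'; d \<in> B'\<rbrakk> \<Longrightarrow> False"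
  unfolding noncrossing_def by blast

text \<open>If \<open>Suc u\<close> is not paired with a waiting position, its partner lies in
  \<open>{1..u}\<close>, so it may itself be counted as waiting.\<close>

lemma matched_pairings_open:
  assumes "\<forall>B\<in>\<pi>. \<forall>x\<in>T. B \<noteq> {Suc u, x}"
  shows "\<pi> \<in> matched_pairings lab (Suc u) T \<longleftrightarrow> \<pi> \<in> matched_pairings lab u (insert (Suc u) T)"
proof -
  have S: "{1..Suc u} \<union> T = {1..u} \<union> insert (Suc u) T" by auto
  have "\<not> B \<subseteq> insert (Suc u) T" if B: "B \<in> \<pi>" "card B = 2" "\<not> B \<subseteq> T" for B
  proof
    assume sub: "B \<subseteq> insert (Suc u) T"
    then have p: "Suc u \<in> B" using B(3) by auto
    obtain x y where xy: "B = {x, y}" "x \<noteq> y" using B(2) by (meson card_2_iff)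
    then obtain z where z: "B = {Suc u, z}" "z \<noteq> Suc u" using p by auto
    then have "z \<in> T" using sub by auto
    then show False using assms B(1) z(1) by auto
  qed
  then show ?thesis unfolding matched_pairings_def S by auto
qed

text \<open>Only the nearest waiting position \<open>t\<close> can be the partner of
  \<open>Suc u\<close>. If the partner were some \<open>x\<close> beyond \<open>t\<close>, then
  \<open>t\<close> would be paired with some \<open>y \<le> u\<close>, and \<open>{y, t}\<close>
  would cross \<open>{Suc u, x}\<close>. Conversely, no other point lies between
  \<open>Suc u\<close> and \<open>t\<close>, so adding their pair creates no crossing.\<close>

lemma matched_pairings_close:
  assumes st: "\<forall>x\<in>set (t # st). Suc u < x" "sorted_wrt (<) (t # st)"
  shows "bij_betw (insert {Suc u, t}) (if lab (Suc u) \<noteq> lab t then matched_pairings lab u (set st) else {})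
     {\<pi> \<in> matched_pairings lab (Suc u) (set (t # st)). \<exists>B\<in>\<pi>. \<exists>x\<in>set (t # st). B = {Suc u, x}}"
    (is "bij_betw _ ?Q ?R")
proof -
  define p where "p = Suc u"
  define S' where "S' = {1..u} \<union> set st"
  define S where "S = {1..Suc u} \<union> set (t # st)"
  have tst: "\<forall>x\<in>set st. t < x" "p < t" using st by (auto simp: p_def)
  have nS': "p \<notin> S'" "t \<notin> S'" using st tst by (auto simp: p_def S'_def)
  have Sdiff: "S - {p, t} = S'" "{p, t} \<subseteq> S" using nS' by (auto simp: S_def S'_def p_def)
  have mm: "Min {p, t} = p" "Max {p, t} = t" using tst(2) by auto
  have R1: "{p, t} \<in> \<pi>" if \<pi>: "\<pi> \<in> matched_pairings lab (Suc u) (set (t # st))"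
    and ex: "\<exists>B\<in>\<pi>. \<exists>x\<in>set (t # st). B = {Suc u, x}" for \<pi>
  proof (rule ccontr)
    assume nt: "{p, t} \<notin> \<pi>"
    obtain x where x: "x \<in> set (t # st)" "{p, x} \<in> \<pi>" using ex unfolding p_def by blast
    have part: "partition_on S \<pi>" and nc: "noncrossing \<pi>"
      and bl: "\<And>B. B \<in> \<pi> \<Longrightarrow> card B = 2 \<and> \<not> B \<subseteq> set (t # st)"
      using \<pi> unfolding matched_pairings_def S_def by blast+
    have xt: "x \<noteq> t" using x(2) nt by auto
    then have tx: "t < x" using x(1) tst(1) by auto
    have "t \<in> \<Union>\<pi>" using part by (auto simp: partition_on_def S_def)
    then obtain B where B: "B \<in> \<pi>" "t \<in> B" by blast
    then obtain y where y: "B = {t, y}" "y \<noteq> t"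
      using bl[OF B(1)] by (auto simp: card_2_iff)
    have BS: "B \<subseteq> S" using part B(1) by (auto simp: partition_on_def)
    have "y \<noteq> p" using nt y B(1) by (auto simp: insert_commute)
    moreover have "y \<notin> set (t # st)" using bl[OF B(1)] y(1) by auto
    ultimately have "y < p" using BS y(1) by (auto simp: S_def p_def)
    moreover have "B \<noteq> {p, x}" using y(1) tst(2) xt by auto
    moreover have "y \<in> B" "p \<in> {p, x}" "x \<in> {p, x}" using y(1) by auto
    ultimately show False
      using noncrossingD[OF nc B(1) x(2), of y p t x] B(2) tst(2) tx by blast
  qed
  have R: "?R = {\<pi> \<in> matched_pairings lab (Suc u) (set (t # st)). {p, t} \<in> \<pi>}"
    proof (intro Collect_cong conj_cong refl iffI)
    fix \<pi> assume "\<pi> \<in> matched_pairings lab (Suc u) (set (t # st))" "\<exists>B\<in>\<pi>. \<exists>x\<in>set (t # st). B = {Suc u, x}"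
    then show "{p, t} \<in> \<pi>" by (rule R1)
  next
    fix \<pi> assume "{p, t} \<in> \<pi>"
    then show "\<exists>B\<in>\<pi>. \<exists>x\<in>set (t # st). B = {Suc u, x}"
      unfolding p_def by (intro bexI[of _ "{Suc u, t}"] bexI[of _ t]) simp_all
  qed
  have key: "insert {p, t} \<pi> \<in> ?R \<longleftrightarrow> \<pi> \<in> ?Q" if fresh: "{p, t} \<inter> \<Union>\<pi> = {}" for \<pi>
  proof -
    have part: "partition_on S (insert {p, t} \<pi>) \<longleftrightarrow> partition_on S' \<pi>"
      using partition_on_insert[of "{p, t}" \<pi> S] fresh Sdiff by (simp add: disjnt_def)
    have nin: "{p, t} \<notin> \<pi>" using fresh by auto
    have nc: "noncrossing (insert {p, t} \<pi>) \<longleftrightarrow> noncrossing \<pi>" if "partition_on S' \<pi>"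
    proof
      assume "noncrossing (insert {p, t} \<pi>)"
      then show "noncrossing \<pi>" unfolding noncrossing_def by blast
    next
      assume nc: "noncrossing \<pi>"
      have bt: "\<not> (p < x \<and> x < t)" if "x \<in> B" "B \<in> \<pi>" for x B
      proof -
        have "x \<in> S'" using that \<open>partition_on S' \<pi>\<close> by (auto simp: partition_on_def)
        then show ?thesis using tst(1) by (auto simp: S'_def p_def)
      qed
      show "noncrossing (insert {p, t} \<pi>)"
        unfolding noncrossing_def
      proof (intro notI, elim bexE exE conjE)
        fix B B' a b c d
        assume B: "B \<in> insert {p, t} \<pi>" "B' \<in> insert {p, t} \<pi>" "B \<noteq> B'"
          and o: "a < b" "b < c" "c < d" and i: "a \<in> B" "c \<in> B" "b \<in> B'" "d \<in> B'"
        consider "B = {p, t}" "B' \<in> \<pi>" | "B' = {p, t}" "B \<in> \<pi>" | "B \<in> \<pi>" "B' \<in> \<pi>"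
          using B by blast
        then show False
        proof cases
          case 1
          then have "a = p \<or> a = t" "c = p \<or> c = t" using i by auto
          then have "a = p" "c = t" using o tst(2) by auto
          then show False using bt[of b B'] 1 i o by auto
        next
          case 2
          then have "b = p \<or> b = t" "d = p \<or> d = t" using i by auto
          then have "b = p" "d = t" using o tst(2) by auto
          then show False using bt[of c B] 2 i o by auto
        next
          case 3
          then show False using nc B(3) o i unfolding noncrossing_def by blast
        qed
      qed
    qed
    have sub: "B \<subseteq> set (t # st) \<longleftrightarrow> B \<subseteq> set st" if "B \<in> \<pi>" for B
      using fresh that by auto
    have cpt: "card {p, t} = 2" "\<not> {p, t} \<subseteq> set (t # st)"
      using tst nS'(1) by (auto simp: S'_def)
    have all: "(\<forall>B\<in>insert {p, t} \<pi>. card B = 2 \<and> lab (Min B) \<noteq> lab (Max B) \<and> \<not> B \<subseteq> set (t # st)) \<longleftrightarrow>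
        lab p \<noteq> lab t \<and> (\<forall>B\<in>\<pi>. card B = 2 \<and> lab (Min B) \<noteq> lab (Max B) \<and> \<not> B \<subseteq> set st)"
    proof -
      have b: "(\<forall>B\<in>insert {p, t} \<pi>. P B) \<longleftrightarrow> P {p, t} \<and> (\<forall>B\<in>\<pi>. P B)" for P by blast
      have "(\<forall>B\<in>\<pi>. card B = 2 \<and> lab (Min B) \<noteq> lab (Max B) \<and> \<not> B \<subseteq> set (t # st)) \<longleftrightarrow>
          (\<forall>B\<in>\<pi>. card B = 2 \<and> lab (Min B) \<noteq> lab (Max B) \<and> \<not> B \<subseteq> set st)"
        by (intro ball_cong refl) (simp only: sub)
      then show ?thesis unfolding b mm using cpt by blast
    qed
    have "insert {p, t} \<pi> \<in> ?R \<longleftrightarrow> insert {p, t} \<pi> \<in> matched_pairings lab (Suc u) (set (t # st))"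
      unfolding R by blast
    also have "\<dots> \<longleftrightarrow> partition_on S' \<pi> \<and> noncrossing \<pi> \<and> lab p \<noteq> lab t \<and>
        (\<forall>B\<in>\<pi>. card B = 2 \<and> lab (Min B) \<noteq> lab (Max B) \<and> \<not> B \<subseteq> set st)"
      unfolding matched_pairings_def mem_Collect_eq S_def[symmetric] part all
      by (cases "partition_on S' \<pi>") (simp_all only: nc simp_thms)
    also have "\<dots> \<longleftrightarrow> \<pi> \<in> ?Q"
      unfolding matched_pairings_def S'_def[symmetric] p_def[symmetric] by simp
    finally show ?thesis .
  qed
  have fresh_Q: "{p, t} \<inter> \<Union>\<pi> = {}" if "\<pi> \<in> ?Q" for \<pi>
  proof -
    have "\<Union>\<pi> = S'" using that by (auto simp: matched_pairings_def partition_on_def S'_def split: if_splits)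
    then show ?thesis using nS' by auto
  qed
  show ?thesis
  proof (rule bij_betw_byWitness[where f' = "\<lambda>\<pi>. \<pi> - {{Suc u, t}}"])
    show "\<forall>\<pi>\<in>?Q. insert {Suc u, t} \<pi> - {{Suc u, t}} = \<pi>"
    proof
      fix \<pi> assume "\<pi> \<in> ?Q"
      then have "{Suc u, t} \<inter> \<Union>\<pi> = {}" using fresh_Q by (simp only: p_def)
      then have "{Suc u, t} \<notin> \<pi>" by auto
      then show "insert {Suc u, t} \<pi> - {{Suc u, t}} = \<pi>" by simp
    qed
    show "\<forall>\<pi>\<in>?R. insert {Suc u, t} (\<pi> - {{Suc u, t}}) = \<pi>"
      using R1 unfolding p_def by (simp add: insert_absorb)
    show "insert {Suc u, t} ` ?Q \<subseteq> ?R"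
      using key fresh_Q unfolding p_def by (intro image_subsetI) simp
    show "(\<lambda>\<pi>. \<pi> - {{Suc u, t}}) ` ?R \<subseteq> ?Q"
    proof (rule image_subsetI)
      fix \<pi> assume \<pi>: "\<pi> \<in> ?R"
      then have pt: "{p, t} \<in> \<pi>" unfolding R by simp
      have part: "partition_on S \<pi>"
        using \<pi> unfolding matched_pairings_def S_def mem_Collect_eq by (elim conjE)
      have "{p, t} \<inter> B = {}" if "B \<in> \<pi>" "B \<noteq> {p, t}" for B
        using part pt that unfolding partition_on_def by (auto dest: disjointD)
      then have "{p, t} \<inter> \<Union>(\<pi> - {{p, t}}) = {}" by blast
      moreover have "insert {p, t} (\<pi> - {{p, t}}) = \<pi>" using pt by (simp add: insert_absorb)
      ultimately show "\<pi> - {{Suc u, t}} \<in> ?Q" using key[of "\<pi> - {{p, t}}"] \<pi> by (simp only: p_def)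
    qed
  qed
qed

text \<open>The head of the increasing list \<open>st\<close> is the top of the stack. The two
  branches of \<open>stack_count\<close> correspond to \<open>Suc u\<close> waiting for a smaller
  partner and to \<open>Suc u\<close> being paired with the head.\<close>

lemma card_matched_pairings:
  assumes "\<forall>x\<in>set st. u < x" "sorted_wrt (<) st"
  shows "card (matched_pairings lab u (set st)) = stack_count (rev (map lab [1..<Suc u])) (map lab st)"
  using assms
proof (induction u arbitrary: st)
  case 0
  show ?case
  proof (cases st)
    case Nil
    have "matched_pairings lab 0 (set st) = {{}}"
      using Nil by (auto simp: matched_pairings_def partition_on_def noncrossing_def)
    then show ?thesis using Nil by simp
  next
    case (Cons t st')
    \<comment> \<open>With no position left to read, a waiting one would need a partner that is
      itself waiting, which is excluded.\<close>
    have "matched_pairings lab 0 (set st) = {}"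
    proof (rule equals0I)
      fix \<pi> assume "\<pi> \<in> matched_pairings lab 0 (set st)"
      then have "\<Union>\<pi> = set st" "\<forall>B\<in>\<pi>. \<not> B \<subseteq> set st"
        by (auto simp: matched_pairings_def partition_on_def)
      then show False using Cons by auto
    qed
    then show ?thesis using Cons by simp
  qed
next
  case (Suc u)
  let ?P = "\<lambda>\<pi>. \<exists>B\<in>\<pi>. \<exists>x\<in>set st. B = {Suc u, x}"
  have fin: "finite (matched_pairings lab (Suc u) (set st))" by (simp add: finite_matched_pairings)
  have "card (matched_pairings lab (Suc u) (set st)) =
      card {\<pi> \<in> matched_pairings lab (Suc u) (set st). \<not> ?P \<pi>} + card {\<pi> \<in> matched_pairings lab (Suc u) (set st). ?P \<pi>}"
    using fin by (subst card_Un_disjoint[symmetric]) (auto intro!: arg_cong[of _ _ card])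
  also have "{\<pi> \<in> matched_pairings lab (Suc u) (set st). \<not> ?P \<pi>} = matched_pairings lab u (set (Suc u # st))"
  proof -
    have "\<not> ?P \<pi>" if "\<pi> \<in> matched_pairings lab u (set (Suc u # st))" for \<pi>
      using that by (auto simp: matched_pairings_def)
    then show ?thesis using matched_pairings_open[of _ "set st" u lab] by auto
  qed
  also have "card (matched_pairings lab u (set (Suc u # st))) =
      stack_count (rev (map lab [1..<Suc u])) (map lab (Suc u # st))"
    by (rule Suc.IH) (use Suc.prems in auto)
  finally have eq: "card (matched_pairings lab (Suc u) (set st)) =
      stack_count (rev (map lab [1..<Suc u])) (map lab (Suc u # st)) +
      card {\<pi> \<in> matched_pairings lab (Suc u) (set st). ?P \<pi>}" .
  have r: "rev (map lab [1..<Suc (Suc u)]) = lab (Suc u) # rev (map lab [1..<Suc u])" by simp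
  show ?case
  proof (cases st)
    case Nil
    then show ?thesis using eq unfolding r by simp
  next
    case (Cons t st')
    have "card {\<pi> \<in> matched_pairings lab (Suc u) (set st). ?P \<pi>} =
        card (if lab (Suc u) \<noteq> lab t then matched_pairings lab u (set st') else {})"
      using bij_betw_same_card[OF matched_pairings_close[of t st' u lab]] Suc.prems Cons by simp
    also have "\<dots> = (if lab (Suc u) \<noteq> lab t then stack_count (rev (map lab [1..<Suc u])) (map lab st') else 0)"
    proof -
      have "\<forall>x\<in>set st'. u < x" "sorted_wrt (<) st'" using Suc.prems Cons by auto
      then show ?thesis using Suc.IH[of st'] by simp
    qed
    finally show ?thesis using eq Cons unfolding r by simp
  qed
qed

lemma finite_pair_partitions: "finite (pair_partitions m)"
  by (rule finite_subset[of _ "Pow (Pow {1..m})"]) (auto simp: pair_partitions_def partition_on_def)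

text \<open>The product is the indicator that every pair joins opposite exponents, and these
  pairings are the \<open>matched_pairings\<close> with nothing waiting.\<close>

lemma sum_nc_pair_partitions:
  assumes "length w = m"
  shows "(\<Sum>\<pi>\<in>nc_pair_partitions m. \<Prod>B\<in>\<pi>. 1 - (if w ! (Min B - 1) = w ! (Max B - 1) then 1 else 0))
     = real (stack_count (rev w) [])"
proof -
  define lab where "lab i = w ! (i - 1)" for i
  have w: "map lab [1..<Suc m] = w"
    using assms by (intro nth_equalityI) (auto simp: lab_def simp del: upt_Suc)
  have fin: "finite (nc_pair_partitions m)"
    by (rule finite_subset[OF _ finite_pair_partitions[of m]]) (auto simp: nc_pair_partitions_def)
  have finp: "finite \<pi>" if "\<pi> \<in> nc_pair_partitions m" for \<pi>
    using that finite_UnionD[of \<pi>] by (auto simp: nc_pair_partitions_def pair_partitions_def partition_on_def)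
  have "(\<Sum>\<pi>\<in>nc_pair_partitions m. \<Prod>B\<in>\<pi>. 1 - (if lab (Min B) = lab (Max B) then 1 else 0))
      = (\<Sum>\<pi>\<in>nc_pair_partitions m. if \<forall>B\<in>\<pi>. lab (Min B) \<noteq> lab (Max B) then 1 else (0::real))"
    using finp by (intro sum.cong refl) auto
  also have "\<dots> = real (card {\<pi> \<in> nc_pair_partitions m. \<forall>B\<in>\<pi>. lab (Min B) \<noteq> lab (Max B)})"
    using fin by (simp add: sum.inter_filter[symmetric])
  also have "{\<pi> \<in> nc_pair_partitions m. \<forall>B\<in>\<pi>. lab (Min B) \<noteq> lab (Max B)} = matched_pairings lab m {}"
    by (auto simp: matched_pairings_def nc_pair_partitions_def pair_partitions_def)
  also have "card \<dots> = stack_count (rev w) []"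
    using card_matched_pairings[of "[]" m lab] unfolding w by simp
  finally show ?thesis by (simp add: lab_def)
qed

section \<open>Traces of words\<close>

lemma state_nc_eval:
  assumes A: "star_prob_space A" and a: "a \<in> carrier A"
  shows "state A (nc_eval A Q a) =
    (\<Sum>w\<in>Poly_Mapping.keys Q. Poly_Mapping.lookup Q w * state A (nc_monom A a w))"
proof -
  interpret star_prob_space A by (rule A)
  have m: "nc_monom A a w \<in> carrier A" for w by (rule nc_monom_append(1)[OF A a])
  have z: "state A \<zero>\<^bsub>A\<^esub> = 0"
    using state_smult[of "\<one>\<^bsub>A\<^esub>" 0] smult_zero[of "\<one>\<^bsub>A\<^esub>"] by simp
  have "state A (\<Oplus>\<^bsub>A\<^esub>w\<in>K. Poly_Mapping.lookup Q w \<odot>\<^bsub>A\<^esub> nc_monom A a w) =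
      (\<Sum>w\<in>K. Poly_Mapping.lookup Q w * state A (nc_monom A a w))" if "finite K" for K
    using that
  proof (induction K)
    case empty
    then show ?case by (simp add: z)
  next
    case (insert w K)
    have "(\<lambda>w. Poly_Mapping.lookup Q w \<odot>\<^bsub>A\<^esub> nc_monom A a w) \<in> K \<rightarrow> carrier A"
      using m by (auto intro: smult_in)
    then show ?case using insert m
      by (simp add: alg.finsum_insert state_add state_smult smult_in)
  qed
  then show ?thesis by (simp add: nc_eval_def)
qed

definition word_exp :: "star_exp list \<Rightarrow> nat \<Rightarrow> star_exp" where
  "word_exp w u = w ! (u - 1)"

text \<open>The terminal vertex \<open>b\<close> is stored at position \<open>Suc (length w)\<close>,
  which also covers the empty word.\<close>

definition path_sum :: "(star_exp \<Rightarrow> nat \<Rightarrow> nat \<Rightarrow> 'r::comm_ring_1) \<Rightarrow> nat \<Rightarrow> star_exp list \<Rightarrow> nat \<Rightarrow> nat \<Rightarrow> 'r" where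
  "path_sum E n w a b = (\<Sum>i\<in>multi_indices (length w) n. (if (i(Suc (length w) := b)) 1 = a then 1 else 0) *
     (\<Prod>u\<in>{1..length w}. E (word_exp w u) (i u) ((i(Suc (length w) := b)) (Suc u))))"

lemma sum_PiE_insert:
  assumes "x \<notin> S"
  shows "(\<Sum>i\<in>PiE (insert x S) (\<lambda>_. B). f i) = (\<Sum>k\<in>B. \<Sum>i\<in>PiE S (\<lambda>_. B). f (i(x := k)))"
proof -
  have "(\<Sum>i\<in>PiE (insert x S) (\<lambda>_. B). f i) = (\<Sum>p\<in>B \<times> PiE S (\<lambda>_. B). f ((snd p)(x := fst p)))"
    unfolding PiE_insert_eq
    by (subst sum.reindex[OF inj_combinator[OF assms]]) (simp add: case_prod_unfold)
  also have "\<dots> = (\<Sum>k\<in>B. \<Sum>i\<in>PiE S (\<lambda>_. B). f (i(x := k)))"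
    by (simp add: sum.cartesian_product case_prod_unfold)
  finally show ?thesis .
qed

text \<open>Matrix multiplication by the last letter: the former terminal vertex \<open>k\<close>
  becomes an inner vertex and is summed over.\<close>

lemma path_sum_snoc:
  "path_sum E n (w @ [e]) a b = (\<Sum>k\<in>{1..n}. path_sum E n w a k * E e k b)"
proof -
  let ?m = "length w"
  let ?P = "\<lambda>i k M. \<Prod>u\<in>M. E (word_exp (w @ [e]) u) ((i(Suc ?m := k)) u) ((i(Suc ?m := k, Suc (Suc ?m) := b)) (Suc u))"
  let ?Q = "\<lambda>i k. \<Prod>u\<in>{1..?m}. E (word_exp w u) (i u) ((i(Suc ?m := k)) (Suc u))"
  let ?s = "\<lambda>i k. if (i(Suc ?m := k)) 1 = a then 1 else 0"
  have ins: "{1..Suc ?m} = insert (Suc ?m) {1..?m}" by auto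
  have we: "word_exp (w @ [e]) u = word_exp w u" if "u \<in> {1..?m}" for u
    using that by (auto simp: word_exp_def nth_append)
  have wl: "word_exp (w @ [e]) (Suc ?m) = e" by (simp add: word_exp_def)
  have "path_sum E n (w @ [e]) a b = (\<Sum>k\<in>{1..n}. \<Sum>i\<in>multi_indices ?m n.
      ?s i k *
      ?P i k {1..Suc ?m})"
    unfolding path_sum_def length_append_singleton ins
    by (subst sum_PiE_insert) simp_all
  also have "\<dots> = (\<Sum>k\<in>{1..n}. \<Sum>i\<in>multi_indices ?m n.
      ?s i k *
      ?Q i k * E e k b)"
  proof (intro sum.cong refl)
    fix k i
    have "?P i k {1..Suc ?m}
        = E e k b * ?P i k {1..?m}"
      unfolding ins by (subst prod.insert) (simp_all add: wl)
    also have "?P i k {1..?m}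
       = ?Q i k"
      by (intro prod.cong refl) (auto simp: we)
    finally show "?s i k *
      ?P i k {1..Suc ?m} =
      ?s i k *
      ?Q i k * E e k b"
      by (simp add: mult_ac)
  qed
  also have "\<dots> = (\<Sum>k\<in>{1..n}. path_sum E n w a k * E e k b)"
    unfolding path_sum_def by (simp add: sum_distrib_right)
  finally show ?thesis .
qed

lemma nc_monom_mat_index:
  assumes M: "M \<in> carrier_mat n n" and n: "n \<ge> 1"
    and E: "\<And>e a b. a \<in> {1..n} \<Longrightarrow> b \<in> {1..n} \<Longrightarrow> star_pow (mat_prob n) M e $$ (a - 1, b - 1) = E e a b"
  shows "a \<in> {1..n} \<Longrightarrow> b \<in> {1..n} \<Longrightarrow> nc_monom (mat_prob n) M w $$ (a - 1, b - 1) = path_sum E n w a b"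
proof (induction w arbitrary: a b rule: rev_induct)
  case Nil
  then have "(a - 1 = b - 1) = (b = a)" "a - 1 < n" "b - 1 < n" by auto
  then show ?case by (simp add: nc_monom_def path_sum_def)
next
  case (snoc e w)
  have sp: "star_prob_space (mat_prob n)" by (rule star_prob_space_mat[OF n])
  have Mc: "M \<in> carrier (mat_prob n)" using M by simp
  have c1: "nc_monom (mat_prob n) M v \<in> carrier_mat n n" for v
    using nc_monom_append(1)[OF sp Mc, of v] by simp
  have c2: "star_pow (mat_prob n) M e \<in> carrier_mat n n"
    using M by (cases e) (auto simp: mat_adjoint_carrier)
  have "nc_monom (mat_prob n) M (w @ [e]) = nc_monom (mat_prob n) M w * star_pow (mat_prob n) M e"
    using nc_monom_append(2)[OF sp Mc, of w "[e]"] c2 by (simp add: nc_monom_def[of _ _ "[e]"])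
  moreover have "a - 1 < n" "b - 1 < n" using snoc.prems by auto
  ultimately have "nc_monom (mat_prob n) M (w @ [e]) $$ (a - 1, b - 1) =
     (\<Sum>k<n. nc_monom (mat_prob n) M w $$ (a - 1, k) * star_pow (mat_prob n) M e $$ (k, b - 1))"
    using c1[of w] c2 by (simp add: scalar_prod_def atLeast0LessThan)
  also have "\<dots> = (\<Sum>k\<in>{1..n}. nc_monom (mat_prob n) M w $$ (a - 1, k - 1) * star_pow (mat_prob n) M e $$ (k - 1, b - 1))"
    by (rule sum.reindex_bij_witness[of _ "\<lambda>k. k - 1" Suc]) auto
  also have "\<dots> = (\<Sum>k\<in>{1..n}. path_sum E n w a k * E e k b)"
    using snoc E by (intro sum.cong refl) auto
  finally show ?case by (simp only: path_sum_snoc)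
qed

lemma sum_path_sum_diag:
  assumes "w \<noteq> []"
  shows "(\<Sum>a\<in>{1..n}. path_sum E n w a a) = (\<Sum>i\<in>multi_indices (length w) n.
     \<Prod>u\<in>{1..length w}. E (word_exp w u) (i u) (i (cyc_succ (length w) u)))"
proof -
  let ?m = "length w"
  have m: "?m \<ge> 1" using assms by (simp add: Suc_le_eq)
  have "(\<Sum>a\<in>{1..n}. path_sum E n w a a) = (\<Sum>i\<in>multi_indices ?m n. \<Sum>a\<in>{1..n}.
     (if (i(Suc ?m := a)) 1 = a then 1 else 0) *
     (\<Prod>u\<in>{1..?m}. E (word_exp w u) (i u) ((i(Suc ?m := a)) (Suc u))))"
    unfolding path_sum_def by (rule sum.swap)
  also have "\<dots> = (\<Sum>i\<in>multi_indices ?m n.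
     \<Prod>u\<in>{1..?m}. E (word_exp w u) (i u) (i (cyc_succ ?m u)))"
  proof (intro sum.cong refl)
    fix i assume "i \<in> multi_indices ?m n"
    then have i1: "i 1 \<in> {1..n}" using m by (intro PiE_mem[of i "{1..?m}" "\<lambda>_. {1..n}" 1]) auto
    \<comment> \<open>As the word is non-empty, vertex 1 is not the stored terminal vertex; the
      condition therefore selects \<open>a = i 1\<close>, which closes the path.\<close>
    have "(\<Sum>a\<in>{1..n}. (if (i(Suc ?m := a)) 1 = a then 1 else 0) *
       (\<Prod>u\<in>{1..?m}. E (word_exp w u) (i u) ((i(Suc ?m := a)) (Suc u)))) =
       (\<Sum>a\<in>{1..n}. if i 1 = a then (\<Prod>u\<in>{1..?m}. E (word_exp w u) (i u) ((i(Suc ?m := a)) (Suc u))) else 0)"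
      using m by (intro sum.cong refl) auto
    also have "\<dots> = (\<Prod>u\<in>{1..?m}. E (word_exp w u) (i u) ((i(Suc ?m := i 1)) (Suc u)))"
      using i1 by (simp add: sum.delta')
    also have "\<dots> = (\<Prod>u\<in>{1..?m}. E (word_exp w u) (i u) (i (cyc_succ ?m u)))"
      by (intro prod.cong refl) (auto simp: cyc_succ_def)
    finally show "(\<Sum>a\<in>{1..n}. (if (i(Suc ?m := a)) 1 = a then 1 else 0) *
       (\<Prod>u\<in>{1..?m}. E (word_exp w u) (i u) ((i(Suc ?m := a)) (Suc u)))) =
       (\<Prod>u\<in>{1..?m}. E (word_exp w u) (i u) (i (cyc_succ ?m u)))" .
  qed
  finally show ?thesis .
qed

definition word_moment ::
    "'s link \<Rightarrow> 't link \<Rightarrow> ('s \<Rightarrow> 'w \<Rightarrow> real) \<Rightarrow> ('t \<Rightarrow> 'w \<Rightarrow> real) \<Rightarrow>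
     star_exp list \<Rightarrow> nat \<Rightarrow> 'w \<Rightarrow> real" where
  "word_moment LX LY x y w n \<omega> = (1 / real n) * (1 / sqrt (real n)) ^ length w *
     (\<Sum>i\<in>multi_indices (length w) n.
        (\<Prod>u\<in>{1..length w}. x (link_value LX (length w) (word_exp w) i u) \<omega>) *
        (\<Prod>u\<in>{1..length w}. y (link_value LY (length w) (word_exp w) i u) \<omega>))"

lemma scaled_link_matrix_carrier: "scaled_link_matrix LX LY x y n \<omega> \<in> carrier_mat n n"
  by (simp add: scaled_link_matrix_def link_matrix_def)

lemma trace_word:
  assumes n: "n \<ge> 1" and w: "w \<noteq> []"
  shows "state (mat_prob n) (nc_monom (mat_prob n) (scaled_link_matrix LX LY x y n \<omega>) w)
      = of_real (word_moment LX LY x y w n \<omega>)"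
proof -
  define M where "M = scaled_link_matrix LX LY x y n \<omega>"
  define E where "E e a b = complex_of_real (1 / sqrt (real n) * (x (link_pow LX e a b) \<omega> * y (link_pow LY e a b) \<omega>))" for e a b
  let ?m = "length w"
  have M: "M \<in> carrier_mat n n" unfolding M_def by (rule scaled_link_matrix_carrier)
  have Mi: "M $$ (a - 1, b - 1) = complex_of_real (1 / sqrt (real n) * (x (LX a b) \<omega> * y (LY a b) \<omega>))"
    if "a \<in> {1..n}" "b \<in> {1..n}" for a b
  proof -
    have "a - 1 < n" "b - 1 < n" "Suc (a - 1) = a" "Suc (b - 1) = b" using that by auto
    then show ?thesis by (simp add: M_def scaled_link_matrix_def link_matrix_def)
  qed
  have E: "star_pow (mat_prob n) M e $$ (a - 1, b - 1) = E e a b" if ab: "a \<in> {1..n}" "b \<in> {1..n}" for e a b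
  proof (cases e)
    case Plain
    then show ?thesis using Mi[OF ab] by (simp add: E_def)
  next
    case Adj
    \<comment> \<open>The entries are real, so of the adjoint only the exchange of the indices
      remains.\<close>
    have "a - 1 < n" "b - 1 < n" using ab by auto
    then show ?thesis using Adj Mi[OF ab(2,1)] mat_adjoint_index[OF M, of "a - 1" "b - 1"] by (simp add: E_def)
  qed
  have c: "nc_monom (mat_prob n) M w \<in> carrier_mat n n"
    using nc_monom_append(1)[OF star_prob_space_mat[OF n], of M w] M by simp
  have "mat_trace (nc_monom (mat_prob n) M w) = (\<Sum>a<n. nc_monom (mat_prob n) M w $$ (a, a))"
    using c by (simp add: mat_trace_def)
  also have "\<dots> = (\<Sum>a\<in>{1..n}. nc_monom (mat_prob n) M w $$ (a - 1, a - 1))"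
    by (rule sum.reindex_bij_witness[of _ "\<lambda>k. k - 1" Suc]) auto
  also have "\<dots> = (\<Sum>a\<in>{1..n}. path_sum E n w a a)"
    by (intro sum.cong refl nc_monom_mat_index[OF M n E])
  also have "\<dots> = (\<Sum>i\<in>multi_indices ?m n. \<Prod>u\<in>{1..?m}. E (word_exp w u) (i u) (i (cyc_succ ?m u)))"
    by (rule sum_path_sum_diag[OF w])
  also have "\<dots> = of_real ((1 / sqrt (real n)) ^ ?m * (\<Sum>i\<in>multi_indices ?m n.
        (\<Prod>u\<in>{1..?m}. x (link_value LX ?m (word_exp w) i u) \<omega>) *
        (\<Prod>u\<in>{1..?m}. y (link_value LY ?m (word_exp w) i u) \<omega>)))"
    unfolding E_def link_value_def
    by (simp add: prod.distrib sum_distrib_left prod_dividef power_divide)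
  finally show ?thesis unfolding M_def[symmetric] by (simp add: word_moment_def mult_ac)
qed

section \<open>Fluctuations and expectation of the normalized traces\<close>

abbreviation generated_field where
  "generated_field P x \<equiv> vimage_algebra (space P) (\<lambda>\<omega> \<alpha>. x \<alpha> \<omega>) (Pi\<^sub>M UNIV (\<lambda>_. borel))"

text \<open>The fields generated by \<open>f\<close> and by \<open>g\<close> are contained in those
  generated by the two families, so independence passes on to \<open>f\<close> and
  \<open>g\<close>.\<close>

lemma independent_collections_expectation:
  assumes P: "prob_space P" and ind: "independent_collections P x y"
    and mx: "\<And>\<alpha>. x \<alpha> \<in> borel_measurable P" and my: "\<And>\<beta>. y \<beta> \<in> borel_measurable P"
    and f: "f \<in> borel_measurable (generated_field P x)"
    and g: "g \<in> borel_measurable (generated_field P y)"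
    and int: "integrable P f" "integrable P (g :: _ \<Rightarrow> real)"
  shows "integrable P (\<lambda>\<omega>. f \<omega> * g \<omega>)" "(\<integral>\<omega>. f \<omega> * g \<omega> \<partial>P) = (\<integral>\<omega>. f \<omega> \<partial>P) * (\<integral>\<omega>. g \<omega> \<partial>P)"
proof -
  interpret prob_space P by (rule P)
  have sub: "sigma_sets (space P) {h -` A \<inter> space P |A. A \<in> sets borel} \<subseteq> sets V"
    if h: "h \<in> borel_measurable V" and V: "space V = space P" for h :: "'a \<Rightarrow> real" and V
    using measurable_sets[OF h] V by (intro sets.sigma_sets_subset[of _ V, unfolded V]) auto
  have "indep_set (sets (generated_field P x)) (sets (generated_field P y))" using ind by (simp add: independent_collections_def)
  then have "indep_set (sigma_sets (space P) {f -` A \<inter> space P |A. A \<in> sets borel})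
      (sigma_sets (space P) {g -` A \<inter> space P |A. A \<in> sets borel})"
    unfolding indep_set_def
    by (rule indep_sets_mono_sets) (use sub[OF f] sub[OF g] in \<open>auto split: bool.split\<close>)
  then have "indep_var borel f borel g"
    using int by (simp add: indep_var_eq borel_measurable_integrable)
  then show "integrable P (\<lambda>\<omega>. f \<omega> * g \<omega>)" "(\<integral>\<omega>. f \<omega> * g \<omega> \<partial>P) = (\<integral>\<omega>. f \<omega> \<partial>P) * (\<integral>\<omega>. g \<omega> \<partial>P)"
    using indep_var_integrable[of f g] indep_var_lebesgue_integral[of f g] int by auto
qed

lemma measurable_coordinate:
  "x \<alpha> \<in> borel_measurable (generated_field P x)"
proof -
  have "(\<lambda>\<omega> \<alpha>. x \<alpha> \<omega>) \<in> measurable (generated_field P x) (Pi\<^sub>M UNIV (\<lambda>_. borel))"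
    by (rule measurable_vimage_algebra1) (auto simp: space_PiM)
  from measurable_compose[OF this measurable_component_singleton[of \<alpha>]] show ?thesis by simp
qed

lemma measurable_cyc_prod:
  "cyc_prod x L m \<epsilon> i \<in> borel_measurable (generated_field P x)"
  unfolding cyc_prod_def by (intro borel_measurable_prod measurable_coordinate)

lemma sum_power_configs:
  fixes a :: "(nat \<Rightarrow> nat) \<Rightarrow> real"
  shows "(\<Sum>i\<in>multi_indices m n. a i) ^ r = (\<Sum>F\<in>configs r m n. \<Prod>l<r. a (F l))"
proof -
  have "(\<Prod>l<r. \<Sum>i\<in>multi_indices m n. a i) = (\<Sum>F\<in>configs r m n. \<Prod>l<r. a (F l))"
    unfolding configs_def by (rule prod_sum_PiE) (auto intro: finite_PiE)
  then show ?thesis by simp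
qed

text \<open>The factor \<open>c\<close> is either the other family itself or its mean; in both cases only the links of the
  centred family matter.\<close>

lemma moment_of_centred_sum:
  fixes L :: "nat \<Rightarrow> nat \<Rightarrow> 'i" and c :: "(nat \<Rightarrow> nat) \<Rightarrow> 'w \<Rightarrow> real"
  assumes S: "(\<Sum>F\<in>configs r m n. \<bar>centred_moment P x L r m \<epsilon> F\<bar>) \<le> C * real n ^ e"
    and D: "\<And>F. \<bar>\<integral>\<omega>. (\<Prod>l<r. c (F l) \<omega>) \<partial>P\<bar> \<le> D"
    and prod: "\<And>F. integrable P (\<lambda>\<omega>. (\<Prod>l<r. cyc_prod x L m \<epsilon> (F l) \<omega> - cyc_mean P x L m \<epsilon> (F l)) * (\<Prod>l<r. c (F l) \<omega>))"
      "\<And>F. (\<integral>\<omega>. (\<Prod>l<r. cyc_prod x L m \<epsilon> (F l) \<omega> - cyc_mean P x L m \<epsilon> (F l)) * (\<Prod>l<r. c (F l) \<omega>) \<partial>P) =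
        centred_moment P x L r m \<epsilon> F * (\<integral>\<omega>. (\<Prod>l<r. c (F l) \<omega>) \<partial>P)"
  shows "integrable P (\<lambda>\<omega>. (\<Sum>i\<in>multi_indices m n. (cyc_prod x L m \<epsilon> i \<omega> - cyc_mean P x L m \<epsilon> i) * c i \<omega>) ^ r)"
    "(\<integral>\<omega>. (\<Sum>i\<in>multi_indices m n. (cyc_prod x L m \<epsilon> i \<omega> - cyc_mean P x L m \<epsilon> i) * c i \<omega>) ^ r \<partial>P) \<le> D * C * real n ^ e"
proof -
  let ?c = "\<lambda>F. (\<integral>\<omega>. (\<Prod>l<r. c (F l) \<omega>) \<partial>P)"
  let ?A = "\<lambda>\<omega>. (\<Sum>i\<in>multi_indices m n. (cyc_prod x L m \<epsilon> i \<omega> - cyc_mean P x L m \<epsilon> i) * c i \<omega>)"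
  have eq: "(?A \<omega>) ^ r =
     (\<Sum>F\<in>configs r m n. (\<Prod>l<r. cyc_prod x L m \<epsilon> (F l) \<omega> - cyc_mean P x L m \<epsilon> (F l)) * (\<Prod>l<r. c (F l) \<omega>))" for \<omega>
    unfolding sum_power_configs by (simp add: prod.distrib)
  show "integrable P (\<lambda>\<omega>. (?A \<omega>) ^ r)"
    unfolding eq by (intro Bochner_Integration.integrable_sum prod)
  have "(\<integral>\<omega>. (?A \<omega>) ^ r \<partial>P) =
      (\<Sum>F\<in>configs r m n. centred_moment P x L r m \<epsilon> F * (?c F))"
    unfolding eq by (subst Bochner_Integration.integral_sum) (simp_all add: prod)
  also have "\<dots> \<le> (\<Sum>F\<in>configs r m n. \<bar>centred_moment P x L r m \<epsilon> F\<bar> * D)"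
  proof (rule sum_mono)
    fix F
    have "centred_moment P x L r m \<epsilon> F * (?c F) \<le> \<bar>centred_moment P x L r m \<epsilon> F * (?c F)\<bar>"
      by (rule abs_ge_self)
    also have "\<dots> \<le> \<bar>centred_moment P x L r m \<epsilon> F\<bar> * D"
      unfolding abs_mult by (rule mult_left_mono[OF D]) simp
    finally show "centred_moment P x L r m \<epsilon> F * (?c F) \<le> \<bar>centred_moment P x L r m \<epsilon> F\<bar> * D" .
  qed
  also have "\<dots> = (\<Sum>F\<in>configs r m n. \<bar>centred_moment P x L r m \<epsilon> F\<bar>) * D" by (simp add: sum_distrib_right)
  also have "\<dots> \<le> C * real n ^ e * D"
    \<comment> \<open>The bound on an absolute value, taken at any configuration, shows that
      \<open>D\<close> is non-negative.\<close>
    using D[of undefined] by (intro mult_right_mono[OF S]) linarith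
  finally show "(\<integral>\<omega>. (?A \<omega>) ^ r \<partial>P) \<le> D * C * real n ^ e"
    by (simp add: mult_ac)
qed

lemma power_add_le:
  fixes a b :: real
  assumes "even r"
  shows "(a + b) ^ r \<le> 2 ^ r * (a ^ r + b ^ r)"
proof -
  have "(a + b) ^ r = \<bar>a + b\<bar> ^ r" using assms by (simp add: power_even_abs)
  also have "\<dots> \<le> (2 * max \<bar>a\<bar> \<bar>b\<bar>) ^ r" by (rule power_mono) auto
  also have "\<dots> = 2 ^ r * (max \<bar>a\<bar> \<bar>b\<bar>) ^ r" by (simp add: power_mult_distrib)
  also have "(max \<bar>a\<bar> \<bar>b\<bar>) ^ r \<le> \<bar>a\<bar> ^ r + \<bar>b\<bar> ^ r" by (auto simp: max_def)
  finally show ?thesis using assms by (simp add: power_even_abs)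
qed

text \<open>For independent families this is the expectation of \<open>word_moment\<close>, since
  each mean of a product is a product of means.\<close>

definition mean_word_moment where
  "mean_word_moment P LX LY x y w n = (1 / real n) * (1 / sqrt (real n)) ^ length w *
     (\<Sum>i\<in>multi_indices (length w) n.
        cyc_mean P x LX (length w) (word_exp w) i * cyc_mean P y LY (length w) (word_exp w) i)"

abbreviation fluctuation where
  "fluctuation P LX LY x y w n \<omega> \<equiv> word_moment LX LY x y w n \<omega> - mean_word_moment P LX LY x y w n"

lemma word_moment_cyc_prod:
  "word_moment LX LY x y w n \<omega> = (1 / real n) * (1 / sqrt (real n)) ^ length w *
     (\<Sum>i\<in>multi_indices (length w) n.
        cyc_prod x LX (length w) (word_exp w) i \<omega> * cyc_prod y LY (length w) (word_exp w) i \<omega>)"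
  by (simp add: word_moment_def cyc_prod_def)

text \<open>Centring one family at a time turns the other one into a bounded factor, so links never
  have to be counted jointly. The scaling \<open>g\<close> is left open in order to serve both the
  variance and the twelfth moment.\<close>

lemma word_moment_fluctuation:
  fixes P :: "'w measure"
  assumes P: "prob_space P" and ind: "independent_collections P x y"
    and regx: "regular_family P x" and regy: "regular_family P y"
    and KX: "link_bounded LX KX" and KY: "link_bounded LY KY"
    and r: "r = 2 \<or> factorizing P x \<and> factorizing P y" "even r" and w: "w \<noteq> []"
    and g: "\<And>n. n \<ge> 1 \<Longrightarrow> ((1 / real n) * (1 / sqrt (real n)) ^ length w) ^ r *
      real n ^ ((3 * (r * length w) + 5 * r) div 6) = g n"
  shows "\<exists>C. \<forall>n\<ge>1.
     integrable P (\<lambda>\<omega>. fluctuation P LX LY x y w n \<omega> ^ r) \<and>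
     (\<integral>\<omega>. fluctuation P LX LY x y w n \<omega> ^ r \<partial>P)
       \<le> C * g n"
proof -
  interpret prob_space P by (rule P)
  define m where "m = length w"
  define \<epsilon> where "\<epsilon> = word_exp w"
  define e where "e = (3 * (r * m) + 5 * r) div 6"
  define X where "X = cyc_prod x LX m \<epsilon>"
  define Y where "Y = cyc_prod y LY m \<epsilon>"
  define cX where "cX = cyc_mean P x LX m \<epsilon>"
  define cY where "cY = cyc_mean P y LY m \<epsilon>"
  define I where "I n = multi_indices m n" for n :: nat
  \<comment> \<open>\<open>A\<close> centres \<open>x\<close> against the random \<open>y\<close>,
    and \<open>B\<close> centres \<open>y\<close> against the mean of \<open>x\<close>; their sum is
    the centred trace up to normalization.\<close>
  define A where "A n \<omega> = (\<Sum>i\<in>I n. (X i \<omega> - cX i) * Y i \<omega>)" for n \<omega>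
  define B where "B n \<omega> = (\<Sum>i\<in>I n. (Y i \<omega> - cY i) * cX i)" for n \<omega>
  have m: "m \<ge> 1" using w by (simp add: m_def Suc_le_eq)
  have mx: "x \<alpha> \<in> borel_measurable P" "y \<beta> \<in> borel_measurable P" for \<alpha> \<beta>
    using regx regy by (simp_all add: regular_family_def)
  have "\<exists>C. \<forall>n\<ge>1. (\<Sum>F\<in>configs r m n. \<bar>centred_moment P x LX r m \<epsilon> F\<bar>) \<le> C * real n ^ e"
    unfolding e_def by (rule sum_centred_moment[OF regx KX m]) (use r in blast)
  then obtain C1 where C1: "\<And>n. n \<ge> 1 \<Longrightarrow> (\<Sum>F\<in>configs r m n. \<bar>centred_moment P x LX r m \<epsilon> F\<bar>) \<le> C1 * real n ^ e"
    by blast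
  have "\<exists>C. \<forall>n\<ge>1. (\<Sum>F\<in>configs r m n. \<bar>centred_moment P y LY r m \<epsilon> F\<bar>) \<le> C * real n ^ e"
    unfolding e_def by (rule sum_centred_moment[OF regy KY m]) (use r in blast)
  then obtain C2 where C2: "\<And>n. n \<ge> 1 \<Longrightarrow> (\<Sum>F\<in>configs r m n. \<bar>centred_moment P y LY r m \<epsilon> F\<bar>) \<le> C2 * real n ^ e"
    by blast
  obtain D1 where D1: "\<And>S L \<epsilon> F. S \<subseteq> {..<r} \<Longrightarrow> \<bar>label_moment P y (cyc_label L m \<epsilon> F) (S \<times> {1..m})\<bar> \<le> D1"
    by (rule centred_moment_bounded[OF regy, of r m]) blast
  \<comment> \<open>The case of one cycle bounds the means of \<open>x\<close>.\<close>
  obtain D2 where D2: "\<And>S L \<epsilon> F. S \<subseteq> {..<1::nat} \<Longrightarrow> \<bar>cycles_moment P x L m \<epsilon> F S\<bar> \<le> D2"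
    by (rule centred_moment_bounded[OF regx, of 1 m]) blast
  have cX_le: "\<bar>cX i\<bar> \<le> D2" for i
  proof -
    have "cX i = label_moment P x (cyc_label LX m \<epsilon> (\<lambda>_. i)) ({0} \<times> {1..m})"
      unfolding cX_def using cyc_mean_label_moment[of P x LX m \<epsilon> "\<lambda>_. i" 0] by simp
    then show ?thesis using D2[of "{0}"] by simp
  qed
  have mX: "(\<lambda>\<omega>. \<Prod>l<r. X (F l) \<omega> - cX (F l)) \<in> borel_measurable (generated_field P x)" for F
    unfolding X_def by (intro borel_measurable_prod borel_measurable_diff measurable_cyc_prod borel_measurable_const)
  have mY: "(\<lambda>\<omega>. \<Prod>l<r. Y (F l) \<omega>) \<in> borel_measurable (generated_field P y)" for F
    unfolding Y_def by (intro borel_measurable_prod measurable_cyc_prod)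
  have iX: "integrable P (\<lambda>\<omega>. \<Prod>l<r. X (F l) \<omega> - cX (F l))" for F
    unfolding X_def cX_def by (rule integrable_centred[OF regx])
  have iY: "integrable P (\<lambda>\<omega>. \<Prod>l<r. Y (F l) \<omega>)" for F
    unfolding Y_def by (rule integrable_prod_cyc[OF regy]) simp
  have iY': "integrable P (\<lambda>\<omega>. \<Prod>l<r. Y (F l) \<omega> - cY (F l))" for F
    unfolding Y_def cY_def by (rule integrable_centred[OF regy])
  have A: "integrable P (\<lambda>\<omega>. A n \<omega> ^ r)" "(\<integral>\<omega>. A n \<omega> ^ r \<partial>P) \<le> D1 * C1 * real n ^ e" if n: "n \<ge> 1" for n
  proof -
    note E = independent_collections_expectation[OF P ind mx mX mY iX iY]
    have D: "\<bar>\<integral>\<omega>. (\<Prod>l<r. Y (F l) \<omega>) \<partial>P\<bar> \<le> D1" for F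
      unfolding Y_def integral_prod_cyc_prod by (rule D1) simp
    have c: "centred_moment P x LX r m \<epsilon> F = (\<integral>\<omega>. (\<Prod>l<r. X (F l) \<omega> - cX (F l)) \<partial>P)" for F
      by (simp add: centred_moment_def X_def cX_def)
    note M = moment_of_centred_sum[where r = r and m = m and P = P and x = x and L = LX and \<epsilon> = \<epsilon> and C = C1 and e = e
          and c = Y and D = D1, OF C1[OF n] D,
        folded X_def cX_def, OF E(1), unfolded c, OF E(2)]
    show "integrable P (\<lambda>\<omega>. A n \<omega> ^ r)" "(\<integral>\<omega>. A n \<omega> ^ r \<partial>P) \<le> D1 * C1 * real n ^ e"
      unfolding A_def I_def
      by (rule M)+
  qed
  have B: "integrable P (\<lambda>\<omega>. B n \<omega> ^ r)" "(\<integral>\<omega>. B n \<omega> ^ r \<partial>P) \<le> D2 ^ r * C2 * real n ^ e" if n: "n \<ge> 1" for n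
  proof -
    have D: "\<bar>\<integral>\<omega>. (\<Prod>l<r. cX (F l)) \<partial>P\<bar> \<le> D2 ^ r" for F :: config
    proof -
      have "\<bar>\<Prod>l<r. cX (F l)\<bar> \<le> (\<Prod>l<r. D2)" unfolding abs_prod by (rule prod_mono) (simp add: cX_le)
      then show ?thesis by (simp add: prob_space)
    qed
    have c: "centred_moment P y LY r m \<epsilon> F = (\<integral>\<omega>. (\<Prod>l<r. Y (F l) \<omega> - cY (F l)) \<partial>P)" for F
      by (simp add: centred_moment_def Y_def cY_def)
    have p: "integrable P (\<lambda>\<omega>. (\<Prod>l<r. Y (F l) \<omega> - cY (F l)) * (\<Prod>l<r. cX (F l)))"
      "(\<integral>\<omega>. (\<Prod>l<r. Y (F l) \<omega> - cY (F l)) * (\<Prod>l<r. cX (F l)) \<partial>P) =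
        (\<integral>\<omega>. (\<Prod>l<r. Y (F l) \<omega> - cY (F l)) \<partial>P) * (\<integral>\<omega>. (\<Prod>l<r. cX (F l)) \<partial>P)" for F
      using iY'[of F] by (simp_all add: prob_space)
    note M = moment_of_centred_sum[where r = r and m = m and P = P and x = y and L = LY and \<epsilon> = \<epsilon> and C = C2 and e = e
          and c = "\<lambda>i _. cX i" and D = "D2 ^ r", OF C2[OF n] D,
        folded Y_def cY_def, OF p(1), unfolded c, OF p(2)]
    show "integrable P (\<lambda>\<omega>. B n \<omega> ^ r)" "(\<integral>\<omega>. B n \<omega> ^ r \<partial>P) \<le> D2 ^ r * C2 * real n ^ e"
      unfolding B_def I_def
      by (rule M)+
  qed
  define C where "C = 2 ^ r * (D1 * C1 + D2 ^ r * C2)"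
  have "integrable P (\<lambda>\<omega>. fluctuation P LX LY x y w n \<omega> ^ r) \<and>
     (\<integral>\<omega>. fluctuation P LX LY x y w n \<omega> ^ r \<partial>P)
       \<le> C * g n" if n: "n \<ge> 1" for n
  proof -
    define \<kappa> where "\<kappa> = (1 / real n) * (1 / sqrt (real n)) ^ m"
    have eq: "word_moment LX LY x y w n \<omega> - mean_word_moment P LX LY x y w n = \<kappa> * (A n \<omega> + B n \<omega>)" for \<omega>
    proof -
      have "(\<Sum>i\<in>I n. X i \<omega> * Y i \<omega>) - (\<Sum>i\<in>I n. cX i * cY i) = A n \<omega> + B n \<omega>"
        unfolding A_def B_def sum.distrib[symmetric] sum_subtractf[symmetric]
        by (rule sum.cong) (simp_all add: algebra_simps)
      then show ?thesis
        unfolding word_moment_cyc_prod mean_word_moment_def m_def[symmetric] \<epsilon>_def[symmetric]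
          X_def[symmetric] Y_def[symmetric] cX_def[symmetric] cY_def[symmetric] I_def[symmetric] \<kappa>_def
        by (simp only: right_diff_distrib[symmetric])
    qed
    have le: "fluctuation P LX LY x y w n \<omega> ^ r
        \<le> \<kappa> ^ r * (2 ^ r * (A n \<omega> ^ r + B n \<omega> ^ r))" for \<omega>
      unfolding eq power_mult_distrib
      using power_add_le[OF r(2)] r(2) by (intro mult_left_mono) (auto simp: zero_le_even_power)
    have bi: "integrable P (\<lambda>\<omega>. \<kappa> ^ r * (2 ^ r * (A n \<omega> ^ r + B n \<omega> ^ r)))"
      using A(1)[OF n] B(1)[OF n] by simp
    have meas: "word_moment LX LY x y w n \<in> borel_measurable P"
      unfolding word_moment_def using mx by (intro borel_measurable_times borel_measurable_const borel_measurable_sum borel_measurable_prod) auto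
    have ii: "integrable P (\<lambda>\<omega>. fluctuation P LX LY x y w n \<omega> ^ r)"
    proof (rule Bochner_Integration.integrable_bound[OF bi])
      show "(\<lambda>\<omega>. fluctuation P LX LY x y w n \<omega> ^ r) \<in> borel_measurable P"
        using meas by measurable
      show "AE \<omega> in P. norm (fluctuation P LX LY x y w n \<omega> ^ r)
          \<le> norm (\<kappa> ^ r * (2 ^ r * (A n \<omega> ^ r + B n \<omega> ^ r)))"
      proof (rule AE_I2)
        fix \<omega>
        show "norm (fluctuation P LX LY x y w n \<omega> ^ r)
          \<le> norm (\<kappa> ^ r * (2 ^ r * (A n \<omega> ^ r + B n \<omega> ^ r)))"
          using le[of \<omega>] zero_le_even_power[OF r(2), of "word_moment LX LY x y w n \<omega> - mean_word_moment P LX LY x y w n"]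
          by (simp only: real_norm_def)
      qed
    qed
    have "(\<integral>\<omega>. fluctuation P LX LY x y w n \<omega> ^ r \<partial>P)
        \<le> (\<integral>\<omega>. \<kappa> ^ r * (2 ^ r * (A n \<omega> ^ r + B n \<omega> ^ r)) \<partial>P)"
      by (rule integral_mono[OF ii bi le])
    also have "\<dots> = \<kappa> ^ r * (2 ^ r * ((\<integral>\<omega>. A n \<omega> ^ r \<partial>P) + (\<integral>\<omega>. B n \<omega> ^ r \<partial>P)))"
      using A(1)[OF n] B(1)[OF n] by simp
    also have "\<dots> \<le> \<kappa> ^ r * (2 ^ r * (D1 * C1 * real n ^ e + D2 ^ r * C2 * real n ^ e))"
      using A(2)[OF n] B(2)[OF n] r(2) by (intro mult_left_mono add_mono) (auto simp: zero_le_even_power)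
    also have "\<dots> = C * (\<kappa> ^ r * real n ^ e)" by (simp add: C_def algebra_simps)
    also have "\<kappa> ^ r * real n ^ e = g n" unfolding \<kappa>_def m_def e_def by (rule g[OF n])
    finally show ?thesis using ii by blast
  qed
  then show ?thesis by blast
qed

section \<open>The limit of the expected moments\<close>

definition paired :: "'t link \<Rightarrow> nat \<Rightarrow> exponents \<Rightarrow> (nat \<Rightarrow> nat) \<Rightarrow> bool" where
  "paired L m \<epsilon> i \<longleftrightarrow> induced_partition L m \<epsilon> i \<in> pair_partitions m"

lemma induced_partition_eq:
  "induced_partition L m \<epsilon> i = (\<lambda>u. {v\<in>{1..m}. link_value L m \<epsilon> i v = link_value L m \<epsilon> i u}) ` {1..m}"
  unfolding induced_partition_def quotient_def UNION_singleton_eq_range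
  by (intro image_cong refl) auto

lemma paired_iff:
  "paired L m \<epsilon> i \<longleftrightarrow> (\<forall>u\<in>{1..m}. card {v\<in>{1..m}. link_value L m \<epsilon> i v = link_value L m \<epsilon> i u} = 2)"
proof -
  have "partition_on {1..m} (induced_partition L m \<epsilon> i)"
    unfolding induced_partition_def
    by (rule partition_on_quotient) (auto intro!: equivI refl_onI symI transI)
  then show ?thesis unfolding paired_def pair_partitions_def by (simp add: induced_partition_eq)
qed

lemma block_single_cycle:
  "block L 1 m \<epsilon> (\<lambda>_. i) (0, u) = Pair 0 ` {v\<in>{1..m}. link_value L m \<epsilon> i v = link_value L m \<epsilon> i u}"
  by (auto simp: block_def cyc_label_def)

text \<open>A single multi-index is treated as a configuration with one cycle, so that the estimates
  for configurations apply with \<open>r = 1\<close>.\<close>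

lemma paired_iff_block:
  "paired L m \<epsilon> i \<longleftrightarrow> (\<forall>p\<in>{..<1} \<times> {1..m}. card (block L 1 m \<epsilon> (\<lambda>_. i) p) = 2)"
proof -
  have "card (block L 1 m \<epsilon> (\<lambda>_. i) (0, u)) = card {v\<in>{1..m}. link_value L m \<epsilon> i v = link_value L m \<epsilon> i u}" for u
    unfolding block_single_cycle by (rule card_image) (simp add: inj_on_def)
  then show ?thesis unfolding paired_iff by auto
qed

lemma cyc_mean_paired:
  assumes reg: "regular_family P x" and p: "paired L m \<epsilon> i"
  shows "cyc_mean P x L m \<epsilon> i = 1"
proof -
  have "label_moment P x (cyc_label L m \<epsilon> (\<lambda>_. i)) ({..<1} \<times> {1..m}) = 1"
    by (rule label_moment_pairs[OF reg]) (use p in \<open>auto simp: paired_iff_block block_def\<close>)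
  moreover have "{..<1::nat} = {0}" by auto
  ultimately show ?thesis using cyc_mean_label_moment[of P x L m \<epsilon> "\<lambda>_. i" 0] by simp
qed

text \<open>Either an isolated label annihilates the mean, or some block has size at least three,
  and then the labels would be few.\<close>

lemma cyc_mean_not_paired:
  assumes reg: "regular_family P x" and p: "\<not> paired L m \<epsilon> i"
    and many: "\<not> card (labels L 1 m \<epsilon> (\<lambda>_. i)) \<le> (m - 1) div 2"
  shows "cyc_mean P x L m \<epsilon> i = 0"
proof (cases "no_single L 1 m \<epsilon> (\<lambda>_. i)")
  case True
  obtain p where "p \<in> {..<1} \<times> {1..m}" "card (block L 1 m \<epsilon> (\<lambda>_. i) p) \<noteq> 2"
    using p unfolding paired_iff_block by blast
  from few_labels_of_big_block[OF True this] many show ?thesis by simp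
next
  case False
  then obtain l u where "l < 1" "u \<in> {1..m}" "block L 1 m \<epsilon> (\<lambda>_. i) (l, u) = {(l, u)}"
    by (rule no_singleE)
  then have "label_moment P x (cyc_label L m \<epsilon> (\<lambda>_. i)) ({l} \<times> {1..m}) = 0"
    by (intro label_moment_single[OF reg, of _ 1]) auto
  then show ?thesis using cyc_mean_label_moment[of P x L m \<epsilon> "\<lambda>_. i" l] by simp
qed

lemma cyc_mean_bounded:
  assumes reg: "regular_family P x"
  obtains D where "D \<ge> 1" "\<And>L \<epsilon> i. \<bar>cyc_mean P x L m \<epsilon> i\<bar> \<le> D"
proof -
  obtain D where D: "D \<ge> 1" "\<And>f T. finite T \<Longrightarrow> card T \<le> m \<Longrightarrow> moment_bounded P x f T D"
    by (rule regular_family_bound[OF reg, of m]) (rule that)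
  have "\<bar>cyc_mean P x L m \<epsilon> i\<bar> \<le> D" for L \<epsilon> i
    using D(2)[of "{0} \<times> {1..m}" "cyc_label L m \<epsilon> (\<lambda>_. i)"] cyc_mean_label_moment[of P x L m \<epsilon> "\<lambda>_. i" 0]
    by simp
  then show ?thesis using that D(1) by blast
qed

lemma card_few_labels_single:
  assumes K: "link_bounded L K" and m: "m \<ge> 1"
  shows "\<exists>C. \<forall>n\<ge>1. card {i \<in> multi_indices m n. card (labels L 1 m \<epsilon> (\<lambda>_. i)) \<le> (m - 1) div 2}
     \<le> C * n ^ ((m - 1) div 2 + 1)"
proof -
  define B where "B = (m - 1) div 2"
  let ?I = "\<lambda>n. {i \<in> multi_indices m n. card (labels L 1 m \<epsilon> (\<lambda>_. i)) \<le> B}"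
  have "card (?I n)
     \<le> 2 ^ (1 * m) * (1 * m * K) ^ (1 * m - (B + 1)) * n ^ (B + 1)" if n: "n \<ge> 1" for n
  proof -
    \<comment> \<open>Configurations are extensional in the cycle index, hence the restriction to
      index 0; the labels do not notice it.\<close>
    have lab: "labels L 1 m \<epsilon> (restrict (\<lambda>_. i) {..<1}) = labels L 1 m \<epsilon> (\<lambda>_. i)" for i
      unfolding labels_def by (intro image_cong refl) (auto simp: cyc_label_def)
    have "card (?I n)
      \<le> card {F \<in> configs 1 m n. card (labels L 1 m \<epsilon> F) \<le> B}"
    proof (rule card_inj_on_le[where f = "\<lambda>i. restrict (\<lambda>_. i) {..<1::nat}"])
      show "inj_on (\<lambda>i. restrict (\<lambda>_. i) {..<1::nat}) (?I n)"
      proof (rule inj_onI)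
        fix i j :: "nat \<Rightarrow> nat" assume "restrict (\<lambda>_. i) {..<1::nat} = restrict (\<lambda>_. j) {..<1::nat}"
        from fun_cong[OF this, of 0] show "i = j" by simp
      qed
      show "(\<lambda>i. restrict (\<lambda>_. i) {..<1::nat}) ` (?I n)
          \<subseteq> {F \<in> configs 1 m n. card (labels L 1 m \<epsilon> F) \<le> B}"
      proof (intro image_subsetI CollectI conjI)
        fix i assume i: "i \<in> (?I n)"
        then show "restrict (\<lambda>_. i) {..<1} \<in> configs 1 m n" unfolding configs_def by simp
        show "card (labels L 1 m \<epsilon> (restrict (\<lambda>_. i) {..<1})) \<le> B" unfolding lab using i by simp
      qed
    qed (simp add: finite_configs)
    also have "\<dots> \<le> 2 ^ (1 * m) * (1 * m * K) ^ (1 * m - (B + 1)) * n ^ (B + 1)"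
      by (rule card_configs_few_labels[OF K m n])
    finally show ?thesis .
  qed
  then show ?thesis unfolding B_def[symmetric] by blast
qed

text \<open>As a power of \<open>sqrt n\<close>, the left side has the exponent
  \<open>2 * e - m - 2\<close>, which is at most -1.\<close>

lemma scaling_le:
  assumes n: "n \<ge> 1" and e: "2 * e \<le> m + 1"
  shows "(1 / real n) * (1 / sqrt (real n)) ^ m * real n ^ e \<le> 1 / sqrt (real n)"
proof -
  define s where "s = sqrt (real n)"
  have s: "s \<ge> 1" "real n = s ^ 2" using n by (simp_all add: s_def)
  have "s ^ (2 * e + 1) \<le> s ^ (m + 2)" using s(1) e by (intro power_increasing) auto
  then have "s ^ (2 * e) * s \<le> s ^ 2 * s ^ m" by (simp add: power_add power2_eq_square mult_ac)
  then have "s ^ (2 * e) / (s ^ 2 * s ^ m) \<le> 1 / s" using s(1) by (simp add: field_simps)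
  then show ?thesis unfolding s_def[symmetric] s(2) using s(1) by (simp add: power_mult[symmetric] power_divide)
qed

lemma pair_partitions_odd:
  assumes "odd m"
  shows "pair_partitions m = {}"
proof (rule equals0I)
  fix \<pi> assume "\<pi> \<in> pair_partitions m"
  then have p: "partition_on {1..m} \<pi>" "\<And>B. B \<in> \<pi> \<Longrightarrow> card B = 2" by (auto simp: pair_partitions_def)
  have "card (\<Union>\<pi>) = sum card \<pi>"
    by (rule card_Union_disjoint)
      (use p in \<open>auto simp: partition_on_def disjoint_def pairwise_def disjnt_def intro: card_ge_0_finite\<close>)
  then have "m = 2 * card \<pi>" using p by (simp add: partition_on_def)
  then show False using assms by simp
qed

text \<open>The multi-indices paired for both links are sorted by the two induced pairings.
  Compatibility removes the off-diagonal terms, and joint circularity evaluates the diagonal ones.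
  In odd length there are no pairings, and both sides are 0.\<close>

lemma paired_count_tendsto:
  assumes comp: "compatible LX LY" and jc: "jointly_circular LX LY" and w: "w \<noteq> []"
  shows "(\<lambda>n. (1 / real n) * (1 / sqrt (real n)) ^ length w * real (card {i \<in> multi_indices (length w) n.
      paired LX (length w) (word_exp w) i \<and> paired LY (length w) (word_exp w) i}))
     \<longlonglongrightarrow> real (stack_count (rev w) [])"
proof (cases "odd (length w)")
  case True
  have "real (stack_count (rev w) []) = 0"
    unfolding sum_nc_pair_partitions[OF refl, symmetric]
    by (simp add: nc_pair_partitions_def pair_partitions_odd[OF True])
  then show ?thesis by (simp add: paired_def pair_partitions_odd[OF True])
next
  case False
  then obtain k where k: "length w = 2 * k" by blast
  then have k1: "k \<ge> 1" using w by (cases k) auto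
  define \<epsilon> where "\<epsilon> = word_exp w"
  define PP where "PP = pair_partitions (2 * k)"
  define c where "c n \<pi> \<pi>' = card (partition_class LX k \<epsilon> n \<pi> \<inter> partition_class LY k \<epsilon> n \<pi>')" for n \<pi> \<pi>'
  define l where "l \<pi> = (if \<pi> \<in> nc_pair_partitions (2*k)
             then \<Prod>B\<in>\<pi>. 1 - (if \<epsilon> (Min B) = \<epsilon> (Max B) then 1 else 0)
             else (0::real))" for \<pi>
  have fin: "finite PP" unfolding PP_def by (rule finite_pair_partitions)
  have finc: "finite (partition_class L k \<epsilon> n \<pi>)" for L :: "nat \<Rightarrow> nat \<Rightarrow> 'z" and n \<pi>
    unfolding partition_class_def by (rule finite_subset[of _ "multi_indices (2 * k) n"]) (auto intro: finite_PiE)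
  have card: "card {i \<in> multi_indices (2 * k) n. paired LX (2*k) \<epsilon> i \<and> paired LY (2*k) \<epsilon> i} = (\<Sum>q\<in>PP \<times> PP. c n (fst q) (snd q))" for n
  proof -
    have "{i \<in> multi_indices (2 * k) n. paired LX (2*k) \<epsilon> i \<and> paired LY (2*k) \<epsilon> i} =
        (\<Union>q\<in>PP \<times> PP. partition_class LX k \<epsilon> n (fst q) \<inter> partition_class LY k \<epsilon> n (snd q))"
      by (auto simp: paired_def PP_def partition_class_def)
    also have "card \<dots> = (\<Sum>q\<in>PP \<times> PP. c n (fst q) (snd q))"
      unfolding c_def
      by (rule card_UN_disjoint) (use fin finc in \<open>auto simp: partition_class_def\<close>)
    finally show ?thesis .
  qed
  have lim: "(\<lambda>n. real (c n (fst q) (snd q)) / real n ^ (1 + k)) \<longlonglongrightarrow> (if fst q = snd q then l (fst q) else 0)"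
    if q: "q \<in> PP \<times> PP" for q
  proof (cases "fst q = snd q")
    case True
    have "fst q \<in> pair_partitions (2 * k)" using q by (auto simp: PP_def)
    then have "(\<lambda>n. real (c n (fst q) (fst q)) / real n ^ (1 + k)) \<longlonglongrightarrow> l (fst q)"
      using jc k1 unfolding jointly_circular_def c_def l_def by blast
    then show ?thesis using True by simp
  next
    case ne: False
    have "fst q \<in> pair_partitions (2 * k)" "snd q \<in> pair_partitions (2 * k)" using q by (auto simp: PP_def)
    then have "(\<lambda>n. real (c n (fst q) (snd q)) / real n ^ (1 + k)) \<longlonglongrightarrow> 0"
      using comp k1 ne unfolding compatible_def c_def by blast
    then show ?thesis using ne by simp
  qed
  have "(\<lambda>n. \<Sum>q\<in>PP \<times> PP. real (c n (fst q) (snd q)) / real n ^ (1 + k)) \<longlonglongrightarrow>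
      (\<Sum>q\<in>PP \<times> PP. if fst q = snd q then l (fst q) else 0)"
    by (rule tendsto_sum) (rule lim)
  also have "(\<Sum>q\<in>PP \<times> PP. if fst q = snd q then l (fst q) else 0) = (\<Sum>\<pi>\<in>PP. \<Sum>\<pi>'\<in>PP. if \<pi> = \<pi>' then l \<pi> else 0)"
    by (simp add: sum.cartesian_product case_prod_unfold)
  also have "\<dots> = (\<Sum>\<pi>\<in>PP. l \<pi>)" using fin by (simp add: sum.delta)
  also have "\<dots> = (\<Sum>\<pi>\<in>nc_pair_partitions (2*k). \<Prod>B\<in>\<pi>. 1 - (if \<epsilon> (Min B) = \<epsilon> (Max B) then 1 else 0))"
  proof -
    have "(\<Sum>\<pi>\<in>PP. l \<pi>) = (\<Sum>\<pi>\<in>nc_pair_partitions (2*k). l \<pi>)"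
      by (rule sum.mono_neutral_right[OF fin]) (auto simp: PP_def nc_pair_partitions_def l_def)
    then show ?thesis by (simp add: l_def)
  qed
  also have "\<dots> = real (stack_count (rev w) [])"
    unfolding \<epsilon>_def word_exp_def by (rule sum_nc_pair_partitions[OF k])
  finally have main: "(\<lambda>n. \<Sum>q\<in>PP \<times> PP. real (c n (fst q) (snd q)) / real n ^ (1 + k)) \<longlonglongrightarrow> real (stack_count (rev w) [])" .
  have "(1 / real n) * (1 / sqrt (real n)) ^ (2 * k) * real (card {i \<in> multi_indices (2 * k) n. paired LX (2*k) \<epsilon> i \<and> paired LY (2*k) \<epsilon> i})
      = (\<Sum>q\<in>PP \<times> PP. real (c n (fst q) (snd q)) / real n ^ (1 + k))" for n
  proof -
    have "(1 / sqrt (real n)) ^ (2 * k) = 1 / real n ^ k"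
      by (simp add: power_mult power_divide)
    then show ?thesis unfolding card by (simp add: sum_divide_distrib)
  qed
  then show ?thesis using main unfolding k \<epsilon>_def by simp
qed

text \<open>The product of the two means is the indicator of being paired for both links, except
  where one link has few labels. There are at most O(n^((m+1)/2)) such multi-indices, and
  normalization turns this into O(1 / sqrt n).\<close>

lemma mean_word_moment_tendsto:
  assumes regx: "regular_family P x" and regy: "regular_family P y"
    and KX: "link_bounded LX KX" and KY: "link_bounded LY KY"
    and comp: "compatible LX LY" and jc: "jointly_circular LX LY" and w: "w \<noteq> []"
  shows "(\<lambda>n. mean_word_moment P LX LY x y w n) \<longlonglongrightarrow> real (stack_count (rev w) [])"
proof -
  define m where "m = length w"
  define \<epsilon> where "\<epsilon> = word_exp w"
  define I where "I n = multi_indices m n" for n :: nat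
  define \<kappa> where "\<kappa> n = (1 / real n) * (1 / sqrt (real n)) ^ m" for n :: nat
  define cX where "cX = cyc_mean P x LX m \<epsilon>"
  define cY where "cY = cyc_mean P y LY m \<epsilon>"
  define G where "G n = {i \<in> I n. paired LX m \<epsilon> i \<and> paired LY m \<epsilon> i}" for n
  define B where "B = (m - 1) div 2"
  define FX where "FX n = {i \<in> I n. card (labels LX 1 m \<epsilon> (\<lambda>_. i)) \<le> B}" for n
  define FY where "FY n = {i \<in> I n. card (labels LY 1 m \<epsilon> (\<lambda>_. i)) \<le> B}" for n
  have m: "m \<ge> 1" using w by (simp add: m_def Suc_le_eq)
  have finI: "finite (I n)" for n unfolding I_def by (intro finite_PiE) auto
  obtain D1 where D1: "D1 \<ge> 1" "\<And>L \<epsilon> i. \<bar>cyc_mean P x L m \<epsilon> i\<bar> \<le> D1" by (rule cyc_mean_bounded[OF regx]) (rule that)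
  obtain D2 where D2: "D2 \<ge> 1" "\<And>L \<epsilon> i. \<bar>cyc_mean P y L m \<epsilon> i\<bar> \<le> D2" by (rule cyc_mean_bounded[OF regy]) (rule that)
  have "\<exists>C. \<forall>n\<ge>1. card (FX n) \<le> C * n ^ (B + 1)" unfolding FX_def I_def B_def
    by (rule card_few_labels_single[OF KX m])
  then obtain C1 where C1: "\<And>n. n \<ge> 1 \<Longrightarrow> card (FX n) \<le> C1 * n ^ (B + 1)" by blast
  have "\<exists>C. \<forall>n\<ge>1. card (FY n) \<le> C * n ^ (B + 1)" unfolding FY_def I_def B_def
    by (rule card_few_labels_single[OF KY m])
  then obtain C2 where C2: "\<And>n. n \<ge> 1 \<Longrightarrow> card (FY n) \<le> C2 * n ^ (B + 1)" by blast
  define C where "C = real (C1 + C2) * (D1 * D2 + 1)"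
  have bound: "\<bar>mean_word_moment P LX LY x y w n - \<kappa> n * real (card (G n))\<bar> \<le> C * (1 / sqrt (real n))" if n: "n \<ge> 1" for n
  proof -
    have \<kappa>: "\<kappa> n \<ge> 0" by (simp add: \<kappa>_def)
    have "(\<Sum>i\<in>I n. cX i * cY i) - real (card (G n)) = (\<Sum>i\<in>I n. cX i * cY i - (if i \<in> G n then 1 else 0))"
      using finI by (simp add: sum_subtractf G_def sum.If_cases Int_def)
    also have "\<dots> = (\<Sum>i\<in>FX n \<union> FY n. cX i * cY i - (if i \<in> G n then 1 else 0))"
    proof (rule sum.mono_neutral_right[OF finI])
      show "FX n \<union> FY n \<subseteq> I n" by (auto simp: FX_def FY_def)
      show "\<forall>i\<in>I n - (FX n \<union> FY n). cX i * cY i - (if i \<in> G n then 1 else 0) = 0"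
      proof
        fix i assume i: "i \<in> I n - (FX n \<union> FY n)"
        then have nf: "\<not> card (labels LX 1 m \<epsilon> (\<lambda>_. i)) \<le> (m - 1) div 2" "\<not> card (labels LY 1 m \<epsilon> (\<lambda>_. i)) \<le> (m - 1) div 2"
          by (auto simp: FX_def FY_def B_def)
        consider "paired LX m \<epsilon> i" "paired LY m \<epsilon> i" | "\<not> paired LX m \<epsilon> i" | "\<not> paired LY m \<epsilon> i" by blast
        then show "cX i * cY i - (if i \<in> G n then 1 else 0) = 0"
        proof cases
          case 1
          then show ?thesis
            using i cyc_mean_paired[OF regx 1(1)] cyc_mean_paired[OF regy 1(2)] by (simp add: G_def cX_def cY_def)
        next
          case 2
          then show ?thesis using cyc_mean_not_paired[OF regx 2 nf(1)] by (simp add: G_def cX_def)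
        next
          case 3
          then show ?thesis using cyc_mean_not_paired[OF regy 3 nf(2)] by (simp add: G_def cY_def)
        qed
      qed
    qed
    finally have eq: "(\<Sum>i\<in>I n. cX i * cY i) - real (card (G n)) = (\<Sum>i\<in>FX n \<union> FY n. cX i * cY i - (if i \<in> G n then 1 else 0))" .
    have t: "\<bar>cX i * cY i - (if i \<in> G n then 1 else 0)\<bar> \<le> D1 * D2 + 1" for i
    proof -
      have "\<bar>cX i * cY i\<bar> \<le> D1 * D2"
        unfolding abs_mult cX_def cY_def using D1 D2 by (intro mult_mono) auto
      then show ?thesis by auto
    qed
    have "\<bar>(\<Sum>i\<in>I n. cX i * cY i) - real (card (G n))\<bar> \<le> real (card (FX n \<union> FY n)) * (D1 * D2 + 1)"
      unfolding eq by (rule order_trans[OF sum_abs sum_bounded_above]) (rule t)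
    also have "\<dots> \<le> real ((C1 + C2) * n ^ (B + 1)) * (D1 * D2 + 1)"
    proof (rule mult_right_mono)
      have "card (FX n \<union> FY n) \<le> (C1 + C2) * n ^ (B + 1)"
        using card_Un_le[of "FX n" "FY n"] C1[OF n] C2[OF n] by (simp add: algebra_simps)
      then show "real (card (FX n \<union> FY n)) \<le> real ((C1 + C2) * n ^ (B + 1))" by (rule of_nat_mono)
      have "0 \<le> D1 * D2" using D1(1) D2(1) by simp
      then show "0 \<le> D1 * D2 + 1" by simp
    qed
    also have "\<dots> = C * real n ^ (B + 1)" by (simp add: C_def mult_ac)
    finally have "\<kappa> n * \<bar>(\<Sum>i\<in>I n. cX i * cY i) - real (card (G n))\<bar> \<le> \<kappa> n * (C * real n ^ (B + 1))"
      using \<kappa> by (rule mult_left_mono)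
    also have "\<dots> = C * (\<kappa> n * real n ^ (B + 1))" by simp
    also have "\<dots> \<le> C * (1 / sqrt (real n))"
    proof (rule mult_left_mono)
      show "\<kappa> n * real n ^ (B + 1) \<le> 1 / sqrt (real n)"
        unfolding \<kappa>_def by (rule scaling_le[OF n]) (use m in \<open>simp add: B_def\<close>)
      show "0 \<le> C" using D1(1) D2(1) by (simp add: C_def)
    qed
    finally have "\<kappa> n * \<bar>(\<Sum>i\<in>I n. cX i * cY i) - real (card (G n))\<bar> \<le> C * (1 / sqrt (real n))" .
    moreover have "mean_word_moment P LX LY x y w n = \<kappa> n * (\<Sum>i\<in>I n. cX i * cY i)"
      by (simp add: mean_word_moment_def \<kappa>_def I_def cX_def cY_def m_def \<epsilon>_def)
    ultimately show ?thesis
      using \<kappa> by (simp add: right_diff_distrib[symmetric] abs_mult)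
  qed
  have "(\<lambda>n. C * (1 / sqrt (real n))) \<longlonglongrightarrow> 0" by real_asymp
  then have "(\<lambda>n. mean_word_moment P LX LY x y w n - \<kappa> n * real (card (G n))) \<longlonglongrightarrow> 0"
    by (rule Lim_null_comparison[rotated])
      (use bound in \<open>auto intro!: eventually_sequentiallyI[of 1]\<close>)
  moreover have "(\<lambda>n. \<kappa> n * real (card (G n))) \<longlonglongrightarrow> real (stack_count (rev w) [])"
    using paired_count_tendsto[OF comp jc w] by (simp add: \<kappa>_def G_def I_def m_def \<epsilon>_def)
  ultimately have "(\<lambda>n. (mean_word_moment P LX LY x y w n - \<kappa> n * real (card (G n))) + \<kappa> n * real (card (G n))) \<longlonglongrightarrow> 0 + real (stack_count (rev w) [])"
    by (rule tendsto_add)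
  then show ?thesis by simp
qed

section \<open>From words to polynomials, in probability and almost surely\<close>

instance star_exp :: countable
  by countable_datatype

text \<open>The empty word has normalized trace 1, whereas \<open>word_moment\<close> would give
  \<open>1 / n\<close>: an empty cycle has no starting vertex to sum over.\<close>

definition normalized_trace ::
    "'s link \<Rightarrow> 't link \<Rightarrow> ('s \<Rightarrow> 'w \<Rightarrow> real) \<Rightarrow> ('t \<Rightarrow> 'w \<Rightarrow> real) \<Rightarrow>
     star_exp list \<Rightarrow> nat \<Rightarrow> 'w \<Rightarrow> real" where
  "normalized_trace LX LY x y w n \<omega> = (if w = [] then 1 else word_moment LX LY x y w n \<omega>)"

lemma trace_nc_eval:
  assumes n: "n \<ge> 1"
  shows "1 / of_nat n * mat_trace (nc_eval (mat_prob n) Q (scaled_link_matrix LX LY x y n \<omega>)) =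
    (\<Sum>w\<in>Poly_Mapping.keys Q. Poly_Mapping.lookup Q w * of_real (normalized_trace LX LY x y w n \<omega>))"
proof -
  interpret star_prob_space "mat_prob n" by (rule star_prob_space_mat[OF n])
  let ?M = "scaled_link_matrix LX LY x y n \<omega>"
  have M: "?M \<in> carrier (mat_prob n)" using scaled_link_matrix_carrier by simp
  have "1 / of_nat n * mat_trace (nc_eval (mat_prob n) Q ?M) = state (mat_prob n) (nc_eval (mat_prob n) Q ?M)"
    by simp
  also have "\<dots> = (\<Sum>w\<in>Poly_Mapping.keys Q. Poly_Mapping.lookup Q w * state (mat_prob n) (nc_monom (mat_prob n) ?M w))"
    by (rule state_nc_eval[OF star_prob_space_mat[OF n] M])
  also have "\<dots> = (\<Sum>w\<in>Poly_Mapping.keys Q. Poly_Mapping.lookup Q w * of_real (normalized_trace LX LY x y w n \<omega>))"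
  proof (intro sum.cong refl)
    fix w
    have "state (mat_prob n) (nc_monom (mat_prob n) ?M w) = of_real (normalized_trace LX LY x y w n \<omega>)"
    proof (cases "w = []")
      case True
      then show ?thesis using state_one by (simp add: nc_monom_def normalized_trace_def)
    next
      case False
      then show ?thesis using trace_word[OF n False] by (simp add: normalized_trace_def del: mat_prob_simps)
    qed
    then show "Poly_Mapping.lookup Q w * state (mat_prob n) (nc_monom (mat_prob n) ?M w) =
        Poly_Mapping.lookup Q w * of_real (normalized_trace LX LY x y w n \<omega>)" by simp
  qed
  finally show ?thesis .
qed

lemma state_nc_eval_circular:
  assumes A: "star_prob_space A" and c: "circular A c"
  shows "c \<in> carrier A"
    and "state A (nc_eval A Q c) =
      (\<Sum>w\<in>Poly_Mapping.keys Q. Poly_Mapping.lookup Q w * of_real (real (stack_count (rev w) [])))"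
proof -
  interpret star_prob_space A by (rule A)
  show cin: "c \<in> carrier A"
    using c unfolding circular_def semicircular_def by (auto simp: smult_in)
  show "state A (nc_eval A Q c) =
      (\<Sum>w\<in>Poly_Mapping.keys Q. Poly_Mapping.lookup Q w * of_real (real (stack_count (rev w) [])))"
    unfolding state_nc_eval[OF A cin] state_nc_monom_circular[OF A c] by simp
qed

lemma scaling_2:
  assumes "n \<ge> 1"
  shows "((1 / real n) * (1 / sqrt (real n)) ^ m) ^ 2 * real n ^ ((3 * (2 * m) + 5 * 2) div 6) = 1 / real n"
proof -
  have e: "(3 * (2 * m) + 5 * 2) div 6 = m + 1" by simp
  have "((1 / sqrt (real n)) ^ m) ^ 2 = 1 / real n ^ m"
    by (simp add: power_mult[symmetric] mult.commute[of m] power_mult power_divide)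
  then have "((1 / real n) * (1 / sqrt (real n)) ^ m) ^ 2 = (1 / real n) ^ 2 * (1 / real n ^ m)"
    by (simp only: power_mult_distrib)
  then show ?thesis using assms unfolding e by (simp add: power2_eq_square)
qed

text \<open>The count contributes the exponent \<open>6 * m + 10\<close>, the normalization
  \<open>- (6 * m + 12)\<close>; as 60 is divisible by 6, nothing is lost by rounding.\<close>

lemma scaling_12:
  assumes "n \<ge> 1"
  shows "((1 / real n) * (1 / sqrt (real n)) ^ m) ^ 12 * real n ^ ((3 * (12 * m) + 5 * 12) div 6) = 1 / real n ^ 2"
proof -
  have e: "(3 * (12 * m) + 5 * 12) div 6 = 6 * m + 10" by simp
  have "((1 / sqrt (real n)) ^ m) ^ 12 = ((1 / sqrt (real n)) ^ 2) ^ (6 * m)"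
    unfolding power_mult[symmetric] by (simp add: mult.commute)
  then have "((1 / sqrt (real n)) ^ m) ^ 12 = 1 / real n ^ (6 * m)"
    by (simp add: power_divide)
  then have "((1 / real n) * (1 / sqrt (real n)) ^ m) ^ 12 = (1 / real n) ^ 12 * (1 / real n ^ (6 * m))"
    by (simp only: power_mult_distrib)
  also have "(1 / real n) ^ 12 = 1 / real n ^ 10 * (1 / real n ^ 2)"
    by (simp add: power_divide flip: power_add)
  finally have eq: "((1 / real n) * (1 / sqrt (real n)) ^ m) ^ 12 = 1 / real n ^ 10 * (1 / real n ^ 2) * (1 / real n ^ (6 * m))" .
  have "1 / a * (1 / c) * (1 / b) * (b * a) = 1 / c" if "a \<noteq> 0" "b \<noteq> 0" for a b c :: real
    using that by simp
  from this[of "real n ^ 10" "real n ^ (6 * m)" "real n ^ 2"] show ?thesis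
    using assms unfolding e power_add eq by simp
qed

text \<open>Chebyshev's inequality: once the mean is within \<open>d / 2\<close> of the limit, a
  deviation by more than \<open>d\<close> forces a fluctuation of at least
  \<open>d / 2\<close>.\<close>

lemma normalized_trace_in_probability:
  assumes P: "prob_space P" and ind: "independent_collections P x y"
    and regx: "regular_family P x" and regy: "regular_family P y"
    and KX: "link_bounded LX KX" and KY: "link_bounded LY KY"
    and comp: "compatible LX LY" and jc: "jointly_circular LX LY" and d: "d > 0"
  shows "(\<lambda>n. measure P {\<omega> \<in> space P. \<bar>normalized_trace LX LY x y w n \<omega> - real (stack_count (rev w) [])\<bar> > d}) \<longlonglongrightarrow> 0"
proof (cases "w = []")
  case True
  then show ?thesis using d by (simp add: normalized_trace_def)
next
  case False
  interpret prob_space P by (rule P)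
  define \<mu> where "\<mu> n = mean_word_moment P LX LY x y w n" for n
  define s where "s = real (stack_count (rev w) [])"
  define T where "T n \<omega> = word_moment LX LY x y w n \<omega>" for n \<omega>
  have "\<exists>C. \<forall>n\<ge>1. integrable P (\<lambda>\<omega>. (T n \<omega> - \<mu> n) ^ 2) \<and>
     (\<integral>\<omega>. (T n \<omega> - \<mu> n) ^ 2 \<partial>P) \<le> C * (1 / real n)"
    unfolding T_def \<mu>_def
    by (rule word_moment_fluctuation[OF P ind regx regy KX KY _ _ False scaling_2]) simp_all
  then obtain C where C: "integrable P (\<lambda>\<omega>. (T n \<omega> - \<mu> n) ^ 2)"
    "(\<integral>\<omega>. (T n \<omega> - \<mu> n) ^ 2 \<partial>P) \<le> C * (1 / real n)" if "n \<ge> 1" for n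
    by blast
  have mu: "\<mu> \<longlonglongrightarrow> s" unfolding \<mu>_def s_def
    by (rule mean_word_moment_tendsto[OF regx regy KX KY comp jc False])
  have "\<forall>\<^sub>F n in sequentially. dist (\<mu> n) s < d / 2 \<and> 1 \<le> n"
    using tendstoD[OF mu, of "d / 2"] d by (intro eventually_conj eventually_ge_at_top) simp
  then have ev: "\<forall>\<^sub>F n in sequentially. measure P {\<omega> \<in> space P. \<bar>T n \<omega> - s\<bar> > d} \<le> (1 / (d / 2) ^ 2) * (C * (1 / real n))"
  proof (rule eventually_mono, elim conjE)
    fix n :: nat assume close: "dist (\<mu> n) s < d / 2" and n: "1 \<le> n"
    have sub: "{\<omega> \<in> space P. \<bar>T n \<omega> - s\<bar> > d} \<subseteq> {\<omega> \<in> space P. (T n \<omega> - \<mu> n) ^ 2 \<ge> (d / 2) ^ 2}"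
    proof (intro subsetI CollectI conjI; elim CollectE conjE)
      fix \<omega> assume "\<bar>T n \<omega> - s\<bar> > d"
      then have "\<bar>T n \<omega> - \<mu> n\<bar> \<ge> d / 2" using close unfolding dist_real_def by linarith
      then show "(d / 2) ^ 2 \<le> (T n \<omega> - \<mu> n) ^ 2"
        using d power_mono[of "d / 2" "\<bar>T n \<omega> - \<mu> n\<bar>" 2] by simp
    qed
    have meas: "(\<lambda>\<omega>. (T n \<omega> - \<mu> n) ^ 2) \<in> borel_measurable P" using C(1)[OF n] by simp
    have "measure P {\<omega> \<in> space P. \<bar>T n \<omega> - s\<bar> > d} \<le> measure P {\<omega> \<in> space P. (T n \<omega> - \<mu> n) ^ 2 \<ge> (d / 2) ^ 2}"
      by (rule finite_measure_mono[OF sub]) (use meas in measurable)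
    also have "\<dots> \<le> (\<integral>\<omega>. (T n \<omega> - \<mu> n) ^ 2 \<partial>P) / (d / 2) ^ 2"
      by (rule integral_Markov_inequality_measure[OF C(1)[OF n], of "space P"]) (use d in auto)
    also have "\<dots> \<le> (C * (1 / real n)) / (d / 2) ^ 2"
      using C(2)[OF n] by (intro divide_right_mono) auto
    finally show "measure P {\<omega> \<in> space P. \<bar>T n \<omega> - s\<bar> > d} \<le> (1 / (d / 2) ^ 2) * (C * (1 / real n))"
      by (simp add: mult.commute)
  qed
  have lim: "(\<lambda>n. (1 / (d / 2) ^ 2) * (C * (1 / real n))) \<longlonglongrightarrow> 0"
    by (intro tendsto_mult_right_zero lim_1_over_n)
  have "(\<lambda>n. measure P {\<omega> \<in> space P. \<bar>T n \<omega> - s\<bar> > d}) \<longlonglongrightarrow> 0"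
    by (rule tendsto_sandwich[OF _ ev tendsto_const lim]) simp
  then show ?thesis using False by (simp add: normalized_trace_def T_def s_def)
qed

text \<open>The sum of the non-negative powers has finite expectation, hence is finite almost
  surely, and its terms tend to 0. This takes the place of a Borel-Cantelli argument.\<close>

lemma AE_tendsto_zero_of_summable_moments:
  fixes f :: "nat \<Rightarrow> 'w \<Rightarrow> real"
  assumes int: "\<And>n. n \<ge> 1 \<Longrightarrow> integrable P (\<lambda>\<omega>. f n \<omega> ^ r)"
    and le: "\<And>n. n \<ge> 1 \<Longrightarrow> (\<integral>\<omega>. f n \<omega> ^ r \<partial>P) \<le> g n"
    and g: "summable g" and r: "even r" "r > 0"
  shows "AE \<omega> in P. (\<lambda>n. f n \<omega>) \<longlonglongrightarrow> 0"
proof -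
  \<comment> \<open>The shift by one discards \<open>n = 0\<close>, where nothing is
    assumed.\<close>
  define h where "h = (\<lambda>n \<omega>. f (Suc n) \<omega> ^ r)"
  have h: "h n \<omega> \<ge> 0" "integrable P (h n)" "(\<integral>\<omega>. h n \<omega> \<partial>P) \<le> g (Suc n)" for n \<omega>
    using int[of "Suc n"] le[of "Suc n"] r(1) by (simp_all add: h_def zero_le_even_power)
  have g0: "g (Suc n) \<ge> 0" for n
    by (rule order_trans[OF Bochner_Integration.integral_nonneg h(3)]) (rule h(1))
  have gs: "summable (\<lambda>n. g (Suc n))" using g by (simp add: summable_Suc_iff)
  have meas: "h n \<in> borel_measurable P" for n using h(2) by simp
  have "(\<integral>\<^sup>+\<omega>. suminf (\<lambda>n. ennreal (h n \<omega>)) \<partial>P) = suminf (\<lambda>n. \<integral>\<^sup>+\<omega>. ennreal (h n \<omega>) \<partial>P)"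
    using meas by (intro nn_integral_suminf) simp
  also have "\<dots> = suminf (\<lambda>n. ennreal (\<integral>\<omega>. h n \<omega> \<partial>P))"
    by (intro suminf_cong nn_integral_eq_integral h AE_I2)
  also have "\<dots> \<le> suminf (\<lambda>n. ennreal (g (Suc n)))"
    by (intro suminf_le ennreal_leI h) auto
  also have "\<dots> = ennreal (suminf (\<lambda>n. g (Suc n)))"
    by (rule suminf_ennreal2[OF g0 gs])
  finally have fin: "(\<integral>\<^sup>+\<omega>. suminf (\<lambda>n. ennreal (h n \<omega>)) \<partial>P) \<noteq> \<infinity>" by (auto simp: top_unique)
  have "AE \<omega> in P. suminf (\<lambda>n. ennreal (h n \<omega>)) \<noteq> \<infinity>"
    by (rule nn_integral_PInf_AE[OF _ fin]) (use meas in measurable)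
  then show ?thesis
  proof (rule AE_mp, intro AE_I2 impI)
    fix \<omega> assume "suminf (\<lambda>n. ennreal (h n \<omega>)) \<noteq> \<infinity>"
    then have "summable (\<lambda>n. h n \<omega>)" using h(1) by (intro summable_suminf_not_top) (auto simp: top_ennreal_def)
    then have "(\<lambda>n. h n \<omega>) \<longlonglongrightarrow> 0" by (rule summable_LIMSEQ_zero)
    then have "(\<lambda>n. f (Suc n) \<omega>) \<longlonglongrightarrow> 0" unfolding h_def using r(2) by (simp add: power_tendsto_0_iff)
    then show "(\<lambda>n. f n \<omega>) \<longlonglongrightarrow> 0" by (rule LIMSEQ_imp_Suc)
  qed
qed

lemma normalized_trace_almost_surely:
  assumes P: "prob_space P" and ind: "independent_collections P x y"
    and regx: "regular_family P x" and regy: "regular_family P y"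
    and fac: "factorizing P x" "factorizing P y"
    and KX: "link_bounded LX KX" and KY: "link_bounded LY KY"
    and comp: "compatible LX LY" and jc: "jointly_circular LX LY"
  shows "AE \<omega> in P. (\<lambda>n. normalized_trace LX LY x y w n \<omega>) \<longlonglongrightarrow> real (stack_count (rev w) [])"
proof (cases "w = []")
  case True
  then show ?thesis by (simp add: normalized_trace_def)
next
  case False
  have "\<exists>C. \<forall>n\<ge>1. integrable P (\<lambda>\<omega>. fluctuation P LX LY x y w n \<omega> ^ 12) \<and>
     (\<integral>\<omega>. fluctuation P LX LY x y w n \<omega> ^ 12 \<partial>P) \<le> C * (1 / real n ^ 2)"
    by (rule word_moment_fluctuation[OF P ind regx regy KX KY _ _ False scaling_12]) (simp_all add: fac)
  then obtain C where C: "integrable P (\<lambda>\<omega>. fluctuation P LX LY x y w n \<omega> ^ 12)"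
    "(\<integral>\<omega>. fluctuation P LX LY x y w n \<omega> ^ 12 \<partial>P) \<le> C * (1 / real n ^ 2)" if "n \<ge> 1" for n
    by blast
  have "summable (\<lambda>n. C * (1 / real n ^ 2))"
    by (intro summable_mult) (use inverse_power_summable[of 2, where ?'a = real] in \<open>simp add: inverse_eq_divide\<close>)
  then have "AE \<omega> in P. (\<lambda>n. word_moment LX LY x y w n \<omega> - mean_word_moment P LX LY x y w n) \<longlonglongrightarrow> 0"
    using C by (intro AE_tendsto_zero_of_summable_moments[where r = 12 and g = "\<lambda>n. C * (1 / real n ^ 2)"]) simp_all
  then show ?thesis
  proof (rule AE_mp, intro AE_I2 impI)
    fix \<omega> assume "(\<lambda>n. word_moment LX LY x y w n \<omega> - mean_word_moment P LX LY x y w n) \<longlonglongrightarrow> 0"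
    from tendsto_add[OF this mean_word_moment_tendsto[OF regx regy KX KY comp jc False]]
    show "(\<lambda>n. normalized_trace LX LY x y w n \<omega>) \<longlonglongrightarrow> real (stack_count (rev w) [])"
      using False by (simp add: normalized_trace_def)
  qed
qed

lemma converges_in_probability_combination:
  fixes T :: "'k \<Rightarrow> nat \<Rightarrow> 'w \<Rightarrow> real" and q :: "'k \<Rightarrow> complex"
  assumes P: "prob_space P" and K: "finite K"
    and meas: "\<And>w n. T w n \<in> borel_measurable P"
    and lim: "\<And>w d. w \<in> K \<Longrightarrow> d > 0 \<Longrightarrow> (\<lambda>n. measure P {\<omega> \<in> space P. \<bar>T w n \<omega> - s w\<bar> > d}) \<longlonglongrightarrow> 0"
    and Z: "\<And>n \<omega>. n \<ge> 1 \<Longrightarrow> Z n \<omega> = (\<Sum>w\<in>K. q w * of_real (T w n \<omega>))"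
  shows "converges_in_probability P Z (\<Sum>w\<in>K. q w * of_real (s w))"
  unfolding converges_in_probability_def
proof (intro allI impI)
  interpret prob_space P by (rule P)
  fix e :: real assume e: "e > 0"
  let ?D = "\<lambda>n. {\<omega> \<in> space P. dist (Z n \<omega>) (\<Sum>w\<in>K. q w * of_real (s w)) > e}"
  \<comment> \<open>The added 1 keeps \<open>b\<close> positive even if the coefficients sum to 0.
    Deviations of at most \<open>e / b\<close> for every word add up to at most
    \<open>e\<close>.\<close>
  define b where "b = (\<Sum>w\<in>K. cmod (q w)) + 1"
  have b: "b > 0" unfolding b_def by (intro add_nonneg_pos sum_nonneg) auto
  define S where "S w n = {\<omega> \<in> space P. \<bar>T w n \<omega> - s w\<bar> > e / b}" for w n
  have S: "S w n \<in> sets P" for w n unfolding S_def using meas by measurable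
  have "measure P (?D n) \<le> (\<Sum>w\<in>K. measure P (S w n))"
    if n: "n \<ge> 1" for n
  proof -
    have "?D n \<subseteq> (\<Union>w\<in>K. S w n)"
    proof (rule subsetI, rule ccontr)
      fix \<omega> assume \<omega>: "\<omega> \<in> ?D n"
        and "\<omega> \<notin> (\<Union>w\<in>K. S w n)"
      then have small: "\<bar>T w n \<omega> - s w\<bar> \<le> e / b" if "w \<in> K" for w
        using that by (auto simp: S_def not_less)
      have "dist (Z n \<omega>) (\<Sum>w\<in>K. q w * of_real (s w)) = cmod (\<Sum>w\<in>K. q w * of_real (T w n \<omega> - s w))"
        unfolding Z[OF n] dist_norm by (simp add: sum_subtractf right_diff_distrib)
      also have "\<dots> \<le> (\<Sum>w\<in>K. cmod (q w) * \<bar>T w n \<omega> - s w\<bar>)"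
        by (rule order_trans[OF norm_sum]) (simp add: norm_mult del: of_real_diff)
      also have "\<dots> \<le> (\<Sum>w\<in>K. cmod (q w) * (e / b))"
        by (intro sum_mono mult_left_mono small) auto
      also have "\<dots> = (\<Sum>w\<in>K. cmod (q w)) * (e / b)" by (rule sum_distrib_right[symmetric])
      also have "\<dots> \<le> b * (e / b)" using e b by (intro mult_right_mono) (auto simp: b_def)
      also have "\<dots> = e" using b by simp
      finally show False using \<omega> by simp
    qed
    then have "measure P (?D n) \<le> measure P (\<Union>w\<in>K. S w n)"
      by (rule finite_measure_mono) (use K S in auto)
    also have "\<dots> \<le> (\<Sum>w\<in>K. measure P (S w n))"
      by (rule finite_measure_subadditive_finite[OF K]) (use S in auto)
    finally show ?thesis .
  qed
  then have ev: "\<forall>\<^sub>F n in sequentially. (measure P (?D n)) \<le> (\<Sum>w\<in>K. measure P (S w n))"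
    by (intro eventually_sequentiallyI[of 1]) simp
  have "(\<lambda>n. \<Sum>w\<in>K. measure P (S w n)) \<longlonglongrightarrow> (\<Sum>w\<in>K. 0)"
    unfolding S_def using e b by (intro tendsto_sum lim) auto
  then have lim0: "(\<lambda>n. \<Sum>w\<in>K. measure P (S w n)) \<longlonglongrightarrow> 0" by simp
  show "(\<lambda>n. measure P (?D n)) \<longlonglongrightarrow> 0"
    by (rule tendsto_sandwich[OF _ ev tendsto_const lim0]) simp
qed

theorem theorem3p4:
  fixes LX :: "nat \<Rightarrow> nat \<Rightarrow> int ^ 'd"
    and LY :: "nat \<Rightarrow> nat \<Rightarrow> int ^ 'e"
    and P :: "'w measure"
    and x :: "int ^ 'd \<Rightarrow> 'w \<Rightarrow> real"
    and y :: "int ^ 'e \<Rightarrow> 'w \<Rightarrow> real"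
    and A :: "('a, 'm) star_prob_struct_scheme"
    and c :: 'a
  assumes "max (link_Delta LX) (link_Delta LY) < \<infinity>"
    and "compatible LX LY"
    and "jointly_circular LX LY"
    and "prob_space P"
    and "\<And>\<alpha>. x \<alpha> \<in> borel_measurable P"
    and "\<And>\<beta>. y \<beta> \<in> borel_measurable P"
    and "star_prob_space A"
    and "circular A c"
  shows "(independent_collections P x y \<and>
          admissible_SMS P UNIV x \<and> uniformly_bounded_moments P x \<and>
          admissible_SMS P UNIV y \<and> uniformly_bounded_moments P y \<longrightarrow>
            (\<forall>Q. converges_in_probability P
              (\<lambda>n \<omega>. 1 / of_nat n *
                 mat_trace (nc_eval (mat_prob n) Q (scaled_link_matrix LX LY x y n \<omega>)))
              (state A (nc_eval A Q c)))) \<and>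
         (independent_collections P x y \<and>
          independent_standardized P x \<and> uniformly_bounded_moments P x \<and>
          independent_standardized P y \<and> uniformly_bounded_moments P y \<longrightarrow>
            (AE \<omega> in P. \<forall>Q.
              (\<lambda>n. 1 / of_nat n *
                 mat_trace (nc_eval (mat_prob n) Q (scaled_link_matrix LX LY x y n \<omega>)))
              \<longlonglongrightarrow> state A (nc_eval A Q c)) \<and>
            (AE \<omega> in P. converges_in_star_distribution mat_prob
              (\<lambda>n. scaled_link_matrix LX LY x y n \<omega>) A c))"
proof (intro conjI impI allI)
  note comp = assms(2) and jc = assms(3) and P = assms(4) and mx = assms(5) and my = assms(6)
    and A = assms(7) and c = assms(8)
  have "link_Delta LX < \<infinity>" "link_Delta LY < \<infinity>"
    using assms(1) unfolding max_less_iff_conj by blast+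
  from this(1) obtain KX where KX: "link_bounded LX KX"
    by (rule link_bounded_of_Delta) (rule that)
  from \<open>link_Delta LY < \<infinity>\<close> obtain KY where KY: "link_bounded LY KY"
    by (rule link_bounded_of_Delta) (rule that)
  note circ = state_nc_eval_circular[OF A c]
  let ?T = "normalized_trace LX LY x y"
  {
    fix Q
    assume "independent_collections P x y \<and>
          admissible_SMS P UNIV x \<and> uniformly_bounded_moments P x \<and>
          admissible_SMS P UNIV y \<and> uniformly_bounded_moments P y"
    then have ind: "independent_collections P x y" and regx: "regular_family P x" and regy: "regular_family P y"
      using regular_family_SMS[OF P _ _ mx] regular_family_SMS[OF P _ _ my] by auto
    have meas: "?T w n \<in> borel_measurable P" for w n
      unfolding normalized_trace_def word_moment_def
      using mx my by (cases "w = []") (auto intro!: borel_measurable_times borel_measurable_sum borel_measurable_prod)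
    show "converges_in_probability P
              (\<lambda>n \<omega>. 1 / of_nat n *
                 mat_trace (nc_eval (mat_prob n) Q (scaled_link_matrix LX LY x y n \<omega>)))
              (state A (nc_eval A Q c))"
      unfolding circ(2)
    proof (rule converges_in_probability_combination[where T = ?T, OF P finite_keys meas])
      show "(\<lambda>n. measure P {\<omega> \<in> space P. \<bar>?T w n \<omega> - real (stack_count (rev w) [])\<bar> > d}) \<longlonglongrightarrow> 0"
        if "d > 0" for w d
        by (rule normalized_trace_in_probability[OF P ind regx regy KX KY comp jc that])
      show "1 / of_nat n * mat_trace (nc_eval (mat_prob n) Q (scaled_link_matrix LX LY x y n \<omega>)) =
          (\<Sum>w\<in>Poly_Mapping.keys Q. Poly_Mapping.lookup Q w * of_real (?T w n \<omega>))" if "n \<ge> 1" for n \<omega>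
        by (rule trace_nc_eval[OF that])
    qed
  }
  {
    assume "independent_collections P x y \<and>
          independent_standardized P x \<and> uniformly_bounded_moments P x \<and>
          independent_standardized P y \<and> uniformly_bounded_moments P y"
    then have ind: "independent_collections P x y" and regx: "regular_family P x" and regy: "regular_family P y"
      and fac: "factorizing P x" "factorizing P y"
      using regular_family_independent[OF P _ _ mx] regular_family_independent[OF P _ _ my] by auto
    \<comment> \<open>Words are countable, polynomials with complex coefficients are not. The null
      set is therefore chosen for the words, and off it every polynomial converges as a finite
      combination of words.\<close>
    have "AE \<omega> in P. \<forall>w. (\<lambda>n. ?T w n \<omega>) \<longlonglongrightarrow> real (stack_count (rev w) [])"
      unfolding AE_all_countable
      using normalized_trace_almost_surely[OF P ind regx regy fac KX KY comp jc] by blast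
    then show all: "AE \<omega> in P. \<forall>Q.
              (\<lambda>n. 1 / of_nat n *
                 mat_trace (nc_eval (mat_prob n) Q (scaled_link_matrix LX LY x y n \<omega>)))
              \<longlonglongrightarrow> state A (nc_eval A Q c)"
    proof (rule AE_mp, intro AE_I2 impI allI)
      fix \<omega> Q assume "\<forall>w. (\<lambda>n. ?T w n \<omega>) \<longlonglongrightarrow> real (stack_count (rev w) [])"
      then have "(\<lambda>n. \<Sum>w\<in>Poly_Mapping.keys Q. Poly_Mapping.lookup Q w * of_real (?T w n \<omega>))
          \<longlonglongrightarrow> state A (nc_eval A Q c)"
        unfolding circ(2) by (intro tendsto_sum tendsto_mult tendsto_const tendsto_of_real) simp
      \<comment> \<open>The trace formula requires \<open>n \<ge> 1\<close>, hence only an eventual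
        equality.\<close>
      moreover have "\<forall>\<^sub>F n in sequentially. (\<Sum>w\<in>Poly_Mapping.keys Q. Poly_Mapping.lookup Q w * of_real (?T w n \<omega>)) =
          1 / of_nat n * mat_trace (nc_eval (mat_prob n) Q (scaled_link_matrix LX LY x y n \<omega>))"
        using trace_nc_eval[of _ Q LX LY x y \<omega>] by (intro eventually_sequentiallyI[of 1]) (rule sym)
      ultimately show "(\<lambda>n. 1 / of_nat n *
                 mat_trace (nc_eval (mat_prob n) Q (scaled_link_matrix LX LY x y n \<omega>)))
              \<longlonglongrightarrow> state A (nc_eval A Q c)"
        by (rule Lim_transform_eventually)
    qed
    then show "AE \<omega> in P. converges_in_star_distribution mat_prob
              (\<lambda>n. scaled_link_matrix LX LY x y n \<omega>) A c"
    proof (rule AE_mp, intro AE_I2 impI)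
      fix \<omega> assume lim: "\<forall>Q. (\<lambda>n. 1 / of_nat n *
                 mat_trace (nc_eval (mat_prob n) Q (scaled_link_matrix LX LY x y n \<omega>)))
              \<longlonglongrightarrow> state A (nc_eval A Q c)"
      then show "converges_in_star_distribution mat_prob (\<lambda>n. scaled_link_matrix LX LY x y n \<omega>) A c"
        unfolding converges_in_star_distribution_def
        using star_prob_space_mat A circ(1) by (simp add: scaled_link_matrix_carrier)
    qed
  }
qed

end
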